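(* Let $\mathcal E$ be a category with pullbacks, and with coequalisers that are preserved by pullbacks. The equipment $\mathsf{Prof}(\mathcal E)$ of profunctors internal in $\mathcal E$ admits opcartesian tabulations; that is, every internal profunctor $J\colon A\nrightarrow B$ has a tabulation in $\mathsf{Prof}(\mathcal E)$ whose defining cell is opcartesian.
   Context: **Double categories.** Double categories are weak (pseudo) double categories. A double category $\mathcal K$ has objects; vertical morphisms $f\colon A\to C$, forming a category; horizontal morphisms $J\colon A\nrightarrow B$; and square cells. A cell $\phi\colon J\Rightarrow K$, where $J\colon A\nrightarrow B$ and $K\colon C\nrightarrow D$, has a vertical source $f\colon A\to C$ and a vertical target $g\colon B\to D$. Cells compose vertically, written $\psi\circ\phi$, strictly. Horizontal composition is written in diagrammatic order: $J\colon A\nrightarrow B$ and $H\colon B\nrightarrow E$ compose to $J\odot H\colon A\nrightarrow E$, and cells $\phi\colon J\Rightarrow K$, $\chi\colon H\Rightarrow L$ such that the vertical target of $\phi$ equals the vertical source of $\chi$ compose to $\phi\odot\chi\colon J\odot H\Rightarrow K\odot L$. There are horizontal units $1_A$ and unit cells $1_f\colon 1_A\Rightarrow 1_C$ with vertical source and target $f$. Horizontal composition is associative and unital up to coherent invertible cells, which are suppressed from the notation. An equipment is a double category with specified companions and conjoints of all vertical morphisms. **Spans.** A span from $A_0$ to $B_0$ in $\mathcal E$ is a diagram $A_0\xleftarrow{d_0}J\xrightarrow{d_1}B_0$. Spans $J$ from $A_0$ to $B_0$ and $H$ from $B_0$ to $E_0$ compose to $J\times_{B_0}H$, the pullback of $d_1\colon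 J\to B_0$ and $d_0\colon H\to B_0$, with the evident outer legs. For maps $f_0\colon A_0\to C_0$, $g_0\colon B_0\to D_0$, a cell of spans from $J$ to $A'=[C_0\leftarrow K\to D_0]$ over $f_0,g_0$ is a map $\phi\colon J\to K$ with $d_0\circ\phi=f_0\circ d_0$ and $d_1\circ\phi=g_0\circ d_1$. **The double category $\mathsf{Prof}(\mathcal E)$.** Objects are internal categories $A=(A,m_A,e_A)$ in $\mathcal E$: a span $A_0\xleftarrow{d_0}A\xrightarrow{d_1}A_0$ with multiplication $m_A\colon A\times_{A_0}A\to A$ and unit $e_A\colon A_0\to A$, maps of spans satisfying associativity and unit laws. Vertical morphisms are internal functors $f\colon A\to C$: maps $f_0\colon A_0\to C_0$ and $f\colon A\to C$ compatible with source, target, multiplication and unit. Horizontal morphisms $J\colon A\nrightarrow B$ are internal profunctors: spans $A_0\xleftarrow{d_0}J\xrightarrow{d_1}B_0$ with actions $l\colon A\times_{A_0}J\to J$ and $r\colon J\times_{B_0}B\to J$, maps of spans that are associative and unital with respect to the structures of $A$ and $B$ and satisfy $r\circ(l\times\mathrm{id}_B)=l\circ(\mathrm{id}_A\times r)$. A cell $\phi\colon J\Rightarrow K$, with vertical source $f\colon A\to C$ and vertical target $g\colon B\to D$, is a map $\phi\colon J\to K$ of spans over $f_0,g_0$ such that $l\circ(f\times_{f_0}\phi)=\phi\circ l\colon A\times_{A_0}J\to K$ and $r\circ(\phi\times_{g_0}g)=\phi\circ r\colon J\times_{B_0}B\to K$. Vertical composition of cells is composition in $\mathcal E$. The horizontal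 composite of $J\colon A\nrightarrow B$ and $H\colon B\nrightarrow E$ is the coequaliser $J\odot H$ of the two maps $J\times_{B_0}B\times_{B_0}H\rightrightarrows J\times_{B_0}H$ given by the actions of $B$ on $J$ and $H$, with the induced actions of $A$ and $E$; horizontal composites of cells are induced by the universal property of coequalisers. The unit $1_A$ is $A$ itself with both actions given by $m_A$. $\mathsf{Prof}(\mathcal E)$ is an equipment: the companion of $f\colon A\to C$ can be taken to be the span $A_0\leftarrow A_0\times_{C_0}C\to C\xrightarrow{d_1}C_0$ (pullback of $f_0$ and $d_0\colon C\to C_0$) with the evident actions, and conjoints are similar. **Opcartesian cells.** A cell $\phi\colon J\Rightarrow K$ with vertical source $f$ and vertical target $g$ is opcartesian if every cell $\chi\colon J\Rightarrow L$ with vertical source $h\circ f$ and vertical target $k\circ g$ factors as $\chi=\chi'\circ\phi$ for a unique cell $\chi'\colon K\Rightarrow L$ with vertical source $h$ and vertical target $k$. **Tabulations.** A tabulation of $J\colon A\nrightarrow B$ is an object $\langle J\rangle$ with a cell $\pi\colon 1_{\langle J\rangle}\Rightarrow J$, with vertical source $\pi_A\colon\langle J\rangle\to A$ and vertical target $\pi_B\colon\langle J\rangle\to B$, such that: (1-dimensional property) for every cell $\phi\colon 1_X\Rightarrow J$, with vertical source $\phi_A$ and vertical target $\phi_B$, there is a unique vertical morphism $\phi'\colon X\to\langle J\rangle$ with $\pi\circ 1_{\phi'}=\phi$ (in particular $\pi_A\circ\phi'=\phi_A$ and $\pi_B\circ\phi'=\phi_B$, strictly); (2-dimensional property) given cells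 $\phi\colon 1_X\Rightarrow J$ and $\psi\colon 1_Y\Rightarrow J$, factoring as $\phi'\colon X\to\langle J\rangle$ and $\psi'\colon Y\to\langle J\rangle$, a horizontal morphism $H\colon X\nrightarrow Y$ and cells $\xi_A\colon H\Rightarrow 1_A$ (vertical source $\phi_A$, vertical target $\psi_A$) and $\xi_B\colon H\Rightarrow 1_B$ (vertical source $\phi_B$, vertical target $\psi_B$) with $\xi_A\odot\psi=\phi\odot\xi_B$, there is a unique cell $\xi'\colon H\Rightarrow 1_{\langle J\rangle}$ with vertical source $\phi'$ and vertical target $\psi'$ such that $1_{\pi_A}\circ\xi'=\xi_A$ and $1_{\pi_B}\circ\xi'=\xi_B$. The tabulation is opcartesian if the cell $\pi$ is opcartesian. *)

theory Defs
  imports Main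
begin

section \<open>Categories with pullbacks and stable coequalisers\<close>

record ('o, 'm) cat =
  Ob  :: "'o set"
  Mor :: "'m set"
  Dom :: "'m \<Rightarrow> 'o"
  Cod :: "'m \<Rightarrow> 'o"
  Ide :: "'o \<Rightarrow> 'm"
  Comp :: "'m \<Rightarrow> 'm \<Rightarrow> 'm"  (infixr "\<cdot>\<index>" 70)

text \<open>Composites are written in the order of application, so \<open>g \<cdot> f\<close> is meaningful when
  \<open>Cod f = Dom g\<close>; other values of \<open>Comp\<close>, and values of \<open>Dom\<close>, \<open>Cod\<close>, \<open>Ide\<close> outside
  \<open>Mor\<close> and \<open>Ob\<close>, are unconstrained.\<close>

definition hom :: "('o, 'm, 'x) cat_scheme \<Rightarrow> 'o \<Rightarrow> 'o \<Rightarrow> 'm set" where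
  "hom E a b = {f \<in> Mor E. Dom E f = a \<and> Cod E f = b}"

locale category =
  fixes E :: "('o, 'm, 'x) cat_scheme" (structure)
  assumes Dom_in_Ob: "f \<in> Mor E \<Longrightarrow> Dom E f \<in> Ob E"
    and Cod_in_Ob: "f \<in> Mor E \<Longrightarrow> Cod E f \<in> Ob E"
    and Ide_in_hom: "a \<in> Ob E \<Longrightarrow> Ide E a \<in> hom E a a"
    and Comp_in_hom: "f \<in> hom E a b \<Longrightarrow> g \<in> hom E b c \<Longrightarrow> g \<cdot> f \<in> hom E a c"
    and Comp_Ide: "f \<in> hom E a b \<Longrightarrow> f \<cdot> Ide E a = f"
    and Ide_Comp: "f \<in> hom E a b \<Longrightarrow> Ide E b \<cdot> f = f"
    and Comp_assoc:
      "f \<in> hom E a b \<Longrightarrow> g \<in> hom E b c \<Longrightarrow> h \<in> hom E c d \<Longrightarrow> (h \<cdot> g) \<cdot> f = h \<cdot> (g \<cdot> f)"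

definition is_pullback :: "('o, 'm, 'x) cat_scheme \<Rightarrow> 'm \<Rightarrow> 'm \<Rightarrow> 'm \<Rightarrow> 'm \<Rightarrow> bool" where
  "is_pullback E f g p q \<longleftrightarrow>
     f \<in> Mor E \<and> g \<in> Mor E \<and> Cod E f = Cod E g \<and>
     p \<in> Mor E \<and> q \<in> Mor E \<and> Dom E p = Dom E q \<and> Cod E p = Dom E f \<and> Cod E q = Dom E g \<and>
     f \<cdot>\<^bsub>E\<^esub> p = g \<cdot>\<^bsub>E\<^esub> q \<and>
     (\<forall>z. \<forall>x \<in> hom E z (Dom E f). \<forall>y \<in> hom E z (Dom E g). f \<cdot>\<^bsub>E\<^esub> x = g \<cdot>\<^bsub>E\<^esub> y \<longrightarrow>
        (\<exists>!h. h \<in> hom E z (Dom E p) \<and> p \<cdot>\<^bsub>E\<^esub> h = x \<and> q \<cdot>\<^bsub>E\<^esub> h = y))"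

definition is_coequaliser :: "('o, 'm, 'x) cat_scheme \<Rightarrow> 'm \<Rightarrow> 'm \<Rightarrow> 'm \<Rightarrow> bool" where
  "is_coequaliser E u v q \<longleftrightarrow>
     u \<in> Mor E \<and> v \<in> Mor E \<and> Dom E u = Dom E v \<and> Cod E u = Cod E v \<and>
     q \<in> Mor E \<and> Dom E q = Cod E u \<and> q \<cdot>\<^bsub>E\<^esub> u = q \<cdot>\<^bsub>E\<^esub> v \<and>
     (\<forall>z. \<forall>t \<in> hom E (Cod E u) z. t \<cdot>\<^bsub>E\<^esub> u = t \<cdot>\<^bsub>E\<^esub> v \<longrightarrow>
        (\<exists>!s. s \<in> hom E (Cod E q) z \<and> s \<cdot>\<^bsub>E\<^esub> q = t))"

text \<open>The double category of profunctors is built from chosen pullbacks and coequalisers;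
  the choices are given as operations and are otherwise arbitrary.\<close>

record ('o, 'm) cat_choice = "('o, 'm) cat" +
  Pb1 :: "'m \<Rightarrow> 'm \<Rightarrow> 'm"
  Pb2 :: "'m \<Rightarrow> 'm \<Rightarrow> 'm"
  Coeq :: "'m \<Rightarrow> 'm \<Rightarrow> 'm"

definition has_pullbacks :: "('o, 'm, 'x) cat_choice_scheme \<Rightarrow> bool" where
  "has_pullbacks E \<longleftrightarrow>
     (\<forall>f \<in> Mor E. \<forall>g \<in> Mor E. Cod E f = Cod E g \<longrightarrow> is_pullback E f g (Pb1 E f g) (Pb2 E f g))"

definition has_coequalisers :: "('o, 'm, 'x) cat_choice_scheme \<Rightarrow> bool" where
  "has_coequalisers E \<longleftrightarrow>
     (\<forall>u \<in> Mor E. \<forall>v \<in> Mor E. Dom E u = Dom E v \<longrightarrow> Cod E u = Cod E v \<longrightarrow>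
        is_coequaliser E u v (Coeq E u v))"

text \<open>The map \<open>\<langle>x, y\<rangle>\<close> into the chosen pullback of \<open>f\<close> and \<open>g\<close>.\<close>

definition pair :: "('o, 'm, 'x) cat_choice_scheme \<Rightarrow> 'm \<Rightarrow> 'm \<Rightarrow> 'm \<Rightarrow> 'm \<Rightarrow> 'm" where
  "pair E f g x y = (THE h. h \<in> hom E (Dom E x) (Dom E (Pb1 E f g)) \<and>
     Pb1 E f g \<cdot>\<^bsub>E\<^esub> h = x \<and> Pb2 E f g \<cdot>\<^bsub>E\<^esub> h = y)"

text \<open>The value at \<open>w \<colon> (P, h \<cdot> w) \<rightarrow> (Q, h)\<close> of the functor \<open>E/Y \<rightarrow> E/X\<close> that pulls back
  along \<open>f \<colon> X \<rightarrow> Y\<close>.\<close>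

definition pullback_map :: "('o, 'm, 'x) cat_choice_scheme \<Rightarrow> 'm \<Rightarrow> 'm \<Rightarrow> 'm \<Rightarrow> 'm" where
  "pullback_map E f h w =
     pair E f h (Pb1 E f (h \<cdot>\<^bsub>E\<^esub> w)) (w \<cdot>\<^bsub>E\<^esub> Pb2 E f (h \<cdot>\<^bsub>E\<^esub> w))"

text \<open>Coequalisers in \<open>E/Y\<close> are coequalisers \<open>q\<close> of \<open>u, v\<close> in \<open>E\<close> together with a map
  \<open>g \<colon> Cod q \<rightarrow> Y\<close>.\<close>

definition pullbacks_preserve_coequalisers :: "('o, 'm, 'x) cat_choice_scheme \<Rightarrow> bool" where
  "pullbacks_preserve_coequalisers E \<longleftrightarrow>
     (\<forall>u v q f g. is_coequaliser E u v q \<longrightarrow> f \<in> Mor E \<longrightarrow> g \<in> hom E (Cod E q) (Cod E f) \<longrightarrow>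
        is_coequaliser E (pullback_map E f (g \<cdot>\<^bsub>E\<^esub> q) u) (pullback_map E f (g \<cdot>\<^bsub>E\<^esub> q) v)
          (pullback_map E f g q))"

text \<open>The factorisation of \<open>t\<close> through \<open>q\<close>, used for maps \<open>q\<close> that are coequalisers.\<close>

definition desc :: "('o, 'm, 'x) cat_scheme \<Rightarrow> 'm \<Rightarrow> 'm \<Rightarrow> 'm" where
  "desc E q t = (THE s. s \<in> hom E (Cod E q) (Cod E t) \<and> s \<cdot>\<^bsub>E\<^esub> q = t)"

section \<open>Double categories\<close>

text \<open>The structure of a pseudo double category. A square \<open>\<phi> \<colon> J \<Rightarrow> K\<close> has horizontal boundary
  \<open>sqtop \<phi> = J\<close>, \<open>sqbot \<phi> = K\<close> and vertical source and target \<open>sqlft \<phi>\<close>, \<open>sqrgt \<phi>\<close>.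
  Horizontal composition (\<open>hcomp\<close>, \<open>hcell\<close>) is in diagrammatic order, vertical composition in
  the order of application. The cells \<open>lunit J \<colon> 1 \<odot> J \<Rightarrow> J\<close>,
  \<open>runit J \<colon> J \<odot> 1 \<Rightarrow> J\<close> and \<open>assoc J H K \<colon> (J \<odot> H) \<odot> K \<Rightarrow> J \<odot> (H \<odot> K)\<close> are the coherence
  cells.\<close>

record ('o, 'v, 'h, 'c) double_category =
  Vert :: "('o, 'v) cat"
  Hor :: "'h set"
  hsrc :: "'h \<Rightarrow> 'o"
  htrg :: "'h \<Rightarrow> 'o"
  Sq :: "'c set"
  sqtop :: "'c \<Rightarrow> 'h"
  sqbot :: "'c \<Rightarrow> 'h"
  sqlft :: "'c \<Rightarrow> 'v"
  sqrgt :: "'c \<Rightarrow> 'v"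
  vid :: "'h \<Rightarrow> 'c"
  vcomp :: "'c \<Rightarrow> 'c \<Rightarrow> 'c"
  hunit :: "'o \<Rightarrow> 'h"
  ucell :: "'v \<Rightarrow> 'c"
  hcomp :: "'h \<Rightarrow> 'h \<Rightarrow> 'h"
  hcell :: "'c \<Rightarrow> 'c \<Rightarrow> 'c"
  lunit :: "'h \<Rightarrow> 'c"
  runit :: "'h \<Rightarrow> 'c"
  assoc :: "'h \<Rightarrow> 'h \<Rightarrow> 'h \<Rightarrow> 'c"

definition is_cell ::
  "('o, 'v, 'h, 'c, 'x) double_category_scheme \<Rightarrow> 'c \<Rightarrow> 'h \<Rightarrow> 'h \<Rightarrow> 'v \<Rightarrow> 'v \<Rightarrow> bool" where
  "is_cell D \<phi> J K f g \<longleftrightarrow>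
     \<phi> \<in> Sq D \<and> sqtop D \<phi> = J \<and> sqbot D \<phi> = K \<and> sqlft D \<phi> = f \<and> sqrgt D \<phi> = g"

definition vinv :: "('o, 'v, 'h, 'c, 'x) double_category_scheme \<Rightarrow> 'c \<Rightarrow> 'c" where
  "vinv D \<alpha> = (THE \<beta>. \<beta> \<in> Sq D \<and> sqtop D \<beta> = sqbot D \<alpha> \<and> sqbot D \<beta> = sqtop D \<alpha> \<and>
     vcomp D \<beta> \<alpha> = vid D (sqtop D \<alpha>) \<and> vcomp D \<alpha> \<beta> = vid D (sqbot D \<alpha>))"

definition opcartesian :: "('o, 'v, 'h, 'c, 'x) double_category_scheme \<Rightarrow> 'c \<Rightarrow> bool" where
  "opcartesian D \<phi> \<longleftrightarrow> \<phi> \<in> Sq D \<and>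
     (\<forall>L h k \<chi>. h \<in> Mor (Vert D) \<longrightarrow> k \<in> Mor (Vert D) \<longrightarrow>
        Dom (Vert D) h = Cod (Vert D) (sqlft D \<phi>) \<longrightarrow>
        Dom (Vert D) k = Cod (Vert D) (sqrgt D \<phi>) \<longrightarrow>
        is_cell D \<chi> (sqtop D \<phi>) L (h \<cdot>\<^bsub>Vert D\<^esub> sqlft D \<phi>) (k \<cdot>\<^bsub>Vert D\<^esub> sqrgt D \<phi>) \<longrightarrow>
        (\<exists>!\<chi>'. is_cell D \<chi>' (sqbot D \<phi>) L h k \<and> vcomp D \<chi>' \<phi> = \<chi>))"

definition tabulation_1dim ::
  "('o, 'v, 'h, 'c, 'x) double_category_scheme \<Rightarrow> 'h \<Rightarrow> 'o \<Rightarrow> 'c \<Rightarrow> bool" where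
  "tabulation_1dim D J T \<pi> \<longleftrightarrow>
     (\<forall>X \<phi> \<phi>\<^sub>A \<phi>\<^sub>B. X \<in> Ob (Vert D) \<longrightarrow> is_cell D \<phi> (hunit D X) J \<phi>\<^sub>A \<phi>\<^sub>B \<longrightarrow>
        (\<exists>!\<phi>'. \<phi>' \<in> hom (Vert D) X T \<and> vcomp D \<pi> (ucell D \<phi>') = \<phi>))"

text \<open>In the compatibility condition on \<open>\<xi>\<^sub>A\<close> and \<open>\<xi>\<^sub>B\<close>, the cells
  \<open>\<xi>\<^sub>A \<odot> \<psi> \<colon> H \<odot> 1\<^sub>Y \<Rightarrow> 1\<^sub>A \<odot> J\<close> and \<open>\<phi> \<odot> \<xi>\<^sub>B \<colon> 1\<^sub>X \<odot> H \<Rightarrow> J \<odot> 1\<^sub>B\<close> are compared as cells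
  \<open>H \<Rightarrow> J\<close> by means of the unit coherence cells.\<close>

definition tabulation_2dim ::
  "('o, 'v, 'h, 'c, 'x) double_category_scheme \<Rightarrow> 'h \<Rightarrow> 'o \<Rightarrow> 'c \<Rightarrow> bool" where
  "tabulation_2dim D J T \<pi> \<longleftrightarrow>
     (\<forall>X Y \<phi> \<psi> \<phi>\<^sub>A \<phi>\<^sub>B \<psi>\<^sub>A \<psi>\<^sub>B \<phi>' \<psi>' H \<xi>\<^sub>A \<xi>\<^sub>B.
        X \<in> Ob (Vert D) \<longrightarrow> Y \<in> Ob (Vert D) \<longrightarrow>
        is_cell D \<phi> (hunit D X) J \<phi>\<^sub>A \<phi>\<^sub>B \<longrightarrow> is_cell D \<psi> (hunit D Y) J \<psi>\<^sub>A \<psi>\<^sub>B \<longrightarrow>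
        \<phi>' \<in> hom (Vert D) X T \<longrightarrow> vcomp D \<pi> (ucell D \<phi>') = \<phi> \<longrightarrow>
        \<psi>' \<in> hom (Vert D) Y T \<longrightarrow> vcomp D \<pi> (ucell D \<psi>') = \<psi> \<longrightarrow>
        H \<in> Hor D \<longrightarrow> hsrc D H = X \<longrightarrow> htrg D H = Y \<longrightarrow>
        is_cell D \<xi>\<^sub>A H (hunit D (hsrc D J)) \<phi>\<^sub>A \<psi>\<^sub>A \<longrightarrow>
        is_cell D \<xi>\<^sub>B H (hunit D (htrg D J)) \<phi>\<^sub>B \<psi>\<^sub>B \<longrightarrow>
        vcomp D (lunit D J) (vcomp D (hcell D \<xi>\<^sub>A \<psi>) (vinv D (runit D H))) =
        vcomp D (runit D J) (vcomp D (hcell D \<phi> \<xi>\<^sub>B) (vinv D (lunit D H))) \<longrightarrow>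
        (\<exists>!\<xi>'. is_cell D \<xi>' H (hunit D T) \<phi>' \<psi>' \<and>
               vcomp D (ucell D (sqlft D \<pi>)) \<xi>' = \<xi>\<^sub>A \<and>
               vcomp D (ucell D (sqrgt D \<pi>)) \<xi>' = \<xi>\<^sub>B))"

definition is_tabulation ::
  "('o, 'v, 'h, 'c, 'x) double_category_scheme \<Rightarrow> 'h \<Rightarrow> 'o \<Rightarrow> 'c \<Rightarrow> bool" where
  "is_tabulation D J T \<pi> \<longleftrightarrow>
     T \<in> Ob (Vert D) \<and> (\<exists>\<pi>\<^sub>A \<pi>\<^sub>B. is_cell D \<pi> (hunit D T) J \<pi>\<^sub>A \<pi>\<^sub>B) \<and>
     tabulation_1dim D J T \<pi> \<and> tabulation_2dim D J T \<pi>"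

definition admits_opcartesian_tabulations ::
  "('o, 'v, 'h, 'c, 'x) double_category_scheme \<Rightarrow> bool" where
  "admits_opcartesian_tabulations D \<longleftrightarrow>
     (\<forall>J \<in> Hor D. \<exists>T \<pi>. is_tabulation D J T \<pi> \<and> opcartesian D \<pi>)"

section \<open>Spans\<close>

record ('o, 'm) span =
  apex :: 'o
  leg0 :: 'm
  leg1 :: 'm

definition is_span ::
  "('o, 'm, 'x) cat_scheme \<Rightarrow> 'o \<Rightarrow> 'o \<Rightarrow> ('o, 'm, 'y) span_scheme \<Rightarrow> bool" where
  "is_span E a b J \<longleftrightarrow>
     a \<in> Ob E \<and> b \<in> Ob E \<and> apex J \<in> Ob E \<and> leg0 J \<in> hom E (apex J) a \<and> leg1 J \<in> hom E (apex J) b"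

text \<open>\<open>\<phi>\<close> is a cell of spans from \<open>J\<close> to \<open>K\<close> over \<open>f\<close> and \<open>g\<close>.\<close>

definition span_cell :: "('o, 'm, 'x) cat_scheme \<Rightarrow> 'm \<Rightarrow> 'm \<Rightarrow>
    ('o, 'm, 'y) span_scheme \<Rightarrow> ('o, 'm, 'z) span_scheme \<Rightarrow> 'm \<Rightarrow> bool" where
  "span_cell E f g J K \<phi> \<longleftrightarrow> \<phi> \<in> hom E (apex J) (apex K) \<and>
     leg0 K \<cdot>\<^bsub>E\<^esub> \<phi> = f \<cdot>\<^bsub>E\<^esub> leg0 J \<and> leg1 K \<cdot>\<^bsub>E\<^esub> \<phi> = g \<cdot>\<^bsub>E\<^esub> leg1 J"

definition unit_span :: "('o, 'm, 'x) cat_scheme \<Rightarrow> 'o \<Rightarrow> ('o, 'm) span" where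
  "unit_span E a = \<lparr>apex = a, leg0 = Ide E a, leg1 = Ide E a\<rparr>"

definition sp1 :: "('o, 'm, 'x) cat_choice_scheme \<Rightarrow>
    ('o, 'm, 'y) span_scheme \<Rightarrow> ('o, 'm, 'z) span_scheme \<Rightarrow> 'm" where
  "sp1 E J H = Pb1 E (leg1 J) (leg0 H)"

definition sp2 :: "('o, 'm, 'x) cat_choice_scheme \<Rightarrow>
    ('o, 'm, 'y) span_scheme \<Rightarrow> ('o, 'm, 'z) span_scheme \<Rightarrow> 'm" where
  "sp2 E J H = Pb2 E (leg1 J) (leg0 H)"

definition spcomp :: "('o, 'm, 'x) cat_choice_scheme \<Rightarrow>
    ('o, 'm, 'y) span_scheme \<Rightarrow> ('o, 'm, 'z) span_scheme \<Rightarrow> ('o, 'm) span" where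
  "spcomp E J H = \<lparr>apex = Dom E (sp1 E J H),
     leg0 = leg0 J \<cdot>\<^bsub>E\<^esub> sp1 E J H, leg1 = leg1 H \<cdot>\<^bsub>E\<^esub> sp2 E J H\<rparr>"

definition spair :: "('o, 'm, 'x) cat_choice_scheme \<Rightarrow>
    ('o, 'm, 'y) span_scheme \<Rightarrow> ('o, 'm, 'z) span_scheme \<Rightarrow> 'm \<Rightarrow> 'm \<Rightarrow> 'm" where
  "spair E J H x y = pair E (leg1 J) (leg0 H) x y"

text \<open>\<open>x \<times> y \<colon> J \<times> H \<rightarrow> J' \<times> H'\<close> for composites of spans.\<close>

definition smap :: "('o, 'm, 'x) cat_choice_scheme \<Rightarrow>
    ('o, 'm, 'y) span_scheme \<Rightarrow> ('o, 'm, 'z) span_scheme \<Rightarrow>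
    ('o, 'm, 'u) span_scheme \<Rightarrow> ('o, 'm, 'w) span_scheme \<Rightarrow> 'm \<Rightarrow> 'm \<Rightarrow> 'm" where
  "smap E J H J' H' x y = spair E J' H' (x \<cdot>\<^bsub>E\<^esub> sp1 E J H) (y \<cdot>\<^bsub>E\<^esub> sp2 E J H)"

text \<open>The canonical isomorphism \<open>(J \<times> H) \<times> K \<rightarrow> J \<times> (H \<times> K)\<close>.\<close>

definition sassoc :: "('o, 'm, 'x) cat_choice_scheme \<Rightarrow>
    ('o, 'm, 'y) span_scheme \<Rightarrow> ('o, 'm, 'z) span_scheme \<Rightarrow> ('o, 'm, 'w) span_scheme \<Rightarrow> 'm" where
  "sassoc E J H K = spair E J (spcomp E H K)
     (sp1 E J H \<cdot>\<^bsub>E\<^esub> sp1 E (spcomp E J H) K)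
     (spair E H K (sp2 E J H \<cdot>\<^bsub>E\<^esub> sp1 E (spcomp E J H) K) (sp2 E (spcomp E J H) K))"

section \<open>Internal categories, functors and profunctors\<close>

record ('o, 'm) icat = "('o, 'm) span" +
  base :: 'o
  mult :: 'm
  unt :: 'm

definition internal_category :: "('o, 'm, 'x) cat_choice_scheme \<Rightarrow> ('o, 'm) icat \<Rightarrow> bool" where
  "internal_category E A \<longleftrightarrow>
     is_span E (base A) (base A) A \<and>
     span_cell E (Ide E (base A)) (Ide E (base A)) (spcomp E A A) A (mult A) \<and>
     span_cell E (Ide E (base A)) (Ide E (base A)) (unit_span E (base A)) A (unt A) \<and>
     mult A \<cdot>\<^bsub>E\<^esub> smap E (spcomp E A A) A A A (mult A) (Ide E (apex A)) =
       mult A \<cdot>\<^bsub>E\<^esub> smap E A (spcomp E A A) A A (Ide E (apex A)) (mult A) \<cdot>\<^bsub>E\<^esub> sassoc E A A A \<and>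
     mult A \<cdot>\<^bsub>E\<^esub> spair E A A (unt A \<cdot>\<^bsub>E\<^esub> leg0 A) (Ide E (apex A)) = Ide E (apex A) \<and>
     mult A \<cdot>\<^bsub>E\<^esub> spair E A A (Ide E (apex A)) (unt A \<cdot>\<^bsub>E\<^esub> leg1 A) = Ide E (apex A)"

record ('o, 'm) ifunctor =
  fsrc :: "('o, 'm) icat"
  ftrg :: "('o, 'm) icat"
  fob :: 'm
  far :: 'm

definition internal_functor :: "('o, 'm, 'x) cat_choice_scheme \<Rightarrow> ('o, 'm) ifunctor \<Rightarrow> bool" where
  "internal_functor E f \<longleftrightarrow> (let A = fsrc f; C = ftrg f in
     internal_category E A \<and> internal_category E C \<and>
     fob f \<in> hom E (base A) (base C) \<and>
     span_cell E (fob f) (fob f) A C (far f) \<and>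
     far f \<cdot>\<^bsub>E\<^esub> mult A = mult C \<cdot>\<^bsub>E\<^esub> smap E A A C C (far f) (far f) \<and>
     far f \<cdot>\<^bsub>E\<^esub> unt A = unt C \<cdot>\<^bsub>E\<^esub> fob f)"

definition Cat_int :: "('o, 'm, 'x) cat_choice_scheme \<Rightarrow> (('o, 'm) icat, ('o, 'm) ifunctor) cat" where
  "Cat_int E = \<lparr>
     Ob = Collect (internal_category E),
     Mor = Collect (internal_functor E),
     Dom = fsrc,
     Cod = ftrg,
     Ide = (\<lambda>A. \<lparr>fsrc = A, ftrg = A, fob = Ide E (base A), far = Ide E (apex A)\<rparr>),
     Comp = (\<lambda>g f. \<lparr>fsrc = fsrc f, ftrg = ftrg g,
       fob = fob g \<cdot>\<^bsub>E\<^esub> fob f, far = far g \<cdot>\<^bsub>E\<^esub> far f\<rparr>)\<rparr>"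

record ('o, 'm) prof = "('o, 'm) span" +
  psrc :: "('o, 'm) icat"
  ptrg :: "('o, 'm) icat"
  lact :: 'm
  ract :: 'm

definition internal_profunctor :: "('o, 'm, 'x) cat_choice_scheme \<Rightarrow> ('o, 'm) prof \<Rightarrow> bool" where
  "internal_profunctor E J \<longleftrightarrow> (let A = psrc J; B = ptrg J; idJ = Ide E (apex J) in
     internal_category E A \<and> internal_category E B \<and>
     is_span E (base A) (base B) J \<and>
     span_cell E (Ide E (base A)) (Ide E (base B)) (spcomp E A J) J (lact J) \<and>
     span_cell E (Ide E (base A)) (Ide E (base B)) (spcomp E J B) J (ract J) \<and>
     lact J \<cdot>\<^bsub>E\<^esub> smap E (spcomp E A A) J A J (mult A) idJ =
       lact J \<cdot>\<^bsub>E\<^esub> smap E A (spcomp E A J) A J (Ide E (apex A)) (lact J) \<cdot>\<^bsub>E\<^esub> sassoc E A A J \<and>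
     lact J \<cdot>\<^bsub>E\<^esub> spair E A J (unt A \<cdot>\<^bsub>E\<^esub> leg0 J) idJ = idJ \<and>
     ract J \<cdot>\<^bsub>E\<^esub> smap E (spcomp E J B) B J B (ract J) (Ide E (apex B)) =
       ract J \<cdot>\<^bsub>E\<^esub> smap E J (spcomp E B B) J B idJ (mult B) \<cdot>\<^bsub>E\<^esub> sassoc E J B B \<and>
     ract J \<cdot>\<^bsub>E\<^esub> spair E J B idJ (unt B \<cdot>\<^bsub>E\<^esub> leg1 J) = idJ \<and>
     ract J \<cdot>\<^bsub>E\<^esub> smap E (spcomp E A J) B J B (lact J) (Ide E (apex B)) =
       lact J \<cdot>\<^bsub>E\<^esub> smap E A (spcomp E J B) A J (Ide E (apex A)) (ract J) \<cdot>\<^bsub>E\<^esub> sassoc E A J B)"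

record ('o, 'm) pcell =
  ctop :: "('o, 'm) prof"
  cbot :: "('o, 'm) prof"
  clft :: "('o, 'm) ifunctor"
  crgt :: "('o, 'm) ifunctor"
  cmap :: 'm

definition internal_cell :: "('o, 'm, 'x) cat_choice_scheme \<Rightarrow> ('o, 'm) pcell \<Rightarrow> bool" where
  "internal_cell E c \<longleftrightarrow> (let J = ctop c; K = cbot c; f = clft c; g = crgt c; \<phi> = cmap c in
     internal_profunctor E J \<and> internal_profunctor E K \<and>
     internal_functor E f \<and> fsrc f = psrc J \<and> ftrg f = psrc K \<and>
     internal_functor E g \<and> fsrc g = ptrg J \<and> ftrg g = ptrg K \<and>
     span_cell E (fob f) (fob g) J K \<phi> \<and>
     lact K \<cdot>\<^bsub>E\<^esub> smap E (psrc J) J (psrc K) K (far f) \<phi> = \<phi> \<cdot>\<^bsub>E\<^esub> lact J \<and>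
     ract K \<cdot>\<^bsub>E\<^esub> smap E J (ptrg J) K (ptrg K) \<phi> (far g) = \<phi> \<cdot>\<^bsub>E\<^esub> ract J)"

section \<open>The double category of internal profunctors\<close>

definition unit_prof :: "('o, 'm) icat \<Rightarrow> ('o, 'm) prof" where
  "unit_prof A = \<lparr>apex = apex A, leg0 = leg0 A, leg1 = leg1 A,
     psrc = A, ptrg = A, lact = mult A, ract = mult A\<rparr>"

text \<open>The quotient map \<open>J \<times> H \<rightarrow> J \<odot> H\<close>: the coequaliser of \<open>r \<times> id\<close> and \<open>id \<times> l\<close>, both
  with domain \<open>(J \<times> B) \<times> H\<close>.\<close>

definition hquot :: "('o, 'm, 'x) cat_choice_scheme \<Rightarrow> ('o, 'm) prof \<Rightarrow> ('o, 'm) prof \<Rightarrow> 'm" where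
  "hquot E J H = (let B = ptrg J in Coeq E
     (smap E (spcomp E J B) H J H (ract J) (Ide E (apex H)))
     (smap E J (spcomp E B H) J H (Ide E (apex J)) (lact H) \<cdot>\<^bsub>E\<^esub> sassoc E J B H))"

definition hspan ::
  "('o, 'm, 'x) cat_choice_scheme \<Rightarrow> ('o, 'm) prof \<Rightarrow> ('o, 'm) prof \<Rightarrow> ('o, 'm) span" where
  "hspan E J H = (let q = hquot E J H in
     \<lparr>apex = Cod E q,
      leg0 = desc E q (leg0 (spcomp E J H)),
      leg1 = desc E q (leg1 (spcomp E J H))\<rparr>)"

text \<open>The actions on \<open>J \<odot> H\<close> are induced along \<open>(A \<times> J) \<times> H \<cong> A \<times> (J \<times> H) \<rightarrow> A \<times> (J \<odot> H)\<close>
  and \<open>(J \<times> H) \<times> C \<rightarrow> (J \<odot> H) \<times> C\<close>, which are coequalisers because coequalisers are preserved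
  by pullbacks.\<close>

definition hcomp_prof ::
  "('o, 'm, 'x) cat_choice_scheme \<Rightarrow> ('o, 'm) prof \<Rightarrow> ('o, 'm) prof \<Rightarrow> ('o, 'm) prof" where
  "hcomp_prof E J H = (let A = psrc J; C = ptrg H; q = hquot E J H; Q = hspan E J H in
     \<lparr>apex = apex Q, leg0 = leg0 Q, leg1 = leg1 Q, psrc = A, ptrg = C,
      lact = desc E
        (smap E A (spcomp E J H) A Q (Ide E (apex A)) q \<cdot>\<^bsub>E\<^esub> sassoc E A J H)
        (q \<cdot>\<^bsub>E\<^esub> smap E (spcomp E A J) H J H (lact J) (Ide E (apex H))),
      ract = desc E
        (smap E (spcomp E J H) C Q C q (Ide E (apex C)))
        (q \<cdot>\<^bsub>E\<^esub> smap E J (spcomp E H C) J H (Ide E (apex J)) (ract H) \<cdot>\<^bsub>E\<^esub> sassoc E J H C)\<rparr>)"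

definition id_pcell ::
  "('o, 'm, 'x) cat_choice_scheme \<Rightarrow> ('o, 'm) prof \<Rightarrow> ('o, 'm) prof \<Rightarrow> 'm \<Rightarrow> ('o, 'm) pcell" where
  "id_pcell E J K \<phi> = \<lparr>ctop = J, cbot = K,
     clft = Ide (Cat_int E) (psrc J), crgt = Ide (Cat_int E) (ptrg J), cmap = \<phi>\<rparr>"

definition Prof :: "('o, 'm, 'x) cat_choice_scheme \<Rightarrow>
    (('o, 'm) icat, ('o, 'm) ifunctor, ('o, 'm) prof, ('o, 'm) pcell) double_category" where
  "Prof E = \<lparr>
     Vert = Cat_int E,
     Hor = Collect (internal_profunctor E),
     hsrc = psrc,
     htrg = ptrg,
     Sq = Collect (internal_cell E),
     sqtop = ctop,
     sqbot = cbot,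
     sqlft = clft,
     sqrgt = crgt,
     vid = (\<lambda>J. id_pcell E J J (Ide E (apex J))),
     vcomp = (\<lambda>\<psi> \<phi>. \<lparr>ctop = ctop \<phi>, cbot = cbot \<psi>,
       clft = clft \<psi> \<cdot>\<^bsub>Cat_int E\<^esub> clft \<phi>, crgt = crgt \<psi> \<cdot>\<^bsub>Cat_int E\<^esub> crgt \<phi>,
       cmap = cmap \<psi> \<cdot>\<^bsub>E\<^esub> cmap \<phi>\<rparr>),
     hunit = unit_prof,
     ucell = (\<lambda>f. \<lparr>ctop = unit_prof (fsrc f), cbot = unit_prof (ftrg f),
       clft = f, crgt = f, cmap = far f\<rparr>),
     hcomp = hcomp_prof E,
     hcell = (\<lambda>\<phi> \<chi>. let J = ctop \<phi>; H = ctop \<chi>; K = cbot \<phi>; L = cbot \<chi> in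
       \<lparr>ctop = hcomp_prof E J H, cbot = hcomp_prof E K L, clft = clft \<phi>, crgt = crgt \<chi>,
        cmap = desc E (hquot E J H) (hquot E K L \<cdot>\<^bsub>E\<^esub> smap E J H K L (cmap \<phi>) (cmap \<chi>))\<rparr>),
     lunit = (\<lambda>J. let U = unit_prof (psrc J) in
       id_pcell E (hcomp_prof E U J) J (desc E (hquot E U J) (lact J))),
     runit = (\<lambda>J. let U = unit_prof (ptrg J) in
       id_pcell E (hcomp_prof E J U) J (desc E (hquot E J U) (ract J))),
     assoc = (\<lambda>J H K. let JH = hcomp_prof E J H; HK = hcomp_prof E H K in
       id_pcell E (hcomp_prof E JH K) (hcomp_prof E J HK)
         (desc E
           (hquot E JH K \<cdot>\<^bsub>E\<^esub> smap E (spcomp E J H) K JH K (hquot E J H) (Ide E (apex K)))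
           (hquot E J HK \<cdot>\<^bsub>E\<^esub> smap E J (spcomp E H K) J HK (Ide E (apex J)) (hquot E H K)
             \<cdot>\<^bsub>E\<^esub> sassoc E J H K)))\<rparr>"

end

theory Submission
  imports Defs
begin

text \<open>The tabulation of \<open>J\<close> has \<open>J\<close> itself as its object of objects, and as its object of morphisms the
  pullback of the two actions of \<open>J\<close>, that is the commutative squares \<open>u \<sqdot> x = y \<sqdot> v\<close> from \<open>y\<close> to \<open>x\<close>; the
  defining cell sends such a square to its diagonal. Everything is verified on generalised elements. The
  defining cell is split by the identity squares, and each square factors as one with \<open>u = 1\<close> followed
  by one with \<open>v = 1\<close>, so a cell out of the unit of the tabulation only depends on the diagonal; this makes the
  defining cell opcartesian. Horizontal composites enter the two-dimensional property only through the
  unit coherence cells, whose quotient maps \<open>J \<times> B \<rightarrow> J \<odot> 1\<close> and \<open>A \<times> J \<rightarrow> 1 \<odot> J\<close> are split coequalisers;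
  with these computed, the compatibility condition on \<open>\<xi>\<^sub>A\<close> and \<open>\<xi>\<^sub>B\<close> says exactly that they
  form a family of commutative squares.\<close>

text \<open>The unit laws dictate the tabulation. By equivariance a cell \<phi> out of the unit of X
  sends an arrow f from x to x' both to \<phi>_A(f) acting on \<phi>(1_x') and to \<phi>(1_x) acted
  on by \<phi>_B(f). So \<phi> amounts to a map on objects, x to \<phi>(1_x), with a commutative
  square for each arrow, that is, to a functor into the category of squares. Generalised elements
  are the working language because the reassociation maps \<open>sassoc\<close> disappear in it: an
  axiom between maps out of iterated pullbacks becomes an ordinary equation between composites of
  elements. The main obstacle is the hypothesis of the two-dimensional property. It is stated with
  \<open>vinv\<close> and \<open>desc\<close>, both definite descriptions, and says nothing usable
  until the inverses of the unit coherence cells are known to exist and to be unique. Existence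
  requires that the composite with a unit is itself a profunctor. Its span is isomorphic to that of
  the given profunctor, and its actions turn out to be the ones transported along this isomorphism,
  which settles both questions.\<close>

locale pullback_category = category E for E :: "('o, 'm, 'x) cat_choice_scheme" (structure) +
  assumes has_pullbacks: "has_pullbacks E"
begin

lemma Dom_Ob [simp]: "f \<in> Mor E \<Longrightarrow> Dom E f \<in> Ob E"
  and Cod_Ob [simp]: "f \<in> Mor E \<Longrightarrow> Cod E f \<in> Ob E"
  by (rule Dom_in_Ob Cod_in_Ob; assumption)+

lemma Ide_simps [simp]:
  assumes "a \<in> Ob E"
  shows "Ide E a \<in> Mor E" "Dom E (Ide E a) = a" "Cod E (Ide E a) = a"
  using Ide_in_hom[OF assms] by (auto simp: hom_def)

lemma Comp_simps [simp]:
  assumes "f \<in> Mor E" "g \<in> Mor E" "Cod E f = Dom E g"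
  shows "g \<cdot> f \<in> Mor E" "Dom E (g \<cdot> f) = Dom E f" "Cod E (g \<cdot> f) = Cod E g"
  using Comp_in_hom[of f "Dom E f" "Cod E f" g "Cod E g"] assms by (auto simp: hom_def)

lemma Comp_Comp [simp]:
  assumes "f \<in> Mor E" "g \<in> Mor E" "h \<in> Mor E" "Cod E f = Dom E g" "Cod E g = Dom E h"
  shows "(h \<cdot> g) \<cdot> f = h \<cdot> (g \<cdot> f)"
  using Comp_assoc[of f "Dom E f" "Cod E f" g "Cod E g" h "Cod E h"] assms by (auto simp: hom_def)

lemma Comp_Ide_simp [simp]: "f \<in> Mor E \<Longrightarrow> Dom E f = a \<Longrightarrow> f \<cdot> Ide E a = f"
  and Ide_Comp_simp [simp]: "f \<in> Mor E \<Longrightarrow> Cod E f = a \<Longrightarrow> Ide E a \<cdot> f = f"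
  using Comp_Ide[of f "Dom E f" "Cod E f"] Ide_Comp[of f "Dom E f" "Cod E f"]
  by (auto simp: hom_def)

text \<open>Composites are normalised to the right by \<open>Comp_Comp\<close>, so an equation
  between two composites no longer matches once a further map is precomposed; this rule supplies the
  extended form.\<close>

lemma Comp_eq_extend:
  assumes "g \<cdot> f = g' \<cdot> f'" "x \<in> Mor E" "f \<in> Mor E" "g \<in> Mor E" "f' \<in> Mor E" "g' \<in> Mor E"
    "Cod E x = Dom E f" "Dom E f' = Dom E f" "Cod E f = Dom E g" "Cod E f' = Dom E g'"
  shows "g \<cdot> (f \<cdot> x) = g' \<cdot> (f' \<cdot> x)"
  using assms by (simp flip: Comp_Comp)

subsection \<open>Chosen pullbacks\<close>

lemma is_pullback_Pb:
  assumes "f \<in> Mor E" "g \<in> Mor E" "Cod E f = Cod E g"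
  shows "is_pullback E f g (Pb1 E f g) (Pb2 E f g)"
  using has_pullbacks assms unfolding has_pullbacks_def by blast

lemma Pb_simps [simp]:
  assumes "f \<in> Mor E" "g \<in> Mor E" "Cod E f = Cod E g"
  shows "Pb1 E f g \<in> Mor E" "Pb2 E f g \<in> Mor E"
    "Dom E (Pb2 E f g) = Dom E (Pb1 E f g)" "Cod E (Pb1 E f g) = Dom E f" "Cod E (Pb2 E f g) = Dom E g"
  using is_pullback_Pb[OF assms] by (auto simp: is_pullback_def)

lemma Pb_commutes:
  assumes "f \<in> Mor E" "g \<in> Mor E" "Cod E f = Cod E g"
  shows "f \<cdot> Pb1 E f g = g \<cdot> Pb2 E f g"
  using is_pullback_Pb[OF assms] by (auto simp: is_pullback_def)

lemma pair_ex1: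
  assumes "f \<in> Mor E" "g \<in> Mor E" "Cod E f = Cod E g"
    and "x \<in> Mor E" "y \<in> Mor E" "Dom E x = Dom E y" "Cod E x = Dom E f" "Cod E y = Dom E g"
    and "f \<cdot> x = g \<cdot> y"
  shows "\<exists>!h. h \<in> hom E (Dom E x) (Dom E (Pb1 E f g)) \<and> Pb1 E f g \<cdot> h = x \<and> Pb2 E f g \<cdot> h = y"
proof -
  have "x \<in> hom E (Dom E x) (Dom E f)" "y \<in> hom E (Dom E x) (Dom E g)"
    using assms by (auto simp: hom_def)
  then show ?thesis
    using is_pullback_Pb[OF assms(1-3)] assms(9) unfolding is_pullback_def by blast
qed

lemma pair_simps [simp]:
  assumes "f \<in> Mor E" "g \<in> Mor E" "Cod E f = Cod E g"
    and "x \<in> Mor E" "y \<in> Mor E" "Dom E x = Dom E y" "Cod E x = Dom E f" "Cod E y = Dom E g"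
    and "f \<cdot> x = g \<cdot> y"
  shows "pair E f g x y \<in> Mor E" "Dom E (pair E f g x y) = Dom E y"
    "Cod E (pair E f g x y) = Dom E (Pb1 E f g)"
    "Pb1 E f g \<cdot> pair E f g x y = x" "Pb2 E f g \<cdot> pair E f g x y = y"
  using theI'[OF pair_ex1[OF assms]] assms(6) by (auto simp: pair_def hom_def)

lemma Pb_eqI:
  assumes "f \<in> Mor E" "g \<in> Mor E" "Cod E f = Cod E g"
    and "h \<in> Mor E" "k \<in> Mor E" "Dom E h = Dom E k"
    and "Cod E h = Dom E (Pb1 E f g)" "Cod E k = Dom E (Pb1 E f g)"
    and "Pb1 E f g \<cdot> h = Pb1 E f g \<cdot> k" "Pb2 E f g \<cdot> h = Pb2 E f g \<cdot> k"
  shows "h = k"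
proof -
  have "f \<cdot> (Pb1 E f g \<cdot> h) = g \<cdot> (Pb2 E f g \<cdot> h)"
    by (rule Comp_eq_extend) (use assms Pb_commutes in auto)
  then have "\<exists>!l. l \<in> hom E (Dom E (Pb1 E f g \<cdot> h)) (Dom E (Pb1 E f g)) \<and>
      Pb1 E f g \<cdot> l = Pb1 E f g \<cdot> h \<and> Pb2 E f g \<cdot> l = Pb2 E f g \<cdot> h"
    by (intro pair_ex1) (use assms in auto)
  moreover have "h \<in> hom E (Dom E (Pb1 E f g \<cdot> h)) (Dom E (Pb1 E f g))"
      "k \<in> hom E (Dom E (Pb1 E f g \<cdot> h)) (Dom E (Pb1 E f g))"
    using assms(1-8) by (simp_all add: hom_def)
  ultimately show ?thesis
    using assms(9,10) by metis
qed

subsection \<open>Composites of spans\<close>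

text \<open>Unlike \<open>is_span\<close>, this leaves the feet implicit: they are read off as
  codomains of the legs, so the typing conditions have no free parameters and suit conditional
  rewriting.\<close>

definition spn :: "('o, 'm, 'y) span_scheme \<Rightarrow> bool" where
  "spn J \<longleftrightarrow> leg0 J \<in> Mor E \<and> leg1 J \<in> Mor E \<and> Dom E (leg0 J) = apex J \<and> Dom E (leg1 J) = apex J"

lemma spnI:
  "leg0 J \<in> Mor E \<Longrightarrow> leg1 J \<in> Mor E \<Longrightarrow> Dom E (leg0 J) = apex J \<Longrightarrow> Dom E (leg1 J) = apex J \<Longrightarrow> spn J"
  by (simp add: spn_def)

lemma spn_simps [simp]:
  assumes "spn J"
  shows "leg0 J \<in> Mor E" "leg1 J \<in> Mor E" "Dom E (leg0 J) = apex J" "Dom E (leg1 J) = apex J"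
    "apex J \<in> Ob E"
  using assms Dom_in_Ob[of "leg0 J"] by (auto simp: spn_def)

lemma spcomp_legs [simp]:
  "leg0 (spcomp E J H) = leg0 J \<cdot> sp1 E J H" "leg1 (spcomp E J H) = leg1 H \<cdot> sp2 E J H"
  by (simp_all add: spcomp_def)

context
  fixes J :: "('o, 'm, 'y) span_scheme" and H :: "('o, 'm, 'z) span_scheme"
  assumes JH: "spn J" "spn H" "Cod E (leg1 J) = Cod E (leg0 H)"
begin

lemma sp_simps [simp]:
  "sp1 E J H \<in> Mor E" "sp2 E J H \<in> Mor E"
  "Dom E (sp1 E J H) = apex (spcomp E J H)" "Dom E (sp2 E J H) = apex (spcomp E J H)"
  "Cod E (sp1 E J H) = apex J" "Cod E (sp2 E J H) = apex H"
  using JH by (auto simp: sp1_def sp2_def spcomp_def)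

lemma spn_spcomp [simp]: "spn (spcomp E J H)"
  by (rule spnI) (use JH in auto)

lemma sp_commutes [simp]: "leg1 J \<cdot> sp1 E J H = leg0 H \<cdot> sp2 E J H"
  using JH by (simp add: sp1_def sp2_def Pb_commutes)

lemma sp_commutes' [simp]:
  "w \<in> Mor E \<Longrightarrow> Cod E w = apex (spcomp E J H) \<Longrightarrow>
    leg1 J \<cdot> (sp1 E J H \<cdot> w) = leg0 H \<cdot> (sp2 E J H \<cdot> w)"
  by (rule Comp_eq_extend) (use JH in auto)

lemma spair_simps [simp]:
  assumes "x \<in> Mor E" "y \<in> Mor E" "Dom E x = Dom E y" "Cod E x = apex J" "Cod E y = apex H"
    and "leg1 J \<cdot> x = leg0 H \<cdot> y"
  shows "spair E J H x y \<in> Mor E" "Dom E (spair E J H x y) = Dom E y"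
    "Cod E (spair E J H x y) = apex (spcomp E J H)"
    "sp1 E J H \<cdot> spair E J H x y = x" "sp2 E J H \<cdot> spair E J H x y = y"
  using JH assms by (auto simp: sp1_def sp2_def spair_def spcomp_def)

lemma spair_simps' [simp]:
  assumes "x \<in> Mor E" "y \<in> Mor E" "Dom E x = Dom E y" "Cod E x = apex J" "Cod E y = apex H"
    and "leg1 J \<cdot> x = leg0 H \<cdot> y" and "w \<in> Mor E" "Cod E w = Dom E y"
  shows "sp1 E J H \<cdot> (spair E J H x y \<cdot> w) = x \<cdot> w" "sp2 E J H \<cdot> (spair E J H x y \<cdot> w) = y \<cdot> w"
  using JH assms by (simp_all flip: Comp_Comp)

lemma sp_eqI:
  assumes "h \<in> Mor E" "k \<in> Mor E" "Dom E h = Dom E k"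
    and "Cod E h = apex (spcomp E J H)" "Cod E k = apex (spcomp E J H)"
    and "sp1 E J H \<cdot> h = sp1 E J H \<cdot> k" "sp2 E J H \<cdot> h = sp2 E J H \<cdot> k"
  shows "h = k"
  by (rule Pb_eqI[of "leg1 J" "leg0 H"]) (use JH assms in \<open>auto simp: sp1_def sp2_def spcomp_def\<close>)

lemma spair_Comp [simp]:
  assumes "x \<in> Mor E" "y \<in> Mor E" "Dom E x = Dom E y" "Cod E x = apex J" "Cod E y = apex H"
    and "leg1 J \<cdot> x = leg0 H \<cdot> y" and "w \<in> Mor E" "Cod E w = Dom E y"
  shows "spair E J H x y \<cdot> w = spair E J H (x \<cdot> w) (y \<cdot> w)"
proof -
  have "leg1 J \<cdot> (x \<cdot> w) = leg0 H \<cdot> (y \<cdot> w)"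
    by (rule Comp_eq_extend) (use JH assms in auto)
  then show ?thesis
    using JH assms by - (rule sp_eqI, simp_all)
qed

lemma spair_sp [simp]:
  assumes "w \<in> Mor E" "Cod E w = apex (spcomp E J H)"
  shows "spair E J H (sp1 E J H \<cdot> w) (sp2 E J H \<cdot> w) = w"
  by (rule sp_eqI) (use JH assms in auto)

lemma spair_sp0 [simp]: "spair E J H (sp1 E J H) (sp2 E J H) = Ide E (apex (spcomp E J H))"
  by (rule sp_eqI) (use JH in auto)

end


text \<open>The right leg of a composite span is unfolded by \<open>spcomp_legs\<close> and then
  reassociated, which hides the left-hand side of \<open>sp_commutes\<close> for an outer composite;
  these are its normal forms.\<close>

lemma sp_commutes_assoc [simp]:
  assumes "spn J" "spn H" "spn K" "Cod E (leg1 J) = Cod E (leg0 H)" "Cod E (leg1 H) = Cod E (leg0 K)"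
  shows "leg1 H \<cdot> (sp2 E J H \<cdot> sp1 E (spcomp E J H) K) = leg0 K \<cdot> sp2 E (spcomp E J H) K"
    and "w \<in> Mor E \<Longrightarrow> Cod E w = apex (spcomp E (spcomp E J H) K) \<Longrightarrow>
      leg1 H \<cdot> (sp2 E J H \<cdot> (sp1 E (spcomp E J H) K \<cdot> w)) = leg0 K \<cdot> (sp2 E (spcomp E J H) K \<cdot> w)"
  using assms sp_commutes[of "spcomp E J H" K] sp_commutes'[of "spcomp E J H" K w]
  by (simp_all del: sp_commutes sp_commutes')

subsection \<open>Equations between maps out of composite spans, in terms of generalised elements\<close>

abbreviation composable ::
  "('o, 'm, 'y) span_scheme \<Rightarrow> ('o, 'm, 'z) span_scheme \<Rightarrow> 'm \<Rightarrow> 'm \<Rightarrow> bool" where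
  "composable J H u v \<equiv> u \<in> Mor E \<and> v \<in> Mor E \<and> Dom E u = Dom E v \<and>
     Cod E u = apex J \<and> Cod E v = apex H \<and> leg1 J \<cdot> u = leg0 H \<cdot> v"

text \<open>The value m(u, v) of a binary operation at a pair of generalised elements with a common
  domain.\<close>

definition act ::
  "'m \<Rightarrow> ('o, 'm, 'y) span_scheme \<Rightarrow> ('o, 'm, 'z) span_scheme \<Rightarrow> 'm \<Rightarrow> 'm \<Rightarrow> 'm" where
  "act m J H u v = m \<cdot> spair E J H u v"

text \<open>Multiplications, left actions and right actions are all of this kind, so each lemma on
  generalised elements is proved once for all of them.\<close>

definition span_op :: "('o, 'm, 'y) span_scheme \<Rightarrow> ('o, 'm, 'z) span_scheme \<Rightarrow>
    ('o, 'm, 'w) span_scheme \<Rightarrow> 'm \<Rightarrow> bool" where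
  "span_op J H K m \<longleftrightarrow> spn J \<and> spn H \<and> spn K \<and> Cod E (leg1 J) = Cod E (leg0 H) \<and>
     span_cell E (Ide E (Cod E (leg0 J))) (Ide E (Cod E (leg1 H))) (spcomp E J H) K m"

lemma span_opD:
  assumes "span_op J H K m"
  shows "spn J" "spn H" "spn K" "Cod E (leg1 J) = Cod E (leg0 H)"
    "m \<in> Mor E" "Dom E m = apex (spcomp E J H)" "Cod E m = apex K"
    "leg0 K \<cdot> m = leg0 J \<cdot> sp1 E J H" "leg1 K \<cdot> m = leg1 H \<cdot> sp2 E J H"
  using assms by (auto simp: span_op_def span_cell_def hom_def)

lemma span_op_Cod:
  assumes "span_op J H K m"
  shows "Cod E (leg0 K) = Cod E (leg0 J)" "Cod E (leg1 K) = Cod E (leg1 H)"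
  using span_opD[OF assms] Comp_simps(3)[of m "leg0 K"] Comp_simps(3)[of "sp1 E J H" "leg0 J"]
    Comp_simps(3)[of m "leg1 K"] Comp_simps(3)[of "sp2 E J H" "leg1 H"]
  by simp_all

lemma act_simps:
  assumes "span_op J H K m"
    and "u \<in> Mor E" "v \<in> Mor E" "Dom E u = Dom E v" "Cod E u = apex J" "Cod E v = apex H"
    and "leg1 J \<cdot> u = leg0 H \<cdot> v"
  shows "act m J H u v \<in> Mor E" "Dom E (act m J H u v) = Dom E v" "Cod E (act m J H u v) = apex K"
    "leg0 K \<cdot> act m J H u v = leg0 J \<cdot> u" "leg1 K \<cdot> act m J H u v = leg1 H \<cdot> v"
proof -
  note [simp] = span_opD[OF assms(1)] assms(2-)
  show "act m J H u v \<in> Mor E" "Dom E (act m J H u v) = Dom E v" "Cod E (act m J H u v) = apex K"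
    by (simp_all add: act_def)
  have "leg0 K \<cdot> (m \<cdot> spair E J H u v) = leg0 J \<cdot> (sp1 E J H \<cdot> spair E J H u v)"
    by (rule Comp_eq_extend) simp_all
  then show "leg0 K \<cdot> act m J H u v = leg0 J \<cdot> u"
    by (simp add: act_def)
  have "leg1 K \<cdot> (m \<cdot> spair E J H u v) = leg1 H \<cdot> (sp2 E J H \<cdot> spair E J H u v)"
    by (rule Comp_eq_extend) simp_all
  then show "leg1 K \<cdot> act m J H u v = leg1 H \<cdot> v"
    by (simp add: act_def)
qed

lemma act_Comp:
  assumes "span_op J H K m"
    and "u \<in> Mor E" "v \<in> Mor E" "Dom E u = Dom E v" "Cod E u = apex J" "Cod E v = apex H"
    and "leg1 J \<cdot> u = leg0 H \<cdot> v" "w \<in> Mor E" "Cod E w = Dom E v"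
  shows "act m J H u v \<cdot> w = act m J H (u \<cdot> w) (v \<cdot> w)"
  using span_opD[OF assms(1)] assms(2-) by (simp add: act_def)

lemma op_Comp:
  assumes "span_op J H K m" "w \<in> Mor E" "Cod E w = apex (spcomp E J H)"
  shows "m \<cdot> w = act m J H (sp1 E J H \<cdot> w) (sp2 E J H \<cdot> w)"
  using span_opD[OF assms(1)] assms(2-) by (simp add: act_def)

lemma op_eq_act:
  assumes "span_op J H K m"
  shows "m = act m J H (sp1 E J H) (sp2 E J H)"
  using span_opD[OF assms(1)] by (simp add: act_def)

lemma eq_spcompI:
  assumes "spn J" "spn H" "Cod E (leg1 J) = Cod E (leg0 H)"
    and "f \<in> Mor E" "g \<in> Mor E" "Dom E f = apex (spcomp E J H)" "Dom E g = apex (spcomp E J H)"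
    and "\<And>u v. composable J H u v \<Longrightarrow> f \<cdot> spair E J H u v = g \<cdot> spair E J H u v"
  shows "f = g"
  using assms(8)[of "sp1 E J H" "sp2 E J H"] assms(1-7) by simp

text \<open>Every generalised element of the triple composite has the form ((u, v), w), so two maps
  agree as soon as they agree on such triples. Four different operations are allowed so that one
  statement covers associativity of a multiplication, of either action, and the compatibility of the
  two actions.\<close>

lemma assoc_iff:
  assumes m: "span_op J H K m" and n: "span_op K L M n" and p: "span_op H L P p" and q: "span_op J P M q"
  shows "n \<cdot> smap E (spcomp E J H) L K L m (Ide E (apex L)) =
      q \<cdot> smap E J (spcomp E H L) J P (Ide E (apex J)) p \<cdot> sassoc E J H L \<longleftrightarrow>
    (\<forall>u v w. composable J H u v \<longrightarrow> composable H L v w \<longrightarrow>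
      act n K L (act m J H u v) w = act q J P u (act p H L v w))"
    (is "?l = ?r \<longleftrightarrow> ?R")
proof -
  note [simp] = smap_def sassoc_def span_opD[OF m] span_opD[OF n] span_opD[OF p] span_opD[OF q]
    span_op_Cod[OF m] span_op_Cod[OF n] span_op_Cod[OF p] span_op_Cod[OF q]
    act_simps[OF m] act_simps[OF n] act_simps[OF p] act_simps[OF q]
    op_Comp[OF m] op_Comp[OF n] op_Comp[OF p] op_Comp[OF q]
    act_Comp[OF m] act_Comp[OF n] act_Comp[OF p] act_Comp[OF q]
  let ?JH = "spcomp E J H"
  have *: "?l \<cdot> spair E ?JH L (spair E J H u v) w = act n K L (act m J H u v) w"
    "?r \<cdot> spair E ?JH L (spair E J H u v) w = act q J P u (act p H L v w)"
    if "composable J H u v" "composable H L v w" for u v w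
    using that by simp_all
  have [simp]: "?l \<in> Mor E" "?r \<in> Mor E" "Dom E ?l = apex (spcomp E ?JH L)" "Dom E ?r = apex (spcomp E ?JH L)"
    by simp_all
  show ?thesis
  proof
    assume ?R
    show "?l = ?r"
    proof (rule eq_spcompI[of ?JH L])
      fix x w
      assume xw: "composable ?JH L x w"
      then have "x = spair E J H (sp1 E J H \<cdot> x) (sp2 E J H \<cdot> x)"
        by simp
      moreover have "composable J H (sp1 E J H \<cdot> x) (sp2 E J H \<cdot> x)"
        "composable H L (sp2 E J H \<cdot> x) w"
        using xw by auto
      ultimately show "?l \<cdot> spair E ?JH L x w = ?r \<cdot> spair E ?JH L x w"
        using * \<open>?R\<close> by metis
    qed simp_all
  qed (use * in metis)
qed

text \<open>Covers at once preservation of multiplication by a functor and both equivariance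
  conditions of a cell. The assumption \<open>fg\<close> says that the pair of maps lands in the
  target pullback.\<close>

lemma hom_iff:
  assumes m: "span_op J H K m" and n: "span_op J' H' K' n"
    and f: "f \<in> Mor E" "Dom E f = apex J" "Cod E f = apex J'"
    and g: "g \<in> Mor E" "Dom E g = apex H" "Cod E g = apex H'"
    and k: "k \<in> Mor E" "Dom E k = apex K" "Cod E k = apex K'"
    and fg: "leg1 J' \<cdot> (f \<cdot> sp1 E J H) = leg0 H' \<cdot> (g \<cdot> sp2 E J H)"
  shows "n \<cdot> smap E J H J' H' f g = k \<cdot> m \<longleftrightarrow>
    (\<forall>u v. composable J H u v \<longrightarrow> act n J' H' (f \<cdot> u) (g \<cdot> v) = k \<cdot> act m J H u v)"
    (is "?l = ?r \<longleftrightarrow> ?R")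
proof -
  note [simp] = smap_def sassoc_def span_opD[OF m] span_opD[OF n] act_simps[OF m] act_simps[OF n] f g k fg
  have "leg1 J' \<cdot> (f \<cdot> u) = leg0 H' \<cdot> (g \<cdot> v)" if "composable J H u v" for u v
  proof -
    have "leg1 J' \<cdot> ((f \<cdot> sp1 E J H) \<cdot> spair E J H u v) = leg0 H' \<cdot> ((g \<cdot> sp2 E J H) \<cdot> spair E J H u v)"
      by (rule Comp_eq_extend) (use that in simp_all)
    then show ?thesis
      using that by simp
  qed
  note [simp] = op_Comp[OF m] op_Comp[OF n] act_Comp[OF m] act_Comp[OF n] this
  have *: "?l \<cdot> spair E J H u v = act n J' H' (f \<cdot> u) (g \<cdot> v)" "?r \<cdot> spair E J H u v = k \<cdot> act m J H u v"
    if "composable J H u v" for u v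
    using that by simp_all
  show ?thesis
  proof
    assume ?R
    show "?l = ?r"
      by (rule eq_spcompI[of J H]) (use * \<open>?R\<close> in simp_all)
  qed (use * in metis)
qed

lemma left_unit_iff:
  assumes m: "span_op A J J m" and e: "e \<in> Mor E" "Dom E e = Cod E (leg0 J)" "Cod E e = apex A"
    and le: "leg1 A \<cdot> e = Ide E (Cod E (leg0 J))"
  shows "m \<cdot> spair E A J (e \<cdot> leg0 J) (Ide E (apex J)) = Ide E (apex J) \<longleftrightarrow>
    (\<forall>u. u \<in> Mor E \<longrightarrow> Cod E u = apex J \<longrightarrow> act m A J (e \<cdot> (leg0 J \<cdot> u)) u = u)"
proof -
  note [simp] = span_opD[OF m] e
  have [simp]: "leg1 A \<cdot> (e \<cdot> w) = w" if "w \<in> Mor E" "Cod E w = Dom E e" for w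
    using that le by (simp flip: Comp_Comp)
  have *: "(m \<cdot> spair E A J (e \<cdot> leg0 J) (Ide E (apex J))) \<cdot> u = act m A J (e \<cdot> (leg0 J \<cdot> u)) u"
    if "u \<in> Mor E" "Cod E u = apex J" for u
    using that by (simp add: act_def)
  show ?thesis (is "?l = ?r \<longleftrightarrow> ?R")
  proof
    assume "?l = ?r"
    then show ?R using * by (metis Ide_Comp_simp)
  next
    assume ?R
    from this[rule_format, of "Ide E (apex J)"] show "?l = ?r"
      using *[of "Ide E (apex J)"] by simp
  qed
qed

lemma right_unit_iff:
  assumes m: "span_op J B J m" and e: "e \<in> Mor E" "Dom E e = Cod E (leg1 J)" "Cod E e = apex B"
    and le: "leg0 B \<cdot> e = Ide E (Cod E (leg1 J))"
  shows "m \<cdot> spair E J B (Ide E (apex J)) (e \<cdot> leg1 J) = Ide E (apex J) \<longleftrightarrow>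
    (\<forall>u. u \<in> Mor E \<longrightarrow> Cod E u = apex J \<longrightarrow> act m J B u (e \<cdot> (leg1 J \<cdot> u)) = u)"
proof -
  note [simp] = span_opD[OF m] e
  have [simp]: "leg0 B \<cdot> (e \<cdot> w) = w" if "w \<in> Mor E" "Cod E w = Dom E e" for w
    using that le by (simp flip: Comp_Comp)
  have [simp]: "leg0 B \<cdot> (e \<cdot> leg1 J) = leg1 J"
    by simp
  have *: "(m \<cdot> spair E J B (Ide E (apex J)) (e \<cdot> leg1 J)) \<cdot> u = act m J B u (e \<cdot> (leg1 J \<cdot> u))"
    if "u \<in> Mor E" "Cod E u = apex J" for u
    using that by (simp add: act_def)
  show ?thesis (is "?l = ?r \<longleftrightarrow> ?R")
  proof
    assume "?l = ?r"
    then show ?R using * by (metis Ide_Comp_simp)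
  next
    assume ?R
    from this[rule_format, of "Ide E (apex J)"] show "?l = ?r"
      using *[of "Ide E (apex J)"] by simp
  qed
qed


subsection \<open>Internal structures in terms of generalised elements\<close>

abbreviation mm :: "('o, 'm) icat \<Rightarrow> 'm \<Rightarrow> 'm \<Rightarrow> 'm" where
  "mm A \<equiv> act (mult A) A A"

abbreviation la :: "('o, 'm) prof \<Rightarrow> 'm \<Rightarrow> 'm \<Rightarrow> 'm" where
  "la J \<equiv> act (lact J) (psrc J) J"

abbreviation ra :: "('o, 'm) prof \<Rightarrow> 'm \<Rightarrow> 'm \<Rightarrow> 'm" where
  "ra J \<equiv> act (ract J) J (ptrg J)"

lemma is_span_iff: "is_span E a b J \<longleftrightarrow> spn J \<and> Cod E (leg0 J) = a \<and> Cod E (leg1 J) = b"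
  by (auto simp: is_span_def hom_def intro: spnI)

lemma span_opI:
  assumes "spn J" "spn H" "spn K" "Cod E (leg1 J) = Cod E (leg0 H)"
    and "m \<in> Mor E" "Dom E m = apex (spcomp E J H)" "Cod E m = apex K"
    and "leg0 K \<cdot> m = leg0 J \<cdot> sp1 E J H" "leg1 K \<cdot> m = leg1 H \<cdot> sp2 E J H"
  shows "span_op J H K m"
  using assms by (simp add: span_op_def span_cell_def hom_def)

text \<open>The working form of the definition: typing data followed by the usual laws on elements.
  Functors, profunctors and cells are treated in the same way below.\<close>

lemma internal_category_iff: "internal_category E A \<longleftrightarrow>
    span_op A A A (mult A) \<and> Cod E (leg0 A) = base A \<and> Cod E (leg1 A) = base A \<and>
    unt A \<in> Mor E \<and> Dom E (unt A) = base A \<and> Cod E (unt A) = apex A \<and>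
    leg0 A \<cdot> unt A = Ide E (base A) \<and> leg1 A \<cdot> unt A = Ide E (base A) \<and>
    (\<forall>u v w. composable A A u v \<longrightarrow> composable A A v w \<longrightarrow> mm A (mm A u v) w = mm A u (mm A v w)) \<and>
    (\<forall>u. u \<in> Mor E \<longrightarrow> Cod E u = apex A \<longrightarrow> mm A (unt A \<cdot> (leg0 A \<cdot> u)) u = u) \<and>
    (\<forall>u. u \<in> Mor E \<longrightarrow> Cod E u = apex A \<longrightarrow> mm A u (unt A \<cdot> (leg1 A \<cdot> u)) = u)"
    (is "_ \<longleftrightarrow> ?op \<and> ?c0 \<and> ?c1 \<and> ?e1 \<and> ?e2 \<and> ?e3 \<and> ?e4 \<and> ?e5 \<and> ?rest")
proof -
  have [simp]: "Ide E (base A) \<cdot> Ide E (base A) = Ide E (base A)" if "spn A" "Cod E (leg0 A) = base A"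
    using that Cod_Ob[of "leg0 A"] by simp
  have data: "is_span E (base A) (base A) A \<and>
     span_cell E (Ide E (base A)) (Ide E (base A)) (spcomp E A A) A (mult A) \<and>
     span_cell E (Ide E (base A)) (Ide E (base A)) (unit_span E (base A)) A (unt A) \<longleftrightarrow>
     ?op \<and> ?c0 \<and> ?c1 \<and> ?e1 \<and> ?e2 \<and> ?e3 \<and> ?e4 \<and> ?e5"
    by (auto simp: is_span_iff span_op_def span_cell_def unit_span_def hom_def)
  show ?thesis
  \<comment> \<open>The translation of the laws is valid only for well-typed data. Both sides of the
    equivalence contain these data, so both fail when the data do.\<close>
  proof (cases "?op \<and> ?c0 \<and> ?c1 \<and> ?e1 \<and> ?e2 \<and> ?e3 \<and> ?e4 \<and> ?e5")
    case True
    then have op: ?op by simp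
    show ?thesis
      using True data assoc_iff[OF op op op op] left_unit_iff[OF op, of "unt A"]
        right_unit_iff[OF op, of "unt A"]
      unfolding internal_category_def by simp
  next
    case False
    then show ?thesis
      using data unfolding internal_category_def by blast
  qed
qed

lemma internal_categoryD:
  assumes "internal_category E A"
  shows "span_op A A A (mult A)" "spn A" "Cod E (leg0 A) = base A" "Cod E (leg1 A) = base A"
    "base A \<in> Ob E" "unt A \<in> Mor E" "Dom E (unt A) = base A" "Cod E (unt A) = apex A"
    "leg0 A \<cdot> unt A = Ide E (base A)" "leg1 A \<cdot> unt A = Ide E (base A)"
proof -
  show *: "span_op A A A (mult A)" "Cod E (leg0 A) = base A" "Cod E (leg1 A) = base A"
    "unt A \<in> Mor E" "Dom E (unt A) = base A" "Cod E (unt A) = apex A"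
    "leg0 A \<cdot> unt A = Ide E (base A)" "leg1 A \<cdot> unt A = Ide E (base A)"
    using assms unfolding internal_category_iff by blast+
  show "spn A" "base A \<in> Ob E"
    using span_opD[OF *(1)] * Dom_Ob[of "unt A"] by auto
qed

lemma internal_functor_iff: "internal_functor E f \<longleftrightarrow>
    internal_category E (fsrc f) \<and> internal_category E (ftrg f) \<and>
    fob f \<in> Mor E \<and> Dom E (fob f) = base (fsrc f) \<and> Cod E (fob f) = base (ftrg f) \<and>
    far f \<in> Mor E \<and> Dom E (far f) = apex (fsrc f) \<and> Cod E (far f) = apex (ftrg f) \<and>
    leg0 (ftrg f) \<cdot> far f = fob f \<cdot> leg0 (fsrc f) \<and> leg1 (ftrg f) \<cdot> far f = fob f \<cdot> leg1 (fsrc f) \<and>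
    (\<forall>u v. composable (fsrc f) (fsrc f) u v \<longrightarrow>
      mm (ftrg f) (far f \<cdot> u) (far f \<cdot> v) = far f \<cdot> mm (fsrc f) u v) \<and>
    far f \<cdot> unt (fsrc f) = unt (ftrg f) \<cdot> fob f"
    (is "_ \<longleftrightarrow> ?A \<and> ?C \<and> ?o1 \<and> ?o2 \<and> ?o3 \<and> ?a1 \<and> ?a2 \<and> ?a3 \<and> ?l0 \<and> ?l1 \<and> ?m \<and> ?e")
proof -
  let ?P = "?A \<and> ?C \<and> ?o1 \<and> ?o2 \<and> ?o3 \<and> ?a1 \<and> ?a2 \<and> ?a3 \<and> ?l0 \<and> ?l1"
  have data: "?A \<and> ?C \<and> fob f \<in> hom E (base (fsrc f)) (base (ftrg f)) \<and>
     span_cell E (fob f) (fob f) (fsrc f) (ftrg f) (far f) \<longleftrightarrow> ?P"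
    by (simp add: span_cell_def hom_def)
  have m: "mult (ftrg f) \<cdot> smap E (fsrc f) (fsrc f) (ftrg f) (ftrg f) (far f) (far f) = far f \<cdot> mult (fsrc f) \<longleftrightarrow> ?m"
    if P: ?P
  proof -
    from P have op: "span_op (fsrc f) (fsrc f) (fsrc f) (mult (fsrc f))"
      "span_op (ftrg f) (ftrg f) (ftrg f) (mult (ftrg f))"
      and c: "Cod E (leg0 (fsrc f)) = base (fsrc f)" "Cod E (leg1 (fsrc f)) = base (fsrc f)"
      unfolding internal_category_iff by blast+
    note s = span_opD[OF op(1)] span_opD[OF op(2)]
    have "leg1 (ftrg f) \<cdot> (far f \<cdot> sp1 E (fsrc f) (fsrc f)) = fob f \<cdot> (leg1 (fsrc f) \<cdot> sp1 E (fsrc f) (fsrc f))"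
      "leg0 (ftrg f) \<cdot> (far f \<cdot> sp2 E (fsrc f) (fsrc f)) = fob f \<cdot> (leg0 (fsrc f) \<cdot> sp2 E (fsrc f) (fsrc f))"
      by (rule Comp_eq_extend; use P in \<open>simp add: s c\<close>)+
    then show ?thesis
      by (intro hom_iff[OF op]) (use P in \<open>simp_all add: s\<close>)
  qed
  show ?thesis
    unfolding internal_functor_def Let_def using data m by metis
qed

lemma internal_profunctor_iff: "internal_profunctor E J \<longleftrightarrow>
    internal_category E (psrc J) \<and> internal_category E (ptrg J) \<and>
    Cod E (leg0 J) = base (psrc J) \<and> Cod E (leg1 J) = base (ptrg J) \<and>
    span_op (psrc J) J J (lact J) \<and> span_op J (ptrg J) J (ract J) \<and>
    (\<forall>u v w. composable (psrc J) (psrc J) u v \<longrightarrow> composable (psrc J) J v w \<longrightarrow>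
      la J (mm (psrc J) u v) w = la J u (la J v w)) \<and>
    (\<forall>u. u \<in> Mor E \<longrightarrow> Cod E u = apex J \<longrightarrow> la J (unt (psrc J) \<cdot> (leg0 J \<cdot> u)) u = u) \<and>
    (\<forall>u v w. composable J (ptrg J) u v \<longrightarrow> composable (ptrg J) (ptrg J) v w \<longrightarrow>
      ra J (ra J u v) w = ra J u (mm (ptrg J) v w)) \<and>
    (\<forall>u. u \<in> Mor E \<longrightarrow> Cod E u = apex J \<longrightarrow> ra J u (unt (ptrg J) \<cdot> (leg1 J \<cdot> u)) = u) \<and>
    (\<forall>u v w. composable (psrc J) J u v \<longrightarrow> composable J (ptrg J) v w \<longrightarrow>
      ra J (la J u v) w = la J u (ra J v w))"
    (is "_ \<longleftrightarrow> ?A \<and> ?B \<and> ?c0 \<and> ?c1 \<and> ?l \<and> ?r \<and> ?rest")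
proof -
  have data: "?A \<and> ?B \<and> is_span E (base (psrc J)) (base (ptrg J)) J \<and>
     span_cell E (Ide E (base (psrc J))) (Ide E (base (ptrg J))) (spcomp E (psrc J) J) J (lact J) \<and>
     span_cell E (Ide E (base (psrc J))) (Ide E (base (ptrg J))) (spcomp E J (ptrg J)) J (ract J)
     \<longleftrightarrow> ?A \<and> ?B \<and> ?c0 \<and> ?c1 \<and> ?l \<and> ?r"
    (is "_ \<and> _ \<and> ?data \<longleftrightarrow> _")
  proof -
    have "?data \<longleftrightarrow> ?c0 \<and> ?c1 \<and> ?l \<and> ?r" if ?A ?B
      by (rule iffI; elim conjE; simp add: is_span_iff span_op_def
          internal_categoryD(2-4)[OF that(1)] internal_categoryD(2-4)[OF that(2)])
    then show ?thesis
      by metis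
  qed
  show ?thesis
  proof (cases "?A \<and> ?B \<and> ?c0 \<and> ?c1 \<and> ?l \<and> ?r")
    case True
    then have l: ?l and r: ?r and op: "span_op (psrc J) (psrc J) (psrc J) (mult (psrc J))"
      "span_op (ptrg J) (ptrg J) (ptrg J) (mult (ptrg J))"
      and c: "Cod E (leg0 (psrc J)) = base (psrc J)" "Cod E (leg1 (psrc J)) = base (psrc J)"
        "Cod E (leg0 (ptrg J)) = base (ptrg J)" "Cod E (leg1 (ptrg J)) = base (ptrg J)"
      and u: "unt (psrc J) \<in> Mor E" "Dom E (unt (psrc J)) = base (psrc J)"
        "Cod E (unt (psrc J)) = apex (psrc J)" "leg1 (psrc J) \<cdot> unt (psrc J) = Ide E (base (psrc J))"
        "unt (ptrg J) \<in> Mor E" "Dom E (unt (ptrg J)) = base (ptrg J)"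
        "Cod E (unt (ptrg J)) = apex (ptrg J)" "leg0 (ptrg J) \<cdot> unt (ptrg J) = Ide E (base (ptrg J))"
      unfolding internal_category_iff by blast+
    have lu: "lact J \<cdot> spair E (psrc J) J (unt (psrc J) \<cdot> leg0 J) (Ide E (apex J)) = Ide E (apex J) \<longleftrightarrow>
        (\<forall>u. u \<in> Mor E \<longrightarrow> Cod E u = apex J \<longrightarrow> la J (unt (psrc J) \<cdot> (leg0 J \<cdot> u)) u = u)"
      by (rule left_unit_iff[OF l]) (use u c True in simp_all)
    have ru: "ract J \<cdot> spair E J (ptrg J) (Ide E (apex J)) (unt (ptrg J) \<cdot> leg1 J) = Ide E (apex J) \<longleftrightarrow>
        (\<forall>u. u \<in> Mor E \<longrightarrow> Cod E u = apex J \<longrightarrow> ra J u (unt (ptrg J) \<cdot> (leg1 J \<cdot> u)) = u)"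
      by (rule right_unit_iff[OF r]) (use u c True in simp_all)
    show ?thesis
      unfolding internal_profunctor_def Let_def assoc_iff[OF op(1) l l l] assoc_iff[OF r r op(2) r]
        assoc_iff[OF l r r l] lu ru
      using data by blast
  next
    case False
    then show ?thesis
      unfolding internal_profunctor_def Let_def using data by blast
  qed
qed

lemma internal_cell_iff: "internal_cell E c \<longleftrightarrow>
    internal_profunctor E (ctop c) \<and> internal_profunctor E (cbot c) \<and>
    internal_functor E (clft c) \<and> fsrc (clft c) = psrc (ctop c) \<and> ftrg (clft c) = psrc (cbot c) \<and>
    internal_functor E (crgt c) \<and> fsrc (crgt c) = ptrg (ctop c) \<and> ftrg (crgt c) = ptrg (cbot c) \<and>
    cmap c \<in> Mor E \<and> Dom E (cmap c) = apex (ctop c) \<and> Cod E (cmap c) = apex (cbot c) \<and>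
    leg0 (cbot c) \<cdot> cmap c = fob (clft c) \<cdot> leg0 (ctop c) \<and>
    leg1 (cbot c) \<cdot> cmap c = fob (crgt c) \<cdot> leg1 (ctop c) \<and>
    (\<forall>u v. composable (psrc (ctop c)) (ctop c) u v \<longrightarrow>
      la (cbot c) (far (clft c) \<cdot> u) (cmap c \<cdot> v) = cmap c \<cdot> la (ctop c) u v) \<and>
    (\<forall>u v. composable (ctop c) (ptrg (ctop c)) u v \<longrightarrow>
      ra (cbot c) (cmap c \<cdot> u) (far (crgt c) \<cdot> v) = cmap c \<cdot> ra (ctop c) u v)"
    (is "_ \<longleftrightarrow> ?J \<and> ?K \<and> ?f \<and> ?f1 \<and> ?f2 \<and> ?g \<and> ?g1 \<and> ?g2 \<and> ?a1 \<and> ?a2 \<and> ?a3 \<and> ?l0 \<and> ?l1 \<and> ?ll \<and> ?rr")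
proof -
  let ?P = "?J \<and> ?K \<and> ?f \<and> ?f1 \<and> ?f2 \<and> ?g \<and> ?g1 \<and> ?g2 \<and> ?a1 \<and> ?a2 \<and> ?a3 \<and> ?l0 \<and> ?l1"
  define J K f g \<phi> where d: "J = ctop c" "K = cbot c" "f = clft c" "g = crgt c" "\<phi> = cmap c"
  have data: "?J \<and> ?K \<and> ?f \<and> ?f1 \<and> ?f2 \<and> ?g \<and> ?g1 \<and> ?g2 \<and> span_cell E (fob f) (fob g) J K \<phi> \<longleftrightarrow> ?P"
    by (simp add: span_cell_def hom_def d)
  have lr: "(lact K \<cdot> smap E (psrc J) J (psrc K) K (far f) \<phi> = \<phi> \<cdot> lact J \<longleftrightarrow> ?ll) \<and>
      (ract K \<cdot> smap E J (ptrg J) K (ptrg K) \<phi> (far g) = \<phi> \<cdot> ract J \<longleftrightarrow> ?rr)" if P: ?P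
  proof -
    have op: "span_op (psrc J) J J (lact J)" "span_op J (ptrg J) J (ract J)"
      "span_op (psrc K) K K (lact K)" "span_op K (ptrg K) K (ract K)"
      and c: "Cod E (leg0 J) = base (psrc J)" "Cod E (leg1 J) = base (ptrg J)"
      and A: "internal_category E (psrc J)" "internal_category E (psrc K)"
        "internal_category E (ptrg J)" "internal_category E (ptrg K)"
      using P unfolding internal_profunctor_iff d by blast+
    have f: "fob f \<in> Mor E" "Dom E (fob f) = base (psrc J)"
        "far f \<in> Mor E" "Dom E (far f) = apex (psrc J)" "Cod E (far f) = apex (psrc K)"
        "leg1 (psrc K) \<cdot> far f = fob f \<cdot> leg1 (psrc J)"
      and g: "fob g \<in> Mor E" "Dom E (fob g) = base (ptrg J)"
        "far g \<in> Mor E" "Dom E (far g) = apex (ptrg J)" "Cod E (far g) = apex (ptrg K)"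
        "leg0 (ptrg K) \<cdot> far g = fob g \<cdot> leg0 (ptrg J)"
      and \<phi>: "\<phi> \<in> Mor E" "Dom E \<phi> = apex J" "Cod E \<phi> = apex K"
        "leg0 K \<cdot> \<phi> = fob f \<cdot> leg0 J" "leg1 K \<cdot> \<phi> = fob g \<cdot> leg1 J"
      using P unfolding internal_functor_iff d by metis+
    note s = span_opD[OF op(1)] span_opD[OF op(2)] span_opD[OF op(3)] span_opD[OF op(4)] c f g \<phi>
      internal_categoryD[OF A(1)] internal_categoryD[OF A(2)] internal_categoryD[OF A(3)] internal_categoryD[OF A(4)]
    have e: "leg1 (psrc K) \<cdot> (far f \<cdot> sp1 E (psrc J) J) = fob f \<cdot> (leg1 (psrc J) \<cdot> sp1 E (psrc J) J)"
      "leg0 K \<cdot> (\<phi> \<cdot> sp2 E (psrc J) J) = fob f \<cdot> (leg0 J \<cdot> sp2 E (psrc J) J)"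
      "leg1 K \<cdot> (\<phi> \<cdot> sp1 E J (ptrg J)) = fob g \<cdot> (leg1 J \<cdot> sp1 E J (ptrg J))"
      "leg0 (ptrg K) \<cdot> (far g \<cdot> sp2 E J (ptrg J)) = fob g \<cdot> (leg0 (ptrg J) \<cdot> sp2 E J (ptrg J))"
      by (rule Comp_eq_extend; simp add: s)+
    show ?thesis
      unfolding d[symmetric]
      by (intro conjI hom_iff[OF op(1) op(3)] hom_iff[OF op(2) op(4)]) (simp_all add: s e)
  qed
  show ?thesis
    unfolding internal_cell_def Let_def using data[unfolded d] lr[unfolded d] by blast
qed


lemma unt_simps:
  assumes "internal_category E A" "w \<in> Mor E" "Cod E w = base A"
  shows "leg0 A \<cdot> (unt A \<cdot> w) = w" "leg1 A \<cdot> (unt A \<cdot> w) = w"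
  using internal_categoryD[OF assms(1)] assms(2,3) by (simp_all flip: Comp_Comp)

lemma mm_laws:
  assumes "internal_category E A"
  shows "composable A A u v \<Longrightarrow> composable A A v w \<Longrightarrow> mm A (mm A u v) w = mm A u (mm A v w)"
    and "u \<in> Mor E \<Longrightarrow> Cod E u = apex A \<Longrightarrow> mm A (unt A \<cdot> (leg0 A \<cdot> u)) u = u"
    and "u \<in> Mor E \<Longrightarrow> Cod E u = apex A \<Longrightarrow> mm A u (unt A \<cdot> (leg1 A \<cdot> u)) = u"
  using assms unfolding internal_category_iff by blast+

lemma internal_profunctorD:
  assumes "internal_profunctor E J"
  shows "internal_category E (psrc J)" "internal_category E (ptrg J)"
    "span_op (psrc J) J J (lact J)" "span_op J (ptrg J) J (ract J)" "spn J"
    "Cod E (leg0 J) = base (psrc J)" "Cod E (leg1 J) = base (ptrg J)"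
proof -
  show *: "internal_category E (psrc J)" "internal_category E (ptrg J)"
    "span_op (psrc J) J J (lact J)" "span_op J (ptrg J) J (ract J)"
    "Cod E (leg0 J) = base (psrc J)" "Cod E (leg1 J) = base (ptrg J)"
    using assms unfolding internal_profunctor_iff by blast+
  show "spn J"
    using span_opD[OF *(3)] by simp
qed

lemma act_laws:
  assumes "internal_profunctor E J"
  shows "composable (psrc J) (psrc J) u v \<Longrightarrow> composable (psrc J) J v w \<Longrightarrow>
      la J (mm (psrc J) u v) w = la J u (la J v w)"
    and "w \<in> Mor E \<Longrightarrow> Cod E w = apex J \<Longrightarrow> la J (unt (psrc J) \<cdot> (leg0 J \<cdot> w)) w = w"
    and "composable J (ptrg J) w u \<Longrightarrow> composable (ptrg J) (ptrg J) u v \<Longrightarrow>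
      ra J (ra J w u) v = ra J w (mm (ptrg J) u v)"
    and "w \<in> Mor E \<Longrightarrow> Cod E w = apex J \<Longrightarrow> ra J w (unt (ptrg J) \<cdot> (leg1 J \<cdot> w)) = w"
    and "composable (psrc J) J u w \<Longrightarrow> composable J (ptrg J) w v \<Longrightarrow>
      ra J (la J u w) v = la J u (ra J w v)"
  using assms unfolding internal_profunctor_iff by blast+

lemma unit_prof_simps [simp]:
  "apex (unit_prof A) = apex A" "leg0 (unit_prof A) = leg0 A" "leg1 (unit_prof A) = leg1 A"
  "psrc (unit_prof A) = A" "ptrg (unit_prof A) = A" "lact (unit_prof A) = mult A" "ract (unit_prof A) = mult A"
  by (simp_all add: unit_prof_def)

text \<open>\<open>unit_prof A\<close> and \<open>A\<close> are records of different types with the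
  same span, and these operations depend on the span alone.\<close>

lemma unit_prof_spans [simp]:
  "spcomp E (unit_prof A) K = spcomp E A K" "spcomp E K (unit_prof A) = spcomp E K A"
  "sp1 E (unit_prof A) K = sp1 E A K" "sp1 E K (unit_prof A) = sp1 E K A"
  "sp2 E (unit_prof A) K = sp2 E A K" "sp2 E K (unit_prof A) = sp2 E K A"
  "spair E (unit_prof A) K = spair E A K" "spair E K (unit_prof A) = spair E K A"
  "act m (unit_prof A) K = act m A K" "act m K (unit_prof A) = act m K A"
  "spn (unit_prof A) = spn A"
  by (simp_all only: spcomp_def sp1_def sp2_def spair_def act_def spn_def fun_eq_iff unit_prof_simps simp_thms)

lemma span_op_unit_prof [simp]:
  "span_op (unit_prof A) H K m = span_op A H K m" "span_op J (unit_prof A) K m = span_op J A K m"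
  "span_op J H (unit_prof A) m = span_op J H A m"
  by (simp_all only: span_op_def span_cell_def unit_prof_simps unit_prof_spans)

lemma internal_profunctor_unit_prof:
  assumes "internal_category E A"
  shows "internal_profunctor E (unit_prof A)"
  using assms mm_laws[OF assms] internal_categoryD[OF assms]
  unfolding internal_profunctor_iff by simp

end

subsection \<open>The category of commutative squares of a profunctor\<close>

locale tabulated_profunctor = pullback_category E for E :: "('o, 'm, 'x) cat_choice_scheme" (structure) +
  fixes J :: "('o, 'm) prof"
  assumes J: "internal_profunctor E J"
begin

abbreviation "A \<equiv> psrc J"
abbreviation "B \<equiv> ptrg J"

lemmas prof = internal_profunctorD[OF J]
lemmas [simp] = prof internal_categoryD[OF prof(1)] internal_categoryD[OF prof(2)]
  unt_simps[OF prof(1)] unt_simps[OF prof(2)]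
  act_simps[OF prof(3)] act_simps[OF prof(4)] act_Comp[OF prof(3)] act_Comp[OF prof(4)]
  act_simps[OF internal_categoryD(1)[OF prof(1)]] act_simps[OF internal_categoryD(1)[OF prof(2)]]
  act_Comp[OF internal_categoryD(1)[OF prof(1)]] act_Comp[OF internal_categoryD(1)[OF prof(2)]]
  span_opD(5-7)[OF prof(3)] span_opD(5-7)[OF prof(4)]
  mm_laws[OF prof(1)] mm_laws[OF prof(2)] act_laws(2,4)[OF J]

lemma lact_Comp [simp]:
  assumes "w \<in> Mor E" "Cod E w = apex (spcomp E A J)"
  shows "lact J \<cdot> w = la J (sp1 E A J \<cdot> w) (sp2 E A J \<cdot> w)"
  by (rule op_Comp[OF prof(3) assms])

lemma ract_Comp [simp]:
  assumes "w \<in> Mor E" "Cod E w = apex (spcomp E J B)"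
  shows "ract J \<cdot> w = ra J (sp1 E J B \<cdot> w) (sp2 E J B \<cdot> w)"
  by (rule op_Comp[OF prof(4) assms])

text \<open>The commutative squares \<open>u \<sqdot> x = y \<sqdot> v\<close> in \<open>J\<close>, seen as morphisms from \<open>y\<close> to \<open>x\<close>.\<close>

definition square :: "'m \<Rightarrow> 'm \<Rightarrow> 'm \<Rightarrow> 'm \<Rightarrow> bool" where
  "square u x y v \<longleftrightarrow> composable A J u x \<and> composable J B y v \<and> Dom E x = Dom E y \<and> la J u x = ra J y v"

lemma squareD:
  assumes "square u x y v"
  shows "u \<in> Mor E" "x \<in> Mor E" "y \<in> Mor E" "v \<in> Mor E"
    "Dom E u = Dom E v" "Dom E x = Dom E v" "Dom E y = Dom E v"
    "Cod E u = apex A" "Cod E x = apex J" "Cod E y = apex J" "Cod E v = apex B"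
    "la J u x = ra J y v"
    "leg1 A \<cdot> u = leg0 J \<cdot> x" "leg0 B \<cdot> v = leg1 J \<cdot> y" "leg0 A \<cdot> u = leg0 J \<cdot> y" "leg1 B \<cdot> v = leg1 J \<cdot> x"
proof -
  have s: "composable A J u x" "composable J B y v" "Dom E x = Dom E y" "la J u x = ra J y v"
    using assms by (simp_all add: square_def)
  then show "u \<in> Mor E" "x \<in> Mor E" "y \<in> Mor E" "v \<in> Mor E"
    "Dom E u = Dom E v" "Dom E x = Dom E v" "Dom E y = Dom E v"
    "Cod E u = apex A" "Cod E x = apex J" "Cod E y = apex J" "Cod E v = apex B"
    "la J u x = ra J y v" "leg1 A \<cdot> u = leg0 J \<cdot> x" "leg0 B \<cdot> v = leg1 J \<cdot> y"
    by simp_all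
  \<comment> \<open>The outer legs of \<open>u\<close> and \<open>v\<close> are not part of the
    definition of a square; comparing the legs of the two expressions for the diagonal yields
    them.\<close>
  have "leg0 J \<cdot> la J u x = leg0 A \<cdot> u" "leg0 J \<cdot> ra J y v = leg0 J \<cdot> y"
    "leg1 J \<cdot> la J u x = leg1 J \<cdot> x" "leg1 J \<cdot> ra J y v = leg1 B \<cdot> v"
    using s(1,2) by simp_all
  then show "leg0 A \<cdot> u = leg0 J \<cdot> y" "leg1 B \<cdot> v = leg1 J \<cdot> x"
    using s(4) by simp_all
qed

lemma square_Comp [simp]:
  assumes s: "square u x y v" and w: "w \<in> Mor E" "Cod E w = Dom E v"
  shows "square (u \<cdot> w) (x \<cdot> w) (y \<cdot> w) (v \<cdot> w)"
proof -
  note [simp] = squareD(1-11)[OF s]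
  have e: "leg1 A \<cdot> (u \<cdot> w) = leg0 J \<cdot> (x \<cdot> w)" "leg1 J \<cdot> (y \<cdot> w) = leg0 B \<cdot> (v \<cdot> w)"
    by (rule Comp_eq_extend; use w squareD[OF s] in simp)+
  have "la J (u \<cdot> w) (x \<cdot> w) = la J u x \<cdot> w"
    using w squareD(13)[OF s] by simp
  also have "\<dots> = ra J (y \<cdot> w) (v \<cdot> w)"
    unfolding squareD(12)[OF s] using w squareD(14)[OF s] by simp
  finally show ?thesis
    using e w by (simp add: square_def)
qed

text \<open>Pasting along the common edge \<open>x\<close>: (u u') x' = u (x v') = (u x) v' = (y v)
  v' = y (v v'). The second equality is the compatibility of the two actions.\<close>

lemma square_mm [simp]:
  assumes s: "square u x y v" and s': "square u' x' x v'"
  shows "square (mm A u u') x' y (mm B v v')"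
proof -
  have [simp]: "Dom E v' = Dom E v"
    using squareD(6)[OF s] squareD(7)[OF s'] by metis
  note [simp] = squareD(1-11,13-)[OF s] squareD(1-11,13-)[OF s']
  have "la J (mm A u u') x' = la J u (la J u' x')"
    by (rule act_laws[OF J]) simp_all
  also have "\<dots> = la J u (ra J x v')"
    by (simp add: squareD(12)[OF s'])
  also have "\<dots> = ra J (la J u x) v'"
    by (rule act_laws[OF J, symmetric]) simp_all
  also have "\<dots> = ra J (ra J y v) v'"
    by (simp add: squareD(12)[OF s])
  also have "\<dots> = ra J y (mm B v v')"
    by (rule act_laws[OF J]) simp_all
  finally show ?thesis
    by (simp add: square_def)
qed

lemma square_unt [simp]:
  assumes "x \<in> Mor E" "Cod E x = apex J"
  shows "square (unt A \<cdot> (leg0 J \<cdot> x)) x x (unt B \<cdot> (leg1 J \<cdot> x))"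
  using assms by (simp add: square_def)

text \<open>The four sides of the universal square, over the pullback \<open>Q\<close> of the two
  actions; \<open>tpair\<close> is the map into \<open>Q\<close> that classifies a given
  square.\<close>

definition tu where "tu = sp1 E A J \<cdot> Pb1 E (lact J) (ract J)"
definition tx where "tx = sp2 E A J \<cdot> Pb1 E (lact J) (ract J)"
definition ty where "ty = sp1 E J B \<cdot> Pb2 E (lact J) (ract J)"
definition tv where "tv = sp2 E J B \<cdot> Pb2 E (lact J) (ract J)"
definition tpair where "tpair u x y v = pair E (lact J) (ract J) (spair E A J u x) (spair E J B y v)"

abbreviation "Q \<equiv> Dom E (Pb1 E (lact J) (ract J))"

lemma square_t: "square tu tx ty tv"
proof -
  have "lact J \<cdot> Pb1 E (lact J) (ract J) = ract J \<cdot> Pb2 E (lact J) (ract J)"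
    by (rule Pb_commutes) simp_all
  then show ?thesis
    by (simp add: square_def tu_def tx_def ty_def tv_def)
qed

lemma t_simps [simp]: "tu \<in> Mor E" "tx \<in> Mor E" "ty \<in> Mor E" "tv \<in> Mor E"
  "Dom E tu = Q" "Dom E tx = Q" "Dom E ty = Q" "Dom E tv = Q"
  "Cod E tu = apex A" "Cod E tx = apex J" "Cod E ty = apex J" "Cod E tv = apex B"
  by (simp_all add: tu_def tx_def ty_def tv_def)

lemmas t_legs [simp] = squareD(13-)[OF square_t]

lemma square_t_Comp: 
  assumes "t \<in> Mor E" "Cod E t = Q"
  shows "square (tu \<cdot> t) (tx \<cdot> t) (ty \<cdot> t) (tv \<cdot> t)"
  using square_Comp[OF square_t, of t] assms by simp

lemma t_Comp_legs [simp]: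
  assumes "t \<in> Mor E" "Cod E t = Q"
  shows "leg1 A \<cdot> (tu \<cdot> t) = leg0 J \<cdot> (tx \<cdot> t)" "leg0 B \<cdot> (tv \<cdot> t) = leg1 J \<cdot> (ty \<cdot> t)"
    "leg0 A \<cdot> (tu \<cdot> t) = leg0 J \<cdot> (ty \<cdot> t)" "leg1 B \<cdot> (tv \<cdot> t) = leg1 J \<cdot> (tx \<cdot> t)"
  using squareD(13-)[OF square_t_Comp[OF assms]] by simp_all

lemma tpair_simps:
  assumes "square u x y v"
  shows "tpair u x y v \<in> Mor E" "Dom E (tpair u x y v) = Dom E v" "Cod E (tpair u x y v) = Q"
    "tu \<cdot> tpair u x y v = u" "tx \<cdot> tpair u x y v = x" "ty \<cdot> tpair u x y v = y" "tv \<cdot> tpair u x y v = v"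
  using squareD[OF assms] by (simp_all add: tpair_def tu_def tx_def ty_def tv_def)

lemma tpair_eqI:
  assumes t: "t \<in> Mor E" "Cod E t = Q" and t': "t' \<in> Mor E" "Cod E t' = Q" and "Dom E t = Dom E t'"
    and "tu \<cdot> t = tu \<cdot> t'" "tx \<cdot> t = tx \<cdot> t'" "ty \<cdot> t = ty \<cdot> t'" "tv \<cdot> t = tv \<cdot> t'"
  shows "t = t'"
proof (rule Pb_eqI[of "lact J" "ract J"])
  show "Pb1 E (lact J) (ract J) \<cdot> t = Pb1 E (lact J) (ract J) \<cdot> t'"
    by (rule sp_eqI[of A J]) (use assms in \<open>simp_all add: tu_def tx_def\<close>)
  show "Pb2 E (lact J) (ract J) \<cdot> t = Pb2 E (lact J) (ract J) \<cdot> t'"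
    by (rule sp_eqI[of J B]) (use assms in \<open>simp_all add: ty_def tv_def\<close>)
qed (use assms in simp_all)

lemma tpair_Comp:
  assumes s: "square u x y v" and w: "w \<in> Mor E" "Cod E w = Dom E v"
  shows "tpair u x y v \<cdot> w = tpair (u \<cdot> w) (x \<cdot> w) (y \<cdot> w) (v \<cdot> w)"
proof -
  have *: "tu \<cdot> (tpair u x y v \<cdot> w) = u \<cdot> w" "tx \<cdot> (tpair u x y v \<cdot> w) = x \<cdot> w"
    "ty \<cdot> (tpair u x y v \<cdot> w) = y \<cdot> w" "tv \<cdot> (tpair u x y v \<cdot> w) = v \<cdot> w"
    using tpair_simps[OF s] w by (simp_all flip: Comp_Comp)
  show ?thesis
    by (rule tpair_eqI)
      (use tpair_simps[OF s] tpair_simps[OF square_Comp[OF s w]] squareD[OF s] w * in simp_all)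
qed

text \<open>The multiplication classifies the pasting \<open>square_mm\<close> of the universal
  composable pair \<open>p\<close>, \<open>q\<close>, and the unit classifies the identity square
  \<open>square_unt\<close> at the universal element of \<open>J\<close>.\<close>

definition tab :: "('o, 'm) icat" where
  "tab = (let p = Pb1 E tx ty; q = Pb2 E tx ty in
    \<lparr>apex = Q, leg0 = ty, leg1 = tx, base = apex J,
     mult = tpair (mm A (tu \<cdot> p) (tu \<cdot> q)) (tx \<cdot> q) (ty \<cdot> p) (mm B (tv \<cdot> p) (tv \<cdot> q)),
     unt = tpair (unt A \<cdot> leg0 J) (Ide E (apex J)) (Ide E (apex J)) (unt B \<cdot> leg1 J)\<rparr>)"

lemma tab_simps [simp]: "apex tab = Q" "leg0 tab = ty" "leg1 tab = tx" "base tab = apex J"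
  by (simp_all add: tab_def Let_def)

lemma mult_tab: "mult tab = tpair (mm A (tu \<cdot> sp1 E tab tab) (tu \<cdot> sp2 E tab tab)) (tx \<cdot> sp2 E tab tab)
    (ty \<cdot> sp1 E tab tab) (mm B (tv \<cdot> sp1 E tab tab) (tv \<cdot> sp2 E tab tab))"
  by (simp add: sp1_def sp2_def) (simp add: tab_def Let_def)

lemma unt_tab: "unt tab = tpair (unt A \<cdot> leg0 J) (Ide E (apex J)) (Ide E (apex J)) (unt B \<cdot> leg1 J)"
  by (simp add: tab_def Let_def)

lemma spn_tab [simp]: "spn tab"
  by (rule spnI) simp_all

lemma square_mult_tab [simp]:
  assumes "s \<in> Mor E" "t \<in> Mor E" "Dom E s = Dom E t" "Cod E s = Q" "Cod E t = Q" "tx \<cdot> s = ty \<cdot> t"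
  shows "square (mm A (tu \<cdot> s) (tu \<cdot> t)) (tx \<cdot> t) (ty \<cdot> s) (mm B (tv \<cdot> s) (tv \<cdot> t))"
  using square_t_Comp[of s] square_t_Comp[of t] assms by (auto intro: square_mm)

lemma tx_sp1_tab [simp]: "tx \<cdot> sp1 E tab tab = ty \<cdot> sp2 E tab tab"
  using sp_commutes[of tab tab] by simp

lemma square_mult_tab0: "square (mm A (tu \<cdot> sp1 E tab tab) (tu \<cdot> sp2 E tab tab)) (tx \<cdot> sp2 E tab tab)
    (ty \<cdot> sp1 E tab tab) (mm B (tv \<cdot> sp1 E tab tab) (tv \<cdot> sp2 E tab tab))"
  by simp

lemma square_unt_tab0: "square (unt A \<cdot> leg0 J) (Ide E (apex J)) (Ide E (apex J)) (unt B \<cdot> leg1 J)"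
  using square_unt[of "Ide E (apex J)"] by simp

lemma span_op_tab: "span_op tab tab tab (mult tab)"
  by (rule span_opI) (simp_all add: mult_tab tpair_simps[OF square_mult_tab0])

lemma mm_tab [simp]:
  assumes "s \<in> Mor E" "t \<in> Mor E" "Dom E s = Dom E t" "Cod E s = Q" "Cod E t = Q" "tx \<cdot> s = ty \<cdot> t"
  shows "mm tab s t = tpair (mm A (tu \<cdot> s) (tu \<cdot> t)) (tx \<cdot> t) (ty \<cdot> s) (mm B (tv \<cdot> s) (tv \<cdot> t))"
proof -
  note [simp] = assms(1-5)
  have [simp]: "leg1 A \<cdot> (tu \<cdot> sp1 E tab tab) = leg0 A \<cdot> (tu \<cdot> sp2 E tab tab)"
    "leg1 B \<cdot> (tv \<cdot> sp1 E tab tab) = leg0 B \<cdot> (tv \<cdot> sp2 E tab tab)"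
    by simp_all
  show ?thesis
    unfolding act_def[of "mult tab"] unfolding mult_tab using assms(6)
    by (subst tpair_Comp[OF square_mult_tab0]) simp_all
qed

lemma unt_tab_Comp [simp]:
  assumes "w \<in> Mor E" "Cod E w = apex J"
  shows "unt tab \<cdot> w = tpair (unt A \<cdot> (leg0 J \<cdot> w)) w w (unt B \<cdot> (leg1 J \<cdot> w))"
  using assms by (simp add: unt_tab tpair_Comp[OF square_unt_tab0])

lemma tpair_t [simp]:
  assumes "t \<in> Mor E" "Cod E t = Q"
  shows "tpair (tu \<cdot> t) (tx \<cdot> t) (ty \<cdot> t) (tv \<cdot> t) = t"
  by (rule tpair_eqI) (use assms tpair_simps[OF square_t_Comp[OF assms]] in simp_all)

lemmas [simp] = tpair_simps

text \<open>Once \<open>mm_tab\<close> and \<open>unt_tab_Comp\<close> have split the operations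
  into components, the laws are those of \<open>A\<close> and \<open>B\<close> in the outer two
  components and trivial in the two middle ones.\<close>

lemma internal_category_tab: "internal_category E tab"
  unfolding internal_category_iff
proof (intro conjI allI impI)
  show "span_op tab tab tab (mult tab)"
    by (rule span_op_tab)
  show "unt tab \<in> Mor E" "Dom E (unt tab) = base tab" "Cod E (unt tab) = apex tab"
    "leg0 tab \<cdot> unt tab = Ide E (base tab)" "leg1 tab \<cdot> unt tab = Ide E (base tab)"
    by (simp_all add: unt_tab tpair_simps[OF square_unt_tab0])
next
  fix u assume u: "u \<in> Mor E" "Cod E u = apex tab"
  show "mm tab (unt tab \<cdot> (leg0 tab \<cdot> u)) u = u" "mm tab u (unt tab \<cdot> (leg1 tab \<cdot> u)) = u"
    using u mm_laws(2)[OF prof(1), of "tu \<cdot> u"] mm_laws(2)[OF prof(2), of "tv \<cdot> u"]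
      mm_laws(3)[OF prof(1), of "tu \<cdot> u"] mm_laws(3)[OF prof(2), of "tv \<cdot> u"] by simp_all
next
  fix u v w assume a: "composable tab tab u v" "composable tab tab v w"
  then show "mm tab (mm tab u v) w = mm tab u (mm tab v w)"
    using square_mult_tab[of u v] square_mult_tab[of v w] by simp
qed simp_all

end

subsection \<open>Functors and cells\<close>

context pullback_category
begin

lemma internal_functorD:
  assumes "internal_functor E f" "fsrc f = A" "ftrg f = C"
  shows "internal_category E A" "internal_category E C"
    "fob f \<in> Mor E" "Dom E (fob f) = base A" "Cod E (fob f) = base C"
    "far f \<in> Mor E" "Dom E (far f) = apex A" "Cod E (far f) = apex C"
    "leg0 C \<cdot> far f = fob f \<cdot> leg0 A" "leg1 C \<cdot> far f = fob f \<cdot> leg1 A"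
    "far f \<cdot> unt A = unt C \<cdot> fob f"
  using assms unfolding internal_functor_iff by blast+

lemma functor_simps:
  assumes f: "internal_functor E f" "fsrc f = A" "ftrg f = C"
  shows "w \<in> Mor E \<Longrightarrow> Cod E w = apex A \<Longrightarrow> leg0 C \<cdot> (far f \<cdot> w) = fob f \<cdot> (leg0 A \<cdot> w)"
    and "w \<in> Mor E \<Longrightarrow> Cod E w = apex A \<Longrightarrow> leg1 C \<cdot> (far f \<cdot> w) = fob f \<cdot> (leg1 A \<cdot> w)"
    and "z \<in> Mor E \<Longrightarrow> Cod E z = base A \<Longrightarrow> far f \<cdot> (unt A \<cdot> z) = unt C \<cdot> (fob f \<cdot> z)"
    and "composable A A u v \<Longrightarrow> far f \<cdot> mm A u v = mm C (far f \<cdot> u) (far f \<cdot> v)"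
proof -
  note f' = internal_functorD[OF f]
  note [simp] = f'(3-8) internal_categoryD[OF f'(1)] internal_categoryD[OF f'(2)]
  show "leg0 C \<cdot> (far f \<cdot> w) = fob f \<cdot> (leg0 A \<cdot> w)" if "w \<in> Mor E" "Cod E w = apex A"
    by (rule Comp_eq_extend[OF f'(9)]) (use that in simp_all)
  show "leg1 C \<cdot> (far f \<cdot> w) = fob f \<cdot> (leg1 A \<cdot> w)" if "w \<in> Mor E" "Cod E w = apex A"
    by (rule Comp_eq_extend[OF f'(10)]) (use that in simp_all)
  show "far f \<cdot> (unt A \<cdot> z) = unt C \<cdot> (fob f \<cdot> z)" if "z \<in> Mor E" "Cod E z = base A"
    by (rule Comp_eq_extend[OF f'(11)]) (use that in simp_all)
  show "far f \<cdot> mm A u v = mm C (far f \<cdot> u) (far f \<cdot> v)" if "composable A A u v"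
    using f that unfolding internal_functor_iff by metis
qed

lemma internal_functorI:
  assumes "internal_category E A" "internal_category E C"
    and "F0 \<in> Mor E" "Dom E F0 = base A" "Cod E F0 = base C"
    and "F \<in> Mor E" "Dom E F = apex A" "Cod E F = apex C"
    and "leg0 C \<cdot> F = F0 \<cdot> leg0 A" "leg1 C \<cdot> F = F0 \<cdot> leg1 A" "F \<cdot> unt A = unt C \<cdot> F0"
    and "\<And>u v. composable A A u v \<Longrightarrow> mm C (F \<cdot> u) (F \<cdot> v) = F \<cdot> mm A u v"
  shows "internal_functor E \<lparr>fsrc = A, ftrg = C, fob = F0, far = F\<rparr>"
  unfolding internal_functor_iff ifunctor.simps using assms by blast

lemma internal_cellD:
  assumes "internal_cell E c" "ctop c = J" "cbot c = K" "clft c = f" "crgt c = g"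
  shows "internal_profunctor E J" "internal_profunctor E K"
    "internal_functor E f" "fsrc f = psrc J" "ftrg f = psrc K"
    "internal_functor E g" "fsrc g = ptrg J" "ftrg g = ptrg K"
    "cmap c \<in> Mor E" "Dom E (cmap c) = apex J" "Cod E (cmap c) = apex K"
    "leg0 K \<cdot> cmap c = fob f \<cdot> leg0 J" "leg1 K \<cdot> cmap c = fob g \<cdot> leg1 J"
  using assms unfolding internal_cell_iff by blast+

lemma cell_simps:
  assumes c: "internal_cell E c" "ctop c = J" "cbot c = K" "clft c = f" "crgt c = g"
  shows "w \<in> Mor E \<Longrightarrow> Cod E w = apex J \<Longrightarrow> leg0 K \<cdot> (cmap c \<cdot> w) = fob f \<cdot> (leg0 J \<cdot> w)"
    and "w \<in> Mor E \<Longrightarrow> Cod E w = apex J \<Longrightarrow> leg1 K \<cdot> (cmap c \<cdot> w) = fob g \<cdot> (leg1 J \<cdot> w)"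
    and "composable (psrc J) J u w \<Longrightarrow> cmap c \<cdot> la J u w = la K (far f \<cdot> u) (cmap c \<cdot> w)"
    and "composable J (ptrg J) w u \<Longrightarrow> cmap c \<cdot> ra J w u = ra K (cmap c \<cdot> w) (far g \<cdot> u)"
proof -
  note c' = internal_cellD[OF c]
  note [simp] = c'(9-11) internal_profunctorD[OF c'(1)] internal_profunctorD[OF c'(2)]
    internal_functorD[OF c'(3,4,5)] internal_functorD[OF c'(6,7,8)]
  show "leg0 K \<cdot> (cmap c \<cdot> w) = fob f \<cdot> (leg0 J \<cdot> w)" if "w \<in> Mor E" "Cod E w = apex J"
    by (rule Comp_eq_extend[OF c'(12)]) (use that in simp_all)
  show "leg1 K \<cdot> (cmap c \<cdot> w) = fob g \<cdot> (leg1 J \<cdot> w)" if "w \<in> Mor E" "Cod E w = apex J"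
    by (rule Comp_eq_extend[OF c'(13)]) (use that in simp_all)
  show "cmap c \<cdot> la J u w = la K (far f \<cdot> u) (cmap c \<cdot> w)" if "composable (psrc J) J u w"
    using c that unfolding internal_cell_iff by metis
  show "cmap c \<cdot> ra J w u = ra K (cmap c \<cdot> w) (far g \<cdot> u)" if "composable J (ptrg J) w u"
    using c that unfolding internal_cell_iff by metis
qed

lemma internal_cellI:
  assumes "internal_profunctor E J" "internal_profunctor E K"
    and "internal_functor E f" "fsrc f = psrc J" "ftrg f = psrc K"
    and "internal_functor E g" "fsrc g = ptrg J" "ftrg g = ptrg K"
    and "\<phi> \<in> Mor E" "Dom E \<phi> = apex J" "Cod E \<phi> = apex K"
    and "leg0 K \<cdot> \<phi> = fob f \<cdot> leg0 J" "leg1 K \<cdot> \<phi> = fob g \<cdot> leg1 J"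
    and "\<And>u w. composable (psrc J) J u w \<Longrightarrow> la K (far f \<cdot> u) (\<phi> \<cdot> w) = \<phi> \<cdot> la J u w"
    and "\<And>w u. composable J (ptrg J) w u \<Longrightarrow> ra K (\<phi> \<cdot> w) (far g \<cdot> u) = \<phi> \<cdot> ra J w u"
  shows "internal_cell E \<lparr>ctop = J, cbot = K, clft = f, crgt = g, cmap = \<phi>\<rparr>"
  unfolding internal_cell_iff pcell.simps using assms by blast

end

lemma Cat_int_simps [simp]:
  "Ob (Cat_int E) = Collect (internal_category E)" "Mor (Cat_int E) = Collect (internal_functor E)"
  "Dom (Cat_int E) = fsrc" "Cod (Cat_int E) = ftrg"
  "Ide (Cat_int E) A = \<lparr>fsrc = A, ftrg = A, fob = Ide E (base A), far = Ide E (apex A)\<rparr>"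
  "Comp (Cat_int E) g f = \<lparr>fsrc = fsrc f, ftrg = ftrg g, fob = fob g \<cdot>\<^bsub>E\<^esub> fob f, far = far g \<cdot>\<^bsub>E\<^esub> far f\<rparr>"
  by (simp_all add: Cat_int_def)

lemma Prof_simps [simp]:
  "Vert (Prof E) = Cat_int E" "Hor (Prof E) = Collect (internal_profunctor E)"
  "hsrc (Prof E) = psrc" "htrg (Prof E) = ptrg" "Sq (Prof E) = Collect (internal_cell E)"
  "sqtop (Prof E) = ctop" "sqbot (Prof E) = cbot" "sqlft (Prof E) = clft" "sqrgt (Prof E) = crgt"
  "vid (Prof E) J = id_pcell E J J (Ide E (apex J))"
  "hunit (Prof E) = unit_prof"
  "vcomp (Prof E) \<psi> \<phi> = \<lparr>ctop = ctop \<phi>, cbot = cbot \<psi>, clft = clft \<psi> \<cdot>\<^bsub>Cat_int E\<^esub> clft \<phi>,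
    crgt = crgt \<psi> \<cdot>\<^bsub>Cat_int E\<^esub> crgt \<phi>, cmap = cmap \<psi> \<cdot>\<^bsub>E\<^esub> cmap \<phi>\<rparr>"
  "ucell (Prof E) f = \<lparr>ctop = unit_prof (fsrc f), cbot = unit_prof (ftrg f), clft = f, crgt = f, cmap = far f\<rparr>"
  by (simp_all add: Prof_def)

lemma hom_Cat_int: "f \<in> hom (Vert (Prof E)) X Y \<longleftrightarrow> internal_functor E f \<and> fsrc f = X \<and> ftrg f = Y"
  by (simp add: hom_def)

section \<open>The defining cell, its one-dimensional property and its opcartesianness\<close>

context tabulated_profunctor
begin

lemmas [simp] = internal_category_tab unt_simps[OF internal_category_tab, simplified]

definition proj_A :: "('o, 'm) ifunctor" where
  "proj_A = \<lparr>fsrc = tab, ftrg = A, fob = leg0 J, far = tu\<rparr>"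

definition proj_B :: "('o, 'm) ifunctor" where
  "proj_B = \<lparr>fsrc = tab, ftrg = B, fob = leg1 J, far = tv\<rparr>"

definition tab_cell :: "('o, 'm) pcell" where
  "tab_cell = \<lparr>ctop = unit_prof tab, cbot = J, clft = proj_A, crgt = proj_B, cmap = la J tu tx\<rparr>"

lemma unt_tab_simps [simp]: "unt tab \<in> Mor E" "Dom E (unt tab) = apex J" "Cod E (unt tab) = Q"
  "tx \<cdot> unt tab = Ide E (apex J)" "ty \<cdot> unt tab = Ide E (apex J)" 
  "tu \<cdot> unt tab = unt A \<cdot> leg0 J" "tv \<cdot> unt tab = unt B \<cdot> leg1 J"
  using internal_categoryD[OF internal_category_tab] 
  by (simp_all) (simp_all add: unt_tab tpair_simps[OF square_unt_tab0])

lemma internal_functor_proj: "internal_functor E proj_A" "internal_functor E proj_B"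
  unfolding proj_A_def proj_B_def by (rule internal_functorI; auto)+

text \<open>Of the two expressions for the diagonal of a square, this orientation makes
  \<open>u \<cdot> x\<close> the normal form.\<close>

lemma la_ra_t [simp]:
  assumes "t \<in> Mor E" "Cod E t = Q"
  shows "ra J (ty \<cdot> t) (tv \<cdot> t) = la J (tu \<cdot> t) (tx \<cdot> t)"
  using squareD[OF square_t_Comp[OF assms]] by simp

lemma internal_cell_tab_cell: "internal_cell E tab_cell"
  unfolding tab_cell_def
proof (rule internal_cellI)
  fix u w
  assume a: "composable (psrc (unit_prof tab)) (unit_prof tab) u w"
  then show "la J (far proj_A \<cdot> u) (la J tu tx \<cdot> w) = la J tu tx \<cdot> la (unit_prof tab) u w"
    by (simp add: proj_A_def act_laws(1)[OF J])
next
  fix u w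
  assume a: "composable (unit_prof tab) (ptrg (unit_prof tab)) w u"
  \<comment> \<open>Left equivariance is plain associativity for the diagonal in the form u x. On
    the right the diagonal of \<open>w\<close> must first be rewritten as y v, and the diagonal of
    the composite is turned back at the end.\<close>
  then have "ra J (la J (tu \<cdot> w) (tx \<cdot> w)) (tv \<cdot> u) = ra J (ra J (ty \<cdot> w) (tv \<cdot> w)) (tv \<cdot> u)"
    by simp
  also have "\<dots> = ra J (ty \<cdot> w) (mm B (tv \<cdot> w) (tv \<cdot> u))"
    by (rule act_laws(3)[OF J]) (use a in simp_all)
  also have "\<dots> = la J (mm A (tu \<cdot> w) (tu \<cdot> u)) (tx \<cdot> u)"
    using squareD(12)[OF square_mult_tab[of w u]] a by simp
  finally show "ra J (la J tu tx \<cdot> w) (far proj_B \<cdot> u) = la J tu tx \<cdot> ra (unit_prof tab) w u"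
    using a by (simp add: proj_B_def)
qed (auto simp: internal_functor_proj[unfolded proj_A_def proj_B_def] proj_A_def proj_B_def J intro: internal_profunctor_unit_prof)

lemma tab_cell_unt: "la J tu tx \<cdot> unt tab = Ide E (apex J)"
  using act_laws(2)[OF J, of "Ide E (apex J)"] by simp

lemma tabulation_1dim: "tabulation_1dim (Prof E) J tab tab_cell"
  unfolding tabulation_1dim_def
proof (intro allI impI)
  fix X \<phi> \<phi>\<^sub>A \<phi>\<^sub>B
  assume X: "X \<in> Ob (Vert (Prof E))"
    and \<phi>: "is_cell (Prof E) \<phi> (hunit (Prof E) X) J \<phi>\<^sub>A \<phi>\<^sub>B"
  then have X: "internal_category E X"
    and c: "internal_cell E \<phi>" "ctop \<phi> = unit_prof X" "cbot \<phi> = J" "clft \<phi> = \<phi>\<^sub>A" "crgt \<phi> = \<phi>\<^sub>B"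
    by (simp_all add: is_cell_def)
  \<comment> \<open>\<open>e\<close> is the value of the cell on identities; it becomes the object
    part of the functor into the tabulation.\<close>
  define p e where "p = cmap \<phi>" and "e = p \<cdot> unt X"
  note cc = internal_cellD[OF c, simplified] cell_simps[OF c, simplified]
  note [simp] = X internal_categoryD[OF X] unt_simps[OF X] mm_laws[OF X]
    cc[folded p_def] internal_functorD[OF cc(3-5)] internal_functorD[OF cc(6-8)]
    functor_simps[OF cc(3-5)] functor_simps[OF cc(6-8)]
    act_simps[OF internal_categoryD(1)[OF X]] act_Comp[OF internal_categoryD(1)[OF X]]
  have e [simp]: "e \<in> Mor E" "Dom E e = base X" "Cod E e = apex J"
    "leg0 J \<cdot> e = fob \<phi>\<^sub>A" "leg1 J \<cdot> e = fob \<phi>\<^sub>B"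
    by (simp_all add: e_def)
  have [simp]: "leg0 J \<cdot> (e \<cdot> w) = fob \<phi>\<^sub>A \<cdot> w" "leg1 J \<cdot> (e \<cdot> w) = fob \<phi>\<^sub>B \<cdot> w"
    if "w \<in> Mor E" "Cod E w = base X" for w
    using that by (simp_all add: e_def)
  \<comment> \<open>The universal arrow of \<open>X\<close> is composed with the identity at its
    target, and left equivariance expresses \<open>p\<close> through \<phi>_A and \<open>e\<close>.
    The identity at its source gives the other expression below; together they are the commutative
    square \<open>sq\<close>.\<close>
  have "p = p \<cdot> mm X (Ide E (apex X)) (unt X \<cdot> leg1 X)"
    using mm_laws(3)[OF X, of "Ide E (apex X)"] by simp
  also have "\<dots> = la J (far \<phi>\<^sub>A \<cdot> Ide E (apex X)) (p \<cdot> (unt X \<cdot> leg1 X))"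
    by (rule cc(16)[folded p_def]) simp
  finally have pl: "la J (far \<phi>\<^sub>A) (e \<cdot> leg1 X) = p"
    by (simp add: e_def)
  have "p = p \<cdot> mm X (unt X \<cdot> leg0 X) (Ide E (apex X))"
    using mm_laws(2)[OF X, of "Ide E (apex X)"] by simp
  also have "\<dots> = ra J (p \<cdot> (unt X \<cdot> leg0 X)) (far \<phi>\<^sub>B \<cdot> Ide E (apex X))"
    by (rule cc(17)[folded p_def]) simp
  finally have pr: "ra J (e \<cdot> leg0 X) (far \<phi>\<^sub>B) = p"
    by (simp add: e_def)
  have sq: "square (far \<phi>\<^sub>A) (e \<cdot> leg1 X) (e \<cdot> leg0 X) (far \<phi>\<^sub>B)"
    using pl pr by (simp add: square_def)
  define F where "F = tpair (far \<phi>\<^sub>A) (e \<cdot> leg1 X) (e \<cdot> leg0 X) (far \<phi>\<^sub>B)"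
  have F [simp]: "F \<in> Mor E" "Dom E F = apex X" "Cod E F = Q"
    "tu \<cdot> F = far \<phi>\<^sub>A" "tx \<cdot> F = e \<cdot> leg1 X" "ty \<cdot> F = e \<cdot> leg0 X" "tv \<cdot> F = far \<phi>\<^sub>B"
    using tpair_simps[OF sq] by (simp_all add: F_def)
  have Fw [simp]: "F \<cdot> w = tpair (far \<phi>\<^sub>A \<cdot> w) (e \<cdot> (leg1 X \<cdot> w)) (e \<cdot> (leg0 X \<cdot> w)) (far \<phi>\<^sub>B \<cdot> w)"
    if "w \<in> Mor E" "Cod E w = apex X" for w
    using that tpair_Comp[OF sq, of w] by (simp add: F_def)
  have sqw [simp]: "square (far \<phi>\<^sub>A \<cdot> w) (e \<cdot> (leg1 X \<cdot> w)) (e \<cdot> (leg0 X \<cdot> w)) (far \<phi>\<^sub>B \<cdot> w)"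
    if "w \<in> Mor E" "Cod E w = apex X" for w
    using that square_Comp[OF sq, of w] by simp
  define \<phi>' where "\<phi>' = \<lparr>fsrc = X, ftrg = tab, fob = e, far = F\<rparr>"
  have \<phi>': "fsrc \<phi>' = X" "ftrg \<phi>' = tab"
    by (simp_all add: \<phi>'_def)
  have \<phi>'_functor: "internal_functor E \<phi>'"
    unfolding \<phi>'_def
  proof (rule internal_functorI)
    fix u v
    assume a: "composable X X u v"
    then show "mm tab (F \<cdot> u) (F \<cdot> v) = F \<cdot> mm X u v"
      using sqw[of u] sqw[of v] by simp
  qed simp_all
  have \<phi>'_eq: "vcomp (Prof E) tab_cell (ucell (Prof E) \<phi>') = \<phi>"
    using c cc(4,5,7,8) pl by (simp add: tab_cell_def \<phi>'_def proj_A_def proj_B_def p_def)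
  have unique: "\<psi> = \<phi>'" if \<psi>: "internal_functor E \<psi>" "fsrc \<psi> = X" "ftrg \<psi> = tab"
    and e\<psi>: "vcomp (Prof E) tab_cell (ucell (Prof E) \<psi>) = \<phi>" for \<psi>
  proof -
    note [simp] = internal_functorD(3-)[OF \<psi>, simplified]
    have 1: "tu \<cdot> far \<psi> = far \<phi>\<^sub>A" "tv \<cdot> far \<psi> = far \<phi>\<^sub>B" "la J tu tx \<cdot> far \<psi> = p"
      using arg_cong[OF e\<psi>, of "\<lambda>c. far (clft c)"] arg_cong[OF e\<psi>, of "\<lambda>c. far (crgt c)"]
        arg_cong[OF e\<psi>, of cmap] c(4,5)
      by (simp_all add: tab_cell_def proj_A_def proj_B_def p_def)
    \<comment> \<open>A functor sends identities to identity squares, and the diagonal of an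
      identity square is the object it sits on. Evaluation at identities therefore recovers the
      object part of \<psi>.\<close>
    have "e = (la J tu tx \<cdot> far \<psi>) \<cdot> unt X"
      by (simp only: 1(3) e_def)
    also have "\<dots> = la J tu tx \<cdot> (far \<psi> \<cdot> unt X)"
      by (rule Comp_Comp) simp_all
    also have "\<dots> = la J tu tx \<cdot> (unt tab \<cdot> fob \<psi>)"
      using internal_functorD(11)[OF \<psi>] by (simp only:)
    finally have 2: "fob \<psi> = e"
      by simp
    have "far \<psi> = F"
      by (rule tpair_eqI) (use 1 2 internal_functorD(9,10)[OF \<psi>] in simp_all)
    then show ?thesis
      using \<psi> 2 by (simp add: \<phi>'_def)
  qed
  show "\<exists>!\<phi>'. \<phi>' \<in> hom (Vert (Prof E)) X tab \<and> vcomp (Prof E) tab_cell (ucell (Prof E) \<phi>') = \<phi>"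
    unfolding hom_Cat_int by (rule ex1I[of _ \<phi>']; use \<phi>' \<phi>'_functor \<phi>'_eq unique in blast)
qed

lemma opcartesian_tab_cell: "opcartesian (Prof E) tab_cell"
  unfolding opcartesian_def
proof (intro conjI allI impI)
  show "tab_cell \<in> Sq (Prof E)"
    by (simp add: internal_cell_tab_cell)
next
  fix L h k \<chi>
  assume "h \<in> Mor (Vert (Prof E))" "k \<in> Mor (Vert (Prof E))"
    "Dom (Vert (Prof E)) h = Cod (Vert (Prof E)) (sqlft (Prof E) tab_cell)"
    "Dom (Vert (Prof E)) k = Cod (Vert (Prof E)) (sqrgt (Prof E) tab_cell)"
    and \<chi>: "is_cell (Prof E) \<chi> (sqtop (Prof E) tab_cell) L
      (h \<cdot>\<^bsub>Vert (Prof E)\<^esub> sqlft (Prof E) tab_cell) (k \<cdot>\<^bsub>Vert (Prof E)\<^esub> sqrgt (Prof E) tab_cell)"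
  then have hk: "internal_functor E h" "fsrc h = A" "internal_functor E k" "fsrc k = B"
    by (simp_all add: tab_cell_def proj_A_def proj_B_def)
  let ?h = "\<lparr>fsrc = tab, ftrg = ftrg h, fob = fob h \<cdot> leg0 J, far = far h \<cdot> tu\<rparr>"
  let ?k = "\<lparr>fsrc = tab, ftrg = ftrg k, fob = fob k \<cdot> leg1 J, far = far k \<cdot> tv\<rparr>"
  have c: "internal_cell E \<chi>" "ctop \<chi> = unit_prof tab" "cbot \<chi> = L" "clft \<chi> = ?h" "crgt \<chi> = ?k"
    using \<chi> by (simp_all add: is_cell_def tab_cell_def proj_A_def proj_B_def)
  note cc = internal_cellD[OF c, simplified] cell_simps[OF c, simplified]
  have L: "internal_profunctor E L" "ftrg h = psrc L" "ftrg k = ptrg L"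
    using internal_cellD(2,5,8)[OF c] by simp_all
  define x where "x = cmap \<chi>"
  note [simp] = hk L internal_profunctorD[OF L(1)] act_laws(2,4)[OF L(1)]
    internal_categoryD[OF internal_profunctorD(1)[OF L(1)]]
    internal_categoryD[OF internal_profunctorD(2)[OF L(1)]]
    internal_functorD[OF hk(1,2) L(2)] internal_functorD[OF hk(3,4) L(3)]
    functor_simps(1-3)[OF hk(1,2) L(2)] functor_simps(1-3)[OF hk(3,4) L(3)]
    internal_cellD(9-13)[OF c, simplified, folded x_def] cell_simps(1,2)[OF c, simplified, folded x_def]
  note x_mm = cell_simps(3,4)[OF c, simplified, folded x_def]
  \<comment> \<open>The only candidate for the factorisation, since \<open>unt tab\<close> splits
    the defining cell by \<open>tab_cell_unt\<close>.\<close>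
  define y where "y = x \<cdot> unt tab"
  have [simp]: "y \<in> Mor E" "Dom E y = apex J" "Cod E y = apex L"
    "leg0 L \<cdot> y = fob h \<cdot> leg0 J" "leg1 L \<cdot> y = fob k \<cdot> leg1 J"
    by (simp_all add: y_def del: unt_tab_Comp)
  have x_unt: "x \<cdot> tpair (unt A \<cdot> (leg0 J \<cdot> w)) w w (unt B \<cdot> (leg1 J \<cdot> w)) = y \<cdot> w"
    if "w \<in> Mor E" "Cod E w = apex J" for w
    using that by (simp add: y_def flip: unt_tab_Comp)
  have y_leg [simp]: "leg0 L \<cdot> (y \<cdot> w) = fob h \<cdot> (leg0 J \<cdot> w)" "leg1 L \<cdot> (y \<cdot> w) = fob k \<cdot> (leg1 J \<cdot> w)"
    if "w \<in> Mor E" "Cod E w = apex J" for w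
    using that by (simp_all add: y_def del: unt_tab_Comp)
  \<comment> \<open>Composing a square with the identity square at its target, and using left
    equivariance, shows that its image depends on \<open>u\<close> and \<open>z\<close> only;
    \<open>xr\<close> does the same at the source, with \<open>w\<close> and
    \<open>v\<close>.\<close>
  have xl: "x \<cdot> tpair u z w v = la L (far h \<cdot> u) (y \<cdot> z)" if s: "square u z w v" for u z w v
  proof -
    note [simp] = tpair_simps[OF s] squareD(1-11)[OF s]
    have "x \<cdot> tpair u z w v = x \<cdot> mm tab (tpair u z w v) (unt tab \<cdot> (leg1 tab \<cdot> tpair u z w v))"
      by (subst mm_laws(3)[OF internal_category_tab]) simp_all
    also have "\<dots> = la L ((far h \<cdot> tu) \<cdot> tpair u z w v) (x \<cdot> (unt tab \<cdot> (leg1 tab \<cdot> tpair u z w v)))"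
      by (rule x_mm) simp
    finally show ?thesis
      by (simp add: x_unt)
  qed
  have xr: "x \<cdot> tpair u z w v = ra L (y \<cdot> w) (far k \<cdot> v)" if s: "square u z w v" for u z w v
  proof -
    note [simp] = tpair_simps[OF s] squareD(1-11)[OF s]
    have "x \<cdot> tpair u z w v = x \<cdot> mm tab (unt tab \<cdot> (leg0 tab \<cdot> tpair u z w v)) (tpair u z w v)"
      by (subst mm_laws(2)[OF internal_category_tab]) simp_all
    also have "\<dots> = ra L (x \<cdot> (unt tab \<cdot> (leg0 tab \<cdot> tpair u z w v))) ((far k \<cdot> tv) \<cdot> tpair u z w v)"
      by (rule x_mm) simp
    finally show ?thesis
      by (simp add: x_unt)
  qed
  \<comment> \<open>A square \<open>t\<close> with diagonal \<open>d\<close> is the composite of the squares \<open>1 \<sqdot> d = y \<sqdot> v\<close> and \<open>u \<sqdot> x = d \<sqdot> 1\<close>,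
    and \<open>\<chi>\<close> sends both to \<open>\<chi> 1\<^sub>d\<close>.\<close>
  have xt: "x \<cdot> t = y \<cdot> (la J tu tx \<cdot> t)" if t: "t \<in> Mor E" "Cod E t = Q" for t
  proof -
    define d where "d = la J (tu \<cdot> t) (tx \<cdot> t)"
    have [simp]: "d \<in> Mor E" "Dom E d = Dom E t" "Cod E d = apex J"
        "leg0 J \<cdot> d = leg0 J \<cdot> (ty \<cdot> t)" "leg1 J \<cdot> d = leg1 J \<cdot> (tx \<cdot> t)"
      using t by (simp_all add: d_def)
    have 1: "square (unt A \<cdot> (leg0 J \<cdot> d)) d (ty \<cdot> t) (tv \<cdot> t)"
      using t act_laws(2)[OF J, of d] by (simp add: square_def d_def)
    have 2: "square (tu \<cdot> t) (tx \<cdot> t) d (unt B \<cdot> (leg1 J \<cdot> d))"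
      using t act_laws(4)[OF J, of d] by (simp add: square_def d_def)
    let ?t1 = "tpair (unt A \<cdot> (leg0 J \<cdot> d)) d (ty \<cdot> t) (tv \<cdot> t)"
    let ?t2 = "tpair (tu \<cdot> t) (tx \<cdot> t) d (unt B \<cdot> (leg1 J \<cdot> d))"
    note s = t tpair_simps[OF 1] tpair_simps[OF 2]
    have "mm tab ?t1 ?t2 = t"
      using mm_laws(2)[OF prof(1), of "tu \<cdot> t"] mm_laws(3)[OF prof(2), of "tv \<cdot> t"] s by simp
    then have "x \<cdot> t = x \<cdot> mm tab ?t1 ?t2"
      by simp
    also have "\<dots> = ra L (x \<cdot> ?t1) ((far k \<cdot> tv) \<cdot> ?t2)"
      by (rule x_mm) (use s in simp)
    also have "x \<cdot> ?t1 = la L (far h \<cdot> (unt A \<cdot> (leg0 J \<cdot> d))) (y \<cdot> d)"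
      by (rule xl[OF 1])
    also have "\<dots> = y \<cdot> d"
      using t act_laws(2)[OF L(1), of "y \<cdot> d"] by simp
    also have "ra L (y \<cdot> d) ((far k \<cdot> tv) \<cdot> ?t2) = y \<cdot> d"
      using s act_laws(4)[OF L(1), of "y \<cdot> d"] by simp
    finally show ?thesis
      using t by (simp add: d_def)
  qed
  have y_cell: "internal_cell E \<lparr>ctop = J, cbot = L, clft = h, crgt = k, cmap = y\<rparr>"
  proof (rule internal_cellI)
    fix u w
    assume a: "composable A J u w"
    \<comment> \<open>This square has an identity as its \<open>B\<close>-side, so its diagonal is
      the product of \<open>u\<close> and \<open>w\<close>. Its image is computed from
      \<open>u\<close> and \<open>w\<close> by \<open>xl\<close> and from the diagonal by
      \<open>xt\<close>; comparison gives left equivariance of \<open>y\<close>. The right action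
      uses an identity as the \<open>A\<close>-side.\<close>
    have "square u w (la J u w) (unt B \<cdot> (leg1 J \<cdot> la J u w))"
      using a act_laws(4)[OF J, of "la J u w"] by (simp add: square_def)
    from xl[OF this] xt tpair_simps[OF this] show "la L (far h \<cdot> u) (y \<cdot> w) = y \<cdot> la J u w"
      by simp
  next
    fix w u
    assume a: "composable J B w u"
    have "square (unt A \<cdot> (leg0 J \<cdot> ra J w u)) (ra J w u) w u"
      using a act_laws(2)[OF J, of "ra J w u"] by (simp add: square_def)
    from xr[OF this] xt tpair_simps[OF this] show "ra L (y \<cdot> w) (far k \<cdot> u) = y \<cdot> ra J w u"
      using a act_laws(2)[OF J, of "ra J w u"] by simp
  qed (simp_all add: J)
  have xy: "x = y \<cdot> la J tu tx"
    using xt[of "Ide E Q"] by simp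
  show "\<exists>!\<chi>'. is_cell (Prof E) \<chi>' (sqbot (Prof E) tab_cell) L h k \<and> vcomp (Prof E) \<chi>' tab_cell = \<chi>"
  proof (rule ex1I)
    show "is_cell (Prof E) \<lparr>ctop = J, cbot = L, clft = h, crgt = k, cmap = y\<rparr> (sqbot (Prof E) tab_cell) L h k \<and>
        vcomp (Prof E) \<lparr>ctop = J, cbot = L, clft = h, crgt = k, cmap = y\<rparr> tab_cell = \<chi>"
      using y_cell c xy by (simp add: is_cell_def tab_cell_def proj_A_def proj_B_def x_def)
  next
    fix \<psi>
    assume "is_cell (Prof E) \<psi> (sqbot (Prof E) tab_cell) L h k \<and> vcomp (Prof E) \<psi> tab_cell = \<chi>"
    then have \<psi>: "internal_cell E \<psi>" "ctop \<psi> = J" "cbot \<psi> = L" "clft \<psi> = h" "crgt \<psi> = k"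
      and eq: "vcomp (Prof E) \<psi> tab_cell = \<chi>"
      by (simp_all only: is_cell_def) (simp_all add: tab_cell_def)
    note [simp] = internal_cellD(9-11)[OF \<psi>]
    have "x = cmap \<psi> \<cdot> la J tu tx"
      using arg_cong[OF eq, of cmap] by (simp add: tab_cell_def x_def)
    then have "y = cmap \<psi> \<cdot> (la J tu tx \<cdot> unt tab)"
      by (simp add: y_def del: act_simps act_Comp)
    then have "y = cmap \<psi>"
      using tab_cell_unt by simp
    then show "\<psi> = \<lparr>ctop = J, cbot = L, clft = h, crgt = k, cmap = y\<rparr>"
      using \<psi> by simp
  qed
qed

end

subsection \<open>Horizontal composites\<close>

lemma Prof_horizontal_simps [simp]:
  "hcomp (Prof E) = hcomp_prof E"
  "lunit (Prof E) J = id_pcell E (hcomp_prof E (unit_prof (psrc J)) J) J (desc E (hquot E (unit_prof (psrc J)) J) (lact J))"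
  "runit (Prof E) J = id_pcell E (hcomp_prof E J (unit_prof (ptrg J))) J (desc E (hquot E J (unit_prof (ptrg J))) (ract J))"
  "hcell (Prof E) \<phi> \<chi> = \<lparr>ctop = hcomp_prof E (ctop \<phi>) (ctop \<chi>), cbot = hcomp_prof E (cbot \<phi>) (cbot \<chi>),
     clft = clft \<phi>, crgt = crgt \<chi>,
     cmap = desc E (hquot E (ctop \<phi>) (ctop \<chi>)) (hquot E (cbot \<phi>) (cbot \<chi>) \<cdot>\<^bsub>E\<^esub>
       smap E (ctop \<phi>) (ctop \<chi>) (cbot \<phi>) (cbot \<chi>) (cmap \<phi>) (cmap \<chi>))\<rparr>"
  by (simp_all add: Prof_def Let_def)

lemma id_pcell_simps [simp]:
  "ctop (id_pcell E J K \<phi>) = J" "cbot (id_pcell E J K \<phi>) = K" "cmap (id_pcell E J K \<phi>) = \<phi>"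
  "clft (id_pcell E J K \<phi>) = Ide (Cat_int E) (psrc J)" "crgt (id_pcell E J K \<phi>) = Ide (Cat_int E) (ptrg J)"
  by (simp_all only: id_pcell_def pcell.simps)

context pullback_category
begin

lemma internal_functor_Ide: "internal_category E A \<Longrightarrow> internal_functor E (Ide (Cat_int E) A)"
  unfolding Cat_int_simps
  by (rule internal_functorI) (simp_all add: internal_categoryD act_simps[OF internal_categoryD(1)])

section \<open>Transport of a profunctor structure along an isomorphism of spans, and the inverse of
  the resulting cell\<close>

context
  fixes K H :: "('o, 'm) prof" and r s
  assumes H: "internal_profunctor E H"
    and r: "r \<in> Mor E" "Dom E r = apex K" "Cod E r = apex H"
    and s: "s \<in> Mor E" "Dom E s = apex H" "Cod E s = apex K"
    and rs: "r \<cdot> s = Ide E (apex H)" and sr: "s \<cdot> r = Ide E (apex K)"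
    and K: "psrc K = psrc H" "ptrg K = ptrg H" "leg0 K = leg0 H \<cdot> r" "leg1 K = leg1 H \<cdot> r"
    and lact: "lact K \<in> Mor E" "Dom E (lact K) = apex (spcomp E (psrc H) K)" "Cod E (lact K) = apex K"
      "\<And>u w. composable (psrc H) K u w \<Longrightarrow> la K u w = s \<cdot> la H u (r \<cdot> w)"
    and ract: "ract K \<in> Mor E" "Dom E (ract K) = apex (spcomp E K (ptrg H))" "Cod E (ract K) = apex K"
      "\<And>w u. composable K (ptrg H) w u \<Longrightarrow> ra K w u = s \<cdot> ra H (r \<cdot> w) u"
begin

lemmas transport_simps = H r s rs sr K lact(1-3) ract(1-3)
  internal_profunctorD[OF H] internal_categoryD[OF internal_profunctorD(1)[OF H]]
  internal_categoryD[OF internal_profunctorD(2)[OF H]]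
  act_simps[OF internal_profunctorD(3)[OF H]] act_simps[OF internal_profunctorD(4)[OF H]]
  act_Comp[OF internal_profunctorD(3)[OF H]] act_Comp[OF internal_profunctorD(4)[OF H]]
  act_simps[OF internal_categoryD(1)[OF internal_profunctorD(1)[OF H]]]
  act_simps[OF internal_categoryD(1)[OF internal_profunctorD(2)[OF H]]]

lemma rs_Comp: 
  "w \<in> Mor E \<Longrightarrow> Cod E w = apex H \<Longrightarrow> r \<cdot> (s \<cdot> w) = w"
  "w \<in> Mor E \<Longrightarrow> Cod E w = apex K \<Longrightarrow> s \<cdot> (r \<cdot> w) = w"
  using r s rs sr by (simp_all flip: Comp_Comp)

lemma spn_transport: "spn K"
  by (rule spnI) (simp_all add: transport_simps)

lemma span_op_transport: "span_op (psrc H) K K (lact K)" "span_op K (ptrg H) K (ract K)"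
proof -
  note [simp] = transport_simps spn_transport rs_Comp
  have l: "lact K = s \<cdot> la H (sp1 E (psrc H) K) (r \<cdot> sp2 E (psrc H) K)"
    by (subst lact(4)[symmetric]) (simp_all add: act_def)
  show "span_op (psrc H) K K (lact K)"
    by (rule span_opI) (simp_all, simp_all add: l)
  have [simp]: "leg1 H \<cdot> (r \<cdot> sp1 E K (ptrg H)) = leg0 (ptrg H) \<cdot> sp2 E K (ptrg H)"
    using sp_commutes[of K "ptrg H"] by simp
  have l: "ract K = s \<cdot> ra H (r \<cdot> sp1 E K (ptrg H)) (sp2 E K (ptrg H))"
    by (subst ract(4)[symmetric]) (simp_all add: act_def)
  show "span_op K (ptrg H) K (ract K)"
    by (rule span_opI) (simp_all, simp_all add: l)
qed

lemma act_transport: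
  "u \<in> Mor E \<Longrightarrow> w \<in> Mor E \<Longrightarrow> Dom E u = Dom E w \<Longrightarrow> Cod E u = apex (psrc H) \<Longrightarrow> Cod E w = apex K \<Longrightarrow>
    leg1 (psrc H) \<cdot> u = leg0 H \<cdot> (r \<cdot> w) \<Longrightarrow> act (lact K) (psrc H) K u w = s \<cdot> la H u (r \<cdot> w)"
  "u \<in> Mor E \<Longrightarrow> w \<in> Mor E \<Longrightarrow> Dom E w = Dom E u \<Longrightarrow> Cod E u = apex (ptrg H) \<Longrightarrow> Cod E w = apex K \<Longrightarrow>
    leg1 H \<cdot> (r \<cdot> w) = leg0 (ptrg H) \<cdot> u \<Longrightarrow> act (ract K) K (ptrg H) w u = s \<cdot> ra H (r \<cdot> w) u"
  using lact(4)[of u w] ract(4)[of w u] by (simp_all add: transport_simps)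

lemma internal_profunctor_transport: "internal_profunctor E K"
  unfolding internal_profunctor_iff K(1,2)
proof (intro conjI allI impI)
  note [simp] = transport_simps spn_transport rs_Comp act_transport
  show "span_op (psrc H) K K (lact K)" "span_op K (ptrg H) K (ract K)"
    by (rule span_op_transport)+
  show "act (lact K) (psrc H) K (mm (psrc H) u v) w = act (lact K) (psrc H) K u (act (lact K) (psrc H) K v w)"
    if "composable (psrc H) (psrc H) u v" "composable (psrc H) K v w" for u v w
    using that act_laws(1)[OF H, of u v "r \<cdot> w"] by simp
  show "act (lact K) (psrc H) K (unt (psrc H) \<cdot> (leg0 K \<cdot> u)) u = u"
    if "u \<in> Mor E" "Cod E u = apex K" for u
    using that act_laws(2)[OF H, of "r \<cdot> u"] unt_simps[OF internal_profunctorD(1)[OF H]] by simp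
  show "act (ract K) K (ptrg H) (act (ract K) K (ptrg H) u v) w = act (ract K) K (ptrg H) u (mm (ptrg H) v w)"
    if "composable K (ptrg H) u v" "composable (ptrg H) (ptrg H) v w" for u v w
    using that act_laws(3)[OF H, of "r \<cdot> u" v w] by auto
  show "act (ract K) K (ptrg H) u (unt (ptrg H) \<cdot> (leg1 K \<cdot> u)) = u"
    if "u \<in> Mor E" "Cod E u = apex K" for u
    using that act_laws(4)[OF H, of "r \<cdot> u"] unt_simps[OF internal_profunctorD(2)[OF H]] by simp
  show "act (ract K) K (ptrg H) (act (lact K) (psrc H) K u v) w = act (lact K) (psrc H) K u (act (ract K) K (ptrg H) v w)"
    if "composable (psrc H) K u v" "composable K (ptrg H) v w" for u v w
    using that act_laws(5)[OF H, of u "r \<cdot> v" w] by auto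
qed (simp_all add: transport_simps)

text \<open>Because \<open>vinv\<close> is a definite description, the inverse has to be exhibited
  as a cell, for which \<open>K\<close> must be a profunctor, and has to be the only one.\<close>

lemma vinv_transport: "vinv (Prof E) (id_pcell E K H r) = id_pcell E H K s"
  unfolding vinv_def
proof (rule the_equality)
  note [simp] = transport_simps spn_transport rs_Comp act_transport internal_functor_Ide internal_profunctor_transport
  have "internal_cell E (id_pcell E H K s)"
    unfolding id_pcell_def
    by (rule internal_cellI) (simp_all add: internal_functor_Ide[unfolded Cat_int_simps])
  then show "id_pcell E H K s \<in> Sq (Prof E) \<and> sqtop (Prof E) (id_pcell E H K s) = sqbot (Prof E) (id_pcell E K H r) \<and>
      sqbot (Prof E) (id_pcell E H K s) = sqtop (Prof E) (id_pcell E K H r) \<and>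
      vcomp (Prof E) (id_pcell E H K s) (id_pcell E K H r) = vid (Prof E) (sqtop (Prof E) (id_pcell E K H r)) \<and>
      vcomp (Prof E) (id_pcell E K H r) (id_pcell E H K s) = vid (Prof E) (sqbot (Prof E) (id_pcell E K H r))"
    by (simp add: id_pcell_def)
next
  note [simp] = transport_simps spn_transport
  fix \<beta>
  assume "\<beta> \<in> Sq (Prof E) \<and> sqtop (Prof E) \<beta> = sqbot (Prof E) (id_pcell E K H r) \<and>
      sqbot (Prof E) \<beta> = sqtop (Prof E) (id_pcell E K H r) \<and>
      vcomp (Prof E) \<beta> (id_pcell E K H r) = vid (Prof E) (sqtop (Prof E) (id_pcell E K H r)) \<and>
      vcomp (Prof E) (id_pcell E K H r) \<beta> = vid (Prof E) (sqbot (Prof E) (id_pcell E K H r))"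
  then have \<beta>: "internal_cell E \<beta>" "ctop \<beta> = H" "cbot \<beta> = K"
    and eq: "vcomp (Prof E) \<beta> (id_pcell E K H r) = id_pcell E K K (Ide E (apex K))"
    by (simp_all only: Prof_simps(5-7,10) id_pcell_simps mem_Collect_eq)
  note c = internal_cellD[OF \<beta> refl refl]
  note [simp] = internal_functorD(3-8)[OF c(3-5)] internal_functorD(3-8)[OF c(6-8)] c(9-11)
  have f: "fsrc (clft \<beta>) = psrc H" "ftrg (clft \<beta>) = psrc H" "fsrc (crgt \<beta>) = ptrg H" "ftrg (crgt \<beta>) = ptrg H"
    using c by simp_all
  \<comment> \<open>The description in \<open>vinv\<close> does not fix the vertical boundary of
    \<beta>. Its composite with identity functors is an identity, and this determines it.\<close>
  have "fob (clft \<beta>) = Ide E (base (psrc H))" "far (clft \<beta>) = Ide E (apex (psrc H))"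
    "fob (crgt \<beta>) = Ide E (base (ptrg H))" "far (crgt \<beta>) = Ide E (apex (ptrg H))"
    using arg_cong[OF eq, of "\<lambda>c. fob (clft c)"] arg_cong[OF eq, of "\<lambda>c. far (clft c)"]
      arg_cong[OF eq, of "\<lambda>c. fob (crgt c)"] arg_cong[OF eq, of "\<lambda>c. far (crgt c)"] by simp_all
  then have "clft \<beta> = Ide (Cat_int E) (psrc H)" "crgt \<beta> = Ide (Cat_int E) (ptrg H)"
    using f by simp_all
  moreover have "cmap \<beta> = s"
  proof -
    have "cmap \<beta> = cmap \<beta> \<cdot> (r \<cdot> s)"
      by simp
    also have "\<dots> = (cmap \<beta> \<cdot> r) \<cdot> s"
      by (rule Comp_Comp[symmetric]) simp_all
    also have "cmap \<beta> \<cdot> r = Ide E (apex K)"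
      using arg_cong[OF eq, of cmap] by simp
    finally show ?thesis
      by simp
  qed
  ultimately show "\<beta> = id_pcell E H K s"
    using \<beta> by (simp add: id_pcell_def del: Cat_int_simps)
qed

end

end

context pullback_category
begin

lemma desc_eqI:
  assumes "s \<in> Mor E" "Dom E s = Cod E q" "Cod E s = Cod E t" "s \<cdot> q = t"
    and "\<And>s'. s' \<in> Mor E \<Longrightarrow> Dom E s' = Cod E q \<Longrightarrow> s' \<cdot> q = t \<Longrightarrow> s' = s"
  shows "desc E q t = s"
  unfolding desc_def
proof (rule the_equality)
  show "s \<in> hom E (Cod E q) (Cod E t) \<and> s \<cdot> q = t"
    using assms(1-4) by (simp only: hom_def mem_Collect_eq simp_thms)
  show "s' = s" if "s' \<in> hom E (Cod E q) (Cod E t) \<and> s' \<cdot> q = t" for s'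
    using assms(5)[of s'] that unfolding hom_def by blast
qed

text \<open>A section of \<open>q\<close> makes \<open>q\<close> epic, so any given factorisation
  through \<open>q\<close> is the one described by \<open>desc\<close>. This is how the actions of a
  composite profunctor are evaluated.\<close>

lemma desc_split_epi:
  assumes "q \<in> Mor E" "k \<in> Mor E" "Dom E k = Cod E q" "Cod E k = Dom E q" "q \<cdot> k = Ide E (Cod E q)"
    and "s \<in> Mor E" "Dom E s = Cod E q" "Cod E s = Cod E t" "s \<cdot> q = t"
  shows "desc E q t = s"
proof (rule desc_eqI)
  fix s' assume s': "s' \<in> Mor E" "Dom E s' = Cod E q" "s' \<cdot> q = t"
  have "(s' \<cdot> q) \<cdot> k = (s \<cdot> q) \<cdot> k"
    using s' assms by simp
  then show "s' = s"
    using s'(1,2) assms(1-8) by simp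
qed (use assms in simp_all)

lemma coequaliser_ex1:
  assumes coeq: "is_coequaliser E u v q" and t: "t \<in> Mor E" "Dom E t = Cod E u" "t \<cdot> u = t \<cdot> v"
  shows "\<exists>!s. s \<in> hom E (Cod E q) (Cod E t) \<and> s \<cdot> q = t"
proof -
  have "\<forall>z. \<forall>t \<in> hom E (Cod E u) z. t \<cdot> u = t \<cdot> v \<longrightarrow> (\<exists>!s. s \<in> hom E (Cod E q) z \<and> s \<cdot> q = t)"
    using coeq unfolding is_coequaliser_def by (elim conjE)
  from this[rule_format, of t "Cod E t"] t show ?thesis
    by (simp only: hom_def mem_Collect_eq simp_thms)
qed

end

section \<open>The quotient map onto a horizontal composite, and horizontal composites of
  cells\<close>

locale profunctor_category = pullback_category E for E :: "('o, 'm, 'x) cat_choice_scheme" (structure) +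
  assumes has_coequalisers: "has_coequalisers E"
begin

context
  fixes J H :: "('o, 'm) prof"
  assumes J: "internal_profunctor E J" and H: "internal_profunctor E H" and match: "ptrg J = psrc H"
begin

lemmas tensor_simps = J H match internal_profunctorD[OF J, unfolded match] internal_profunctorD[OF H]
  internal_categoryD[OF internal_profunctorD(1)[OF J]] internal_categoryD[OF internal_profunctorD(2)[OF H]]
  internal_categoryD[OF internal_profunctorD(1)[OF H]]
  act_simps[OF internal_profunctorD(3)[OF J]] act_simps[OF internal_profunctorD(4)[OF J, unfolded match]]
  act_simps[OF internal_profunctorD(3)[OF H]] act_simps[OF internal_profunctorD(4)[OF H]]
  act_Comp[OF internal_profunctorD(3)[OF J]] act_Comp[OF internal_profunctorD(4)[OF J, unfolded match]]
  act_Comp[OF internal_profunctorD(3)[OF H]] act_Comp[OF internal_profunctorD(4)[OF H]]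
  op_Comp[OF internal_profunctorD(3)[OF J]] op_Comp[OF internal_profunctorD(4)[OF J, unfolded match]]
  op_Comp[OF internal_profunctorD(3)[OF H]] op_Comp[OF internal_profunctorD(4)[OF H]]
  span_opD(5-9)[OF internal_profunctorD(3)[OF J]] span_opD(5-9)[OF internal_profunctorD(4)[OF J, unfolded match]]
  span_opD(5-9)[OF internal_profunctorD(3)[OF H]] span_opD(5-9)[OF internal_profunctorD(4)[OF H]]

text \<open>The parallel pair in \<open>hquot\<close>, with the middle category named
  \<open>psrc H\<close> instead of \<open>ptrg J\<close>, to which it is equal under
  \<open>match\<close>.\<close>

abbreviation "fork1 \<equiv> smap E (spcomp E J (psrc H)) H J H (ract J) (Ide E (apex H))"
abbreviation "fork2 \<equiv> smap E J (spcomp E (psrc H) H) J H (Ide E (apex J)) (lact H) \<cdot> sassoc E J (psrc H) H"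

lemma tensor_pair_simps: 
  "fork1 \<in> Mor E" "Dom E fork1 = apex (spcomp E (spcomp E J (psrc H)) H)" "Cod E fork1 = apex (spcomp E J H)"
  "fork2 \<in> Mor E" "Dom E fork2 = apex (spcomp E (spcomp E J (psrc H)) H)" "Cod E fork2 = apex (spcomp E J H)"
  using tensor_simps by (simp_all add: smap_def sassoc_def)

lemma tensor_pair_spair: 
  assumes "composable J (psrc H) j b" "composable (psrc H) H b h"
  shows "fork1 \<cdot> spair E (spcomp E J (psrc H)) H (spair E J (psrc H) j b) h = spair E J H (ra J j b) h"
    "fork2 \<cdot> spair E (spcomp E J (psrc H)) H (spair E J (psrc H) j b) h = spair E J H j (la H b h)"
proof -
  note [simp] = tensor_simps smap_def sassoc_def
  show "fork1 \<cdot> spair E (spcomp E J (psrc H)) H (spair E J (psrc H) j b) h = spair E J H (ra J j b) h"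
    using assms by simp
  show "fork2 \<cdot> spair E (spcomp E J (psrc H)) H (spair E J (psrc H) j b) h = spair E J H j (la H b h)"
    using assms by simp
qed

lemma hquot_coequaliser: "is_coequaliser E fork1 fork2 (hquot E J H)"
  using has_coequalisers tensor_pair_simps match unfolding has_coequalisers_def hquot_def Let_def by auto

lemma hquot_simps: "hquot E J H \<in> Mor E" "Dom E (hquot E J H) = apex (spcomp E J H)"
  using hquot_coequaliser tensor_pair_simps by (simp_all add: is_coequaliser_def)

text \<open>The defining relation of a tensor product, obtained by evaluating the coequaliser
  equation at the triple ((j, b), h).\<close>

lemma hquot_balanced:
  assumes "composable J (psrc H) j b" "composable (psrc H) H b h"
  shows "hquot E J H \<cdot> spair E J H (ra J j b) h = hquot E J H \<cdot> spair E J H j (la H b h)"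
proof -
  have "hquot E J H \<cdot> fork1 = hquot E J H \<cdot> fork2"
    using hquot_coequaliser by (simp add: is_coequaliser_def)
  then have "hquot E J H \<cdot> (fork1 \<cdot> spair E (spcomp E J (psrc H)) H (spair E J (psrc H) j b) h) =
      hquot E J H \<cdot> (fork2 \<cdot> spair E (spcomp E J (psrc H)) H (spair E J (psrc H) j b) h)"
    by (rule Comp_eq_extend) (use assms hquot_simps tensor_pair_simps tensor_simps in simp_all)
  then show ?thesis
    by (simp only: tensor_pair_spair[OF assms])
qed

text \<open>Balanced maps descend to the tensor product. Testing on triples suffices because every
  element of the domain of the parallel pair is one.\<close>

lemma hquot_desc:
  assumes t: "t \<in> Mor E" "Dom E t = apex (spcomp E J H)"
    and bal: "\<forall>j b h. composable J (psrc H) j b \<longrightarrow> composable (psrc H) H b h \<longrightarrow>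
      t \<cdot> spair E J H (ra J j b) h = t \<cdot> spair E J H j (la H b h)"
  shows "desc E (hquot E J H) t \<in> Mor E" "Dom E (desc E (hquot E J H) t) = Cod E (hquot E J H)" "Cod E (desc E (hquot E J H) t) = Cod E t" "desc E (hquot E J H) t \<cdot> hquot E J H = t"
proof -
  note [simp] = tensor_pair_simps t tensor_simps
  have "t \<cdot> fork1 = t \<cdot> fork2"
  proof (rule eq_spcompI[of "spcomp E J (psrc H)" H])
    fix x h
    assume a: "composable (spcomp E J (psrc H)) H x h"
    define j b where "j = sp1 E J (psrc H) \<cdot> x" and "b = sp2 E J (psrc H) \<cdot> x"
    have x: "x = spair E J (psrc H) j b" and jb: "composable J (psrc H) j b" and bh: "composable (psrc H) H b h"
      using a by (auto simp: j_def b_def)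
    have [simp]: "spair E (spcomp E J (psrc H)) H x h \<in> Mor E"
       "Cod E (spair E (spcomp E J (psrc H)) H x h) = apex (spcomp E (spcomp E J (psrc H)) H)"
      using a by auto
    have "t \<cdot> (fork1 \<cdot> spair E (spcomp E J (psrc H)) H x h) = t \<cdot> (fork2 \<cdot> spair E (spcomp E J (psrc H)) H x h)"
      unfolding x tensor_pair_spair[OF jb bh] by (rule bal[rule_format, OF jb bh])
    then show "(t \<cdot> fork1) \<cdot> spair E (spcomp E J (psrc H)) H x h = (t \<cdot> fork2) \<cdot> spair E (spcomp E J (psrc H)) H x h"
      by (subst (1 2) Comp_Comp) (simp_all only: tensor_pair_simps t \<open>spair E (spcomp E J (psrc H)) H x h \<in> Mor E\<close>
        \<open>Cod E (spair E (spcomp E J (psrc H)) H x h) = apex (spcomp E (spcomp E J (psrc H)) H)\<close>)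
  qed simp_all
  then have ex1: "\<exists>!s. s \<in> hom E (Cod E (hquot E J H)) (Cod E t) \<and> s \<cdot> hquot E J H = t"
    by (intro coequaliser_ex1[OF hquot_coequaliser]) simp_all
  from theI'[OF ex1] show "desc E (hquot E J H) t \<in> Mor E" "Dom E (desc E (hquot E J H) t) = Cod E (hquot E J H)"
    "Cod E (desc E (hquot E J H) t) = Cod E t" "desc E (hquot E J H) t \<cdot> hquot E J H = t"
    unfolding desc_def hom_def by blast+
qed

lemma hquot_epi:
  assumes f: "f \<in> Mor E" "Dom E f = Cod E (hquot E J H)" and g: "g \<in> Mor E" "Dom E g = Cod E (hquot E J H)" and eq: "f \<cdot> hquot E J H = g \<cdot> hquot E J H"
  shows "f = g"
proof -
  note [simp] = f g hquot_simps
  have [simp]: "Cod E g = Cod E f"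
    using Comp_simps(3)[of "hquot E J H" f] Comp_simps(3)[of "hquot E J H" g] eq by simp
  have "hquot E J H \<cdot> fork1 = hquot E J H \<cdot> fork2"
    using hquot_coequaliser by (simp add: is_coequaliser_def)
  then have "(f \<cdot> hquot E J H) \<cdot> fork1 = (f \<cdot> hquot E J H) \<cdot> fork2"
    by (subst (1 2) Comp_Comp) (simp_all only: tensor_pair_simps hquot_simps f)
  then have "\<exists>!s. s \<in> hom E (Cod E (hquot E J H)) (Cod E (f \<cdot> hquot E J H)) \<and> s \<cdot> hquot E J H = f \<cdot> hquot E J H"
    by (intro coequaliser_ex1[OF hquot_coequaliser]) (simp_all add: tensor_pair_simps)
  moreover have "f \<in> hom E (Cod E (hquot E J H)) (Cod E (f \<cdot> hquot E J H))" "g \<in> hom E (Cod E (hquot E J H)) (Cod E (f \<cdot> hquot E J H))"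
    by (simp_all add: hom_def)
  ultimately show ?thesis
    using eq by metis
qed

end

text \<open>The map to be factored is balanced: right equivariance of \<phi> and left equivariance
  of \<chi>, over the same functor \<open>g\<close>, replace \<open>b\<close> by its image under
  \<open>g\<close>, and that image can be moved across the quotient of \<open>K\<close> and
  \<open>L\<close>. Only then is the \<open>desc\<close> in \<open>hcell\<close> known to satisfy
  its equation.\<close>

lemma hcell_simps:
  assumes \<phi>: "internal_cell E \<phi>" "ctop \<phi> = J" "cbot \<phi> = K" "clft \<phi> = f" "crgt \<phi> = g"
    and \<chi>: "internal_cell E \<chi>" "ctop \<chi> = H" "cbot \<chi> = L" "clft \<chi> = g" "crgt \<chi> = k"
    and match: "ptrg J = psrc H" "ptrg K = psrc L"
  shows "cmap (hcell (Prof E) \<phi> \<chi>) \<in> Mor E" "Dom E (cmap (hcell (Prof E) \<phi> \<chi>)) = Cod E (hquot E J H)"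
    "Cod E (cmap (hcell (Prof E) \<phi> \<chi>)) = Cod E (hquot E K L)"
    "composable J H j h \<Longrightarrow> cmap (hcell (Prof E) \<phi> \<chi>) \<cdot> (hquot E J H \<cdot> spair E J H j h) =
      hquot E K L \<cdot> spair E K L (cmap \<phi> \<cdot> j) (cmap \<chi> \<cdot> h)"
proof -
  note J = internal_cellD(1)[OF \<phi>] and K = internal_cellD(2)[OF \<phi>]
    and H = internal_cellD(1)[OF \<chi>] and L = internal_cellD(2)[OF \<chi>]
  define x y where "x = cmap \<phi>" and "y = cmap \<chi>"
  define t where "t = hquot E K L \<cdot> smap E J H K L x y"
  have g: "internal_functor E g" "fsrc g = psrc H" "ftrg g = psrc L"
    using internal_cellD[OF \<chi>] by simp_all
  note [simp] = tensor_simps[OF J H match(1)] tensor_simps[OF K L match(2)] hquot_simps[OF J H match(1)]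
    hquot_simps[OF K L match(2)] internal_functorD(3-8)[OF g] functor_simps[OF g]
    internal_cellD(9-13)[OF \<phi>, folded x_def] internal_cellD(9-13)[OF \<chi>, folded y_def]
    cell_simps[OF \<phi>, folded x_def, unfolded match] cell_simps[OF \<chi>, folded y_def, unfolded match]
  have legs: "leg1 K \<cdot> (x \<cdot> j) = leg0 L \<cdot> (y \<cdot> h)" if "composable J H j h" for j h
    using that by simp
  have t: "t \<in> Mor E" "Dom E t = apex (spcomp E J H)" "Cod E t = Cod E (hquot E K L)"
    by (simp_all add: t_def smap_def)
  have t_spair: "t \<cdot> spair E J H j h = hquot E K L \<cdot> spair E K L (x \<cdot> j) (y \<cdot> h)" if "composable J H j h" for j h
    using that by (simp add: t_def smap_def)
  have "\<forall>j b h. composable J (psrc H) j b \<longrightarrow> composable (psrc H) H b h \<longrightarrow>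
    t \<cdot> spair E J H (ra J j b) h = t \<cdot> spair E J H j (la H b h)"
  proof (intro allI impI)
    fix j b h
    assume that: "composable J (psrc H) j b" "composable (psrc H) H b h"
    have "t \<cdot> spair E J H (ra J j b) h = hquot E K L \<cdot> spair E K L (ra K (x \<cdot> j) (far g \<cdot> b)) (y \<cdot> h)"
      using that t_spair[of "ra J j b" h] by simp
    also have "\<dots> = hquot E K L \<cdot> spair E K L (x \<cdot> j) (la L (far g \<cdot> b) (y \<cdot> h))"
      by (rule hquot_balanced[OF K L match(2)]) (use that in simp_all)
    also have "\<dots> = t \<cdot> spair E J H j (la H b h)"
      using that t_spair[of j "la H b h"] by simp
    finally show "t \<cdot> spair E J H (ra J j b) h = t \<cdot> spair E J H j (la H b h)" .
  qed
  note d = hquot_desc[OF J H match(1) t(1,2) this]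
  have c: "cmap (hcell (Prof E) \<phi> \<chi>) = desc E (hquot E J H) t"
    using \<phi> \<chi> by (simp add: t_def x_def y_def)
  show "cmap (hcell (Prof E) \<phi> \<chi>) \<in> Mor E" "Dom E (cmap (hcell (Prof E) \<phi> \<chi>)) = Cod E (hquot E J H)"
    "Cod E (cmap (hcell (Prof E) \<phi> \<chi>)) = Cod E (hquot E K L)"
    unfolding c by (simp_all only: d(1-3) t(3))
  show "cmap (hcell (Prof E) \<phi> \<chi>) \<cdot> (hquot E J H \<cdot> spair E J H j h) =
      hquot E K L \<cdot> spair E K L (cmap \<phi> \<cdot> j) (cmap \<chi> \<cdot> h)" if a: "composable J H j h"
  proof -
    have sp: "spair E J H j h \<in> Mor E" "Cod E (spair E J H j h) = apex (spcomp E J H)"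
      using a by simp_all
    have "desc E (hquot E J H) t \<cdot> (hquot E J H \<cdot> spair E J H j h) = (desc E (hquot E J H) t \<cdot> hquot E J H) \<cdot> spair E J H j h"
      by (rule Comp_Comp[symmetric]) (simp_all only: sp d(1-3) hquot_simps[OF J H match(1)])
    then show ?thesis
      unfolding c by (simp only: d(4) t_spair[OF a] x_def y_def)
  qed
qed

end

context pullback_category
begin

lemma eq_spcomp3I:
  assumes s: "spn J" "spn H" "spn K" "Cod E (leg1 J) = Cod E (leg0 H)" "Cod E (leg1 H) = Cod E (leg0 K)"
    and f: "f \<in> Mor E" "Dom E f = apex (spcomp E (spcomp E J H) K)"
    and g: "g \<in> Mor E" "Dom E g = apex (spcomp E (spcomp E J H) K)"
    and eq: "\<And>u v w. composable J H u v \<Longrightarrow> composable H K v w \<Longrightarrow>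
      f \<cdot> spair E (spcomp E J H) K (spair E J H u v) w = g \<cdot> spair E (spcomp E J H) K (spair E J H u v) w"
  shows "f = g"
proof (rule eq_spcompI[of "spcomp E J H" K])
  fix x w
  assume a: "composable (spcomp E J H) K x w"
  define u v where "u = sp1 E J H \<cdot> x" and "v = sp2 E J H \<cdot> x"
  have x: "x = spair E J H u v" and 1: "composable J H u v" and 2: "composable H K v w"
    using a s by (auto simp: u_def v_def)
  show "f \<cdot> spair E (spcomp E J H) K x w = g \<cdot> spair E (spcomp E J H) K x w"
    unfolding x by (rule eq[OF 1 2])
qed (use s f g in simp_all)

end

text \<open>If the quotient map \<open>J \<times> H \<rightarrow> J \<odot> H\<close> factors through a split epimorphism \<open>m \<colon> J \<times> H \<rightarrow> M\<close> that is balanced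
  and equivariant, then \<open>J \<odot> H \<cong> M\<close>. The splitting makes every pullback of the quotient map a split
  epimorphism, so the actions on \<open>J \<odot> H\<close> are determined without stability of coequalisers.\<close>

locale split_tensor = profunctor_category E for E :: "('o, 'm, 'x) cat_choice_scheme" (structure) +
  fixes J H M :: "('o, 'm) prof" and m \<sigma> :: 'm
  assumes J: "internal_profunctor E J" and H: "internal_profunctor E H" and match: "ptrg J = psrc H"
    and M: "internal_profunctor E M" "psrc M = psrc J" "ptrg M = ptrg H"
    and m: "span_op J H M m"
    and bal: "\<And>j b h. composable J (psrc H) j b \<Longrightarrow> composable (psrc H) H b h \<Longrightarrow>
      act m J H (ra J j b) h = act m J H j (la H b h)"
    and leq: "\<And>a j h. composable (psrc J) J a j \<Longrightarrow> composable J H j h \<Longrightarrow>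
      act m J H (la J a j) h = la M a (act m J H j h)"
    and req: "\<And>j h c. composable J H j h \<Longrightarrow> composable H (ptrg H) h c \<Longrightarrow>
      act m J H j (ra H h c) = ra M (act m J H j h) c"
    and \<sigma>: "\<sigma> \<in> Mor E" "Dom E \<sigma> = apex M" "Cod E \<sigma> = apex (spcomp E J H)" "m \<cdot> \<sigma> = Ide E (apex M)"
    and q\<sigma>: "hquot E J H \<cdot> (\<sigma> \<cdot> m) = hquot E J H"
begin

lemmas split_simps = tensor_simps[OF J H match]
  hquot_simps[OF J H match] M internal_profunctorD[OF M(1), unfolded M(2,3)]
  act_simps[OF internal_profunctorD(3)[OF M(1), unfolded M(2,3)]] act_simps[OF internal_profunctorD(4)[OF M(1), unfolded M(2,3)]]
  act_Comp[OF internal_profunctorD(3)[OF M(1), unfolded M(2,3)]] act_Comp[OF internal_profunctorD(4)[OF M(1), unfolded M(2,3)]]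
  op_Comp[OF internal_profunctorD(3)[OF M(1), unfolded M(2,3)]] op_Comp[OF internal_profunctorD(4)[OF M(1), unfolded M(2,3)]]
  span_opD(5-9)[OF internal_profunctorD(3)[OF M(1), unfolded M(2,3)]] span_opD(5-9)[OF internal_profunctorD(4)[OF M(1), unfolded M(2,3)]]
  act_simps[OF m] act_Comp[OF m] span_opD(4-9)[OF m] \<sigma>(1-3)

text \<open>These are the two directions of the isomorphism between the composite and
  \<open>M\<close>. Balancedness of \<open>m\<close> gives \<open>split_r\<close>; the assumption
  \<open>q\<sigma>\<close> makes \<open>split_s \<cdot> split_r\<close> the identity, and
  \<open>m \<cdot> \<sigma> = Ide E (apex M)\<close> settles the other order.\<close>

abbreviation "split_r \<equiv> desc E (hquot E J H) m"
abbreviation "split_s \<equiv> hquot E J H \<cdot> \<sigma>"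

lemma split_r: "split_r \<in> Mor E" "Dom E split_r = Cod E (hquot E J H)" "Cod E split_r = apex M" "split_r \<cdot> hquot E J H = m"
proof -
  note [simp] = split_simps
  have "\<forall>j b h. composable J (psrc H) j b \<longrightarrow> composable (psrc H) H b h \<longrightarrow>
      m \<cdot> spair E J H (ra J j b) h = m \<cdot> spair E J H j (la H b h)"
    using bal unfolding act_def by blast
  from hquot_desc[OF J H match _ _ this]
  show "split_r \<in> Mor E" "Dom E split_r = Cod E (hquot E J H)" "Cod E split_r = apex M" "split_r \<cdot> hquot E J H = m"
    by simp_all
qed

lemma split_r_quot: "w \<in> Mor E \<Longrightarrow> Cod E w = apex (spcomp E J H) \<Longrightarrow>
    split_r \<cdot> (hquot E J H \<cdot> w) = act m J H (sp1 E J H \<cdot> w) (sp2 E J H \<cdot> w)"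
  using op_Comp[OF m, of w] split_r by (simp add: split_simps flip: Comp_Comp)

lemma split_quot: "w \<in> Mor E \<Longrightarrow> Cod E w = apex (spcomp E J H) \<Longrightarrow>
    hquot E J H \<cdot> w = split_s \<cdot> act m J H (sp1 E J H \<cdot> w) (sp2 E J H \<cdot> w)"
proof -
  note [simp] = split_simps
  assume w: "w \<in> Mor E" "Cod E w = apex (spcomp E J H)"
  have "hquot E J H \<cdot> w = (hquot E J H \<cdot> (\<sigma> \<cdot> m)) \<cdot> w"
    by (simp only: q\<sigma>)
  also have "\<dots> = split_s \<cdot> (m \<cdot> w)"
    using w by simp
  finally show ?thesis
    using op_Comp[OF m w] by simp
qed

lemma split_s: "split_s \<in> Mor E" "Dom E split_s = apex M" "Cod E split_s = Cod E (hquot E J H)"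
  by (simp_all add: split_simps)

lemma split_inverse: "split_r \<cdot> split_s = Ide E (apex M)" "split_s \<cdot> split_r = Ide E (Cod E (hquot E J H))"
proof -
  note [simp] = split_simps split_r(1-3)
  have "split_r \<cdot> split_s = (split_r \<cdot> hquot E J H) \<cdot> \<sigma>"
    by simp
  then show "split_r \<cdot> split_s = Ide E (apex M)"
    by (simp only: split_r(4) \<sigma>)
  show "split_s \<cdot> split_r = Ide E (Cod E (hquot E J H))"
  proof (rule hquot_epi[OF J H match])
    have "(split_s \<cdot> split_r) \<cdot> hquot E J H = hquot E J H \<cdot> (\<sigma> \<cdot> (split_r \<cdot> hquot E J H))"
      by simp
    then show "(split_s \<cdot> split_r) \<cdot> hquot E J H = Ide E (Cod E (hquot E J H)) \<cdot> hquot E J H"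
      by (simp only: split_r(4) q\<sigma>) simp
  qed simp_all
qed

text \<open>Since \<open>m\<close> preserves outer legs and \<sigma> is a section of it, \<sigma>
  preserves them as well.\<close>

lemma \<sigma>_legs:
  assumes "w \<in> Mor E" "Cod E w = apex M"
  shows "leg0 J \<cdot> (sp1 E J H \<cdot> (\<sigma> \<cdot> w)) = leg0 M \<cdot> w" "leg1 H \<cdot> (sp2 E J H \<cdot> (\<sigma> \<cdot> w)) = leg1 M \<cdot> w"
proof -
  note [simp] = split_simps assms
  have "leg0 M \<cdot> (m \<cdot> (\<sigma> \<cdot> w)) = leg0 J \<cdot> (sp1 E J H \<cdot> (\<sigma> \<cdot> w))"
    "leg1 M \<cdot> (m \<cdot> (\<sigma> \<cdot> w)) = leg1 H \<cdot> (sp2 E J H \<cdot> (\<sigma> \<cdot> w))"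
    by (rule Comp_eq_extend; simp)+
  moreover have "m \<cdot> (\<sigma> \<cdot> w) = (m \<cdot> \<sigma>) \<cdot> w"
    by simp
  ultimately show "leg0 J \<cdot> (sp1 E J H \<cdot> (\<sigma> \<cdot> w)) = leg0 M \<cdot> w" "leg1 H \<cdot> (sp2 E J H \<cdot> (\<sigma> \<cdot> w)) = leg1 M \<cdot> w"
    using \<sigma>(4) by simp_all
qed

lemma hquot_desc_eqI:
  assumes "s \<in> Mor E" "Dom E s = Cod E (hquot E J H)" "Cod E s = Cod E t" "s \<cdot> hquot E J H = t"
  shows "desc E (hquot E J H) t = s"
proof (rule desc_eqI[OF assms])
  show "s' = s" if "s' \<in> Mor E" "Dom E s' = Cod E (hquot E J H)" "s' \<cdot> hquot E J H = t" for s'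
    by (rule hquot_epi[OF J H match that(1,2) assms(1,2)]) (simp only: that(3) assms(4))
qed

lemma hspan_simps: "apex (hspan E J H) = Cod E (hquot E J H)"
  "leg0 (hspan E J H) = leg0 M \<cdot> split_r" "leg1 (hspan E J H) = leg1 M \<cdot> split_r"
proof -
  note [simp] = split_simps split_r(1-3)
  show "apex (hspan E J H) = Cod E (hquot E J H)"
    by (simp add: hspan_def Let_def)
  have eq: "(leg0 M \<cdot> split_r) \<cdot> hquot E J H = leg0 J \<cdot> sp1 E J H"
    "(leg1 M \<cdot> split_r) \<cdot> hquot E J H = leg1 H \<cdot> sp2 E J H"
    by (simp_all add: split_r(4))
  have "desc E (hquot E J H) (leg0 J \<cdot> sp1 E J H) = leg0 M \<cdot> split_r"
    by (rule hquot_desc_eqI) (simp_all only: eq, simp_all)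
  then show "leg0 (hspan E J H) = leg0 M \<cdot> split_r"
    by (simp add: hspan_def Let_def)
  have "desc E (hquot E J H) (leg1 H \<cdot> sp2 E J H) = leg1 M \<cdot> split_r"
    by (rule hquot_desc_eqI) (simp_all only: eq, simp_all)
  then show "leg1 (hspan E J H) = leg1 M \<cdot> split_r"
    by (simp add: hspan_def Let_def)
qed

lemma hcomp_simps: "apex (hcomp_prof E J H) = Cod E (hquot E J H)"
  "leg0 (hcomp_prof E J H) = leg0 M \<cdot> split_r" "leg1 (hcomp_prof E J H) = leg1 M \<cdot> split_r"
  "psrc (hcomp_prof E J H) = psrc J" "ptrg (hcomp_prof E J H) = ptrg H"
  by (simp_all add: hcomp_prof_def Let_def hspan_simps)

lemma spn_hspan: "spn (hspan E J H)"
  using split_simps split_r(1-3) by (intro spnI) (simp_all add: hspan_simps)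

text \<open>By definition the action is a factorisation through the map \<open>e\<close> below. As
  \<open>e\<close> has a section, it is enough that the action transported from \<open>M\<close>
  yields \<open>t\<close> after composition with \<open>e\<close>, and on triples (a, j, h) this is
  \<open>leq\<close>.\<close>

lemma lact_hcomp: "lact (hcomp_prof E J H) =
    split_s \<cdot> (lact M \<cdot> smap E (psrc J) (hspan E J H) (psrc J) M (Ide E (apex (psrc J))) split_r)"
proof -
  note [simp] = split_simps split_r(1-3) spn_hspan hspan_simps \<sigma>_legs split_s(3)
  let ?A = "psrc J" and ?Q = "hspan E J H"
  let ?p = "sp1 E ?A ?Q" and ?p' = "sp2 E ?A ?Q"
  define e where "e = smap E ?A (spcomp E J H) ?A ?Q (Ide E (apex ?A)) (hquot E J H) \<cdot> sassoc E ?A J H"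
  define t where "t = hquot E J H \<cdot> smap E (spcomp E ?A J) H J H (lact J) (Ide E (apex H))"
  \<comment> \<open>The section of \<open>e\<close>: it keeps the element of the acting category and
    lifts a class in the composite to the representative given by \<sigma> after
    \<open>split_r\<close>.\<close>
  define k where "k = spair E (spcomp E ?A J) H
    (spair E ?A J ?p (sp1 E J H \<cdot> (\<sigma> \<cdot> (split_r \<cdot> ?p')))) (sp2 E J H \<cdot> (\<sigma> \<cdot> (split_r \<cdot> ?p')))"
  define l where "l = split_s \<cdot> (lact M \<cdot> smap E ?A ?Q ?A M (Ide E (apex ?A)) split_r)"
  have rq [simp]: "leg0 M \<cdot> (split_r \<cdot> (hquot E J H \<cdot> w)) = leg0 J \<cdot> (sp1 E J H \<cdot> w)"
    "split_r \<cdot> (hquot E J H \<cdot> w) = act m J H (sp1 E J H \<cdot> w) (sp2 E J H \<cdot> w)"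
    if "w \<in> Mor E" "Cod E w = apex (spcomp E J H)" for w
    using that split_r_quot[OF that] by simp_all
  have [simp]: "leg0 M \<cdot> (split_r \<cdot> hquot E J H) = leg0 J \<cdot> sp1 E J H"
    by (simp add: split_r(4))
  have [simp]: "e \<in> Mor E" "Dom E e = apex (spcomp E (spcomp E ?A J) H)" "Cod E e = apex (spcomp E ?A ?Q)"
    "t \<in> Mor E" "Dom E t = apex (spcomp E (spcomp E ?A J) H)" "Cod E t = Cod E (hquot E J H)"
    "k \<in> Mor E" "Dom E k = apex (spcomp E ?A ?Q)" "Cod E k = apex (spcomp E (spcomp E ?A J) H)"
    "l \<in> Mor E" "Dom E l = apex (spcomp E ?A ?Q)" "Cod E l = Cod E (hquot E J H)"
    by (simp_all add: e_def t_def k_def l_def smap_def sassoc_def)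
  have "(split_s \<cdot> split_r) \<cdot> ?p' = ?p'"
    by (simp only: split_inverse(2)) simp
  then have [simp]: "hquot E J H \<cdot> (\<sigma> \<cdot> (split_r \<cdot> ?p')) = ?p'"
    by simp
  have "e \<cdot> k = Ide E (Cod E e)"
    by (simp add: e_def k_def smap_def sassoc_def)
  moreover have "l \<cdot> e = t"
  proof (rule eq_spcomp3I[of ?A J H])
    fix a j h
    assume c: "composable ?A J a j" "composable J H j h"
    have "(l \<cdot> e) \<cdot> spair E (spcomp E ?A J) H (spair E ?A J a j) h = split_s \<cdot> la M a (act m J H j h)"
      using c by (simp add: l_def e_def smap_def sassoc_def)
    also have "\<dots> = split_s \<cdot> act m J H (la J a j) h"
      using leq[OF c] by simp
    also have "\<dots> = t \<cdot> spair E (spcomp E ?A J) H (spair E ?A J a j) h"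
      using c split_quot[of "spair E J H (la J a j) h"] by (simp add: t_def smap_def)
    finally show "(l \<cdot> e) \<cdot> spair E (spcomp E ?A J) H (spair E ?A J a j) h =
      t \<cdot> spair E (spcomp E ?A J) H (spair E ?A J a j) h" .
  qed simp_all
  ultimately have "desc E e t = l"
    by (intro desc_split_epi[of e k l]) simp_all
  then show ?thesis
    by (simp add: hcomp_prof_def Let_def e_def t_def l_def)
qed

text \<open>The mirror image of \<open>lact_hcomp\<close>, with \<open>req\<close> in place of
  \<open>leq\<close>; the bracketing puts the reassociation into \<open>t\<close> instead of
  \<open>e\<close>.\<close>

lemma ract_hcomp: "ract (hcomp_prof E J H) =
    split_s \<cdot> (ract M \<cdot> smap E (hspan E J H) (ptrg H) M (ptrg H) split_r (Ide E (apex (ptrg H))))"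
proof -
  note [simp] = split_simps split_r(1-3) spn_hspan hspan_simps \<sigma>_legs split_s(3)
  let ?C = "ptrg H" and ?Q = "hspan E J H"
  let ?p = "sp1 E ?Q ?C" and ?p' = "sp2 E ?Q ?C"
  define e where "e = smap E (spcomp E J H) ?C ?Q ?C (hquot E J H) (Ide E (apex ?C))"
  define t where "t = hquot E J H \<cdot> (smap E J (spcomp E H ?C) J H (Ide E (apex J)) (ract H) \<cdot> sassoc E J H ?C)"
  define k where "k = spair E (spcomp E J H) ?C (\<sigma> \<cdot> (split_r \<cdot> ?p)) ?p'"
  define l where "l = split_s \<cdot> (ract M \<cdot> smap E ?Q ?C M ?C split_r (Ide E (apex ?C)))"
  have [simp]: "leg1 M \<cdot> (split_r \<cdot> (hquot E J H \<cdot> w)) = leg1 H \<cdot> (sp2 E J H \<cdot> w)"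
    "split_r \<cdot> (hquot E J H \<cdot> w) = act m J H (sp1 E J H \<cdot> w) (sp2 E J H \<cdot> w)"
    if "w \<in> Mor E" "Cod E w = apex (spcomp E J H)" for w
    using that split_r_quot[OF that] by simp_all
  have [simp]: "leg1 M \<cdot> (split_r \<cdot> ?p) = leg0 ?C \<cdot> ?p'"
    using sp_commutes[of ?Q ?C] by simp
  have [simp]: "e \<in> Mor E" "Dom E e = apex (spcomp E (spcomp E J H) ?C)" "Cod E e = apex (spcomp E ?Q ?C)"
    "t \<in> Mor E" "Dom E t = apex (spcomp E (spcomp E J H) ?C)" "Cod E t = Cod E (hquot E J H)"
    "k \<in> Mor E" "Dom E k = apex (spcomp E ?Q ?C)" "Cod E k = apex (spcomp E (spcomp E J H) ?C)"
    "l \<in> Mor E" "Dom E l = apex (spcomp E ?Q ?C)" "Cod E l = Cod E (hquot E J H)"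
    by (simp_all add: e_def t_def k_def l_def smap_def sassoc_def)
  have "(split_s \<cdot> split_r) \<cdot> ?p = ?p"
    by (simp only: split_inverse(2)) simp
  then have [simp]: "hquot E J H \<cdot> (\<sigma> \<cdot> (split_r \<cdot> ?p)) = ?p"
    by simp
  have "e \<cdot> k = Ide E (Cod E e)"
    by (simp add: e_def k_def smap_def sassoc_def)
  moreover have "l \<cdot> e = t"
  proof (rule eq_spcomp3I[of J H ?C])
    fix j h c
    assume c: "composable J H j h" "composable H ?C h c"
    have "(l \<cdot> e) \<cdot> spair E (spcomp E J H) ?C (spair E J H j h) c = split_s \<cdot> ra M (act m J H j h) c"
      using c by (simp add: l_def e_def smap_def)
    also have "\<dots> = split_s \<cdot> act m J H j (ra H h c)"
      using req[OF c] by simp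
    also have "\<dots> = t \<cdot> spair E (spcomp E J H) ?C (spair E J H j h) c"
      using c split_quot[of "spair E J H j (ra H h c)"] by (simp add: t_def smap_def sassoc_def)
    finally show "(l \<cdot> e) \<cdot> spair E (spcomp E J H) ?C (spair E J H j h) c =
      t \<cdot> spair E (spcomp E J H) ?C (spair E J H j h) c" .
  qed simp_all
  ultimately have "desc E e t = l"
    by (intro desc_split_epi[of e k l]) simp_all
  then show ?thesis
    by (simp add: hcomp_prof_def Let_def e_def t_def l_def)
qed

text \<open>By the two preceding computations the composite carries exactly the structure of
  \<open>M\<close> transported along \<open>split_r\<close>, so \<open>vinv_transport\<close>
  applies.\<close>

lemma vinv_split: "vinv (Prof E) (id_pcell E (hcomp_prof E J H) M split_r) = id_pcell E M (hcomp_prof E J H) split_s"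
proof (rule vinv_transport[OF M(1)])
  note [simp] = split_simps split_r(1-3) spn_hspan hspan_simps split_s(3) hcomp_simps
  let ?Q = "hspan E J H" and ?K = "hcomp_prof E J H"
  \<comment> \<open>The actions were computed over \<open>hspan\<close>, a record of another type
    with the same span as \<open>hcomp_prof\<close>; these equations pass between the two.\<close>
  have K: "spair E X ?K = spair E X ?Q" "spair E ?K X = spair E ?Q X"
    "apex (spcomp E X ?K) = apex (spcomp E X ?Q)" "apex (spcomp E ?K X) = apex (spcomp E ?Q X)"
    "apex ?K = apex ?Q" "leg0 ?K = leg0 ?Q" "leg1 ?K = leg1 ?Q" for X :: "('o, 'm) icat"
    by (simp_all add: spair_def spcomp_def sp1_def fun_eq_iff)
  show "split_r \<in> Mor E" "Dom E split_r = apex ?K" "Cod E split_r = apex M"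
    "split_s \<in> Mor E" "Dom E split_s = apex M" "Cod E split_s = apex ?K"
    "split_r \<cdot> split_s = Ide E (apex M)" "split_s \<cdot> split_r = Ide E (apex ?K)"
    "psrc ?K = psrc M" "ptrg ?K = ptrg M" "leg0 ?K = leg0 M \<cdot> split_r" "leg1 ?K = leg1 M \<cdot> split_r"
    using split_inverse by simp_all
  show "lact ?K \<in> Mor E" "Dom E (lact ?K) = apex (spcomp E (psrc M) ?K)" "Cod E (lact ?K) = apex ?K"
    unfolding K lact_hcomp by (simp_all add: smap_def)
  have [simp]: "leg1 M \<cdot> (split_r \<cdot> sp1 E ?Q (ptrg H)) = leg0 (ptrg H) \<cdot> sp2 E ?Q (ptrg H)"
    using sp_commutes[of ?Q "ptrg H"] by simp
  show "ract ?K \<in> Mor E" "Dom E (ract ?K) = apex (spcomp E ?K (ptrg M))" "Cod E (ract ?K) = apex ?K"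
    unfolding K ract_hcomp by (simp_all add: smap_def)
  show "la ?K u w = split_s \<cdot> la M u (split_r \<cdot> w)" if a: "composable (psrc M) ?K u w" for u w
  proof -
    have a': "leg1 (psrc J) \<cdot> u = leg0 M \<cdot> (split_r \<cdot> w)" "u \<in> Mor E" "w \<in> Mor E" "Dom E u = Dom E w"
      "Cod E u = apex (psrc J)" "Cod E w = Cod E (hquot E J H)"
      using a by auto
    have "la ?K u w = lact ?K \<cdot> spair E (psrc J) ?Q u w"
      by (simp add: act_def K(1))
    also have "\<dots> = split_s \<cdot> la M u (split_r \<cdot> w)"
      unfolding lact_hcomp using a' by (simp add: smap_def)
    finally show ?thesis .
  qed
  show "ra ?K w u = split_s \<cdot> ra M (split_r \<cdot> w) u" if a: "composable ?K (ptrg M) w u" for w u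
  proof -
    have a': "leg1 M \<cdot> (split_r \<cdot> w) = leg0 (ptrg H) \<cdot> u" "u \<in> Mor E" "w \<in> Mor E" "Dom E w = Dom E u"
      "Cod E u = apex (ptrg H)" "Cod E w = Cod E (hquot E J H)"
      using a by auto
    have "ra ?K w u = ract ?K \<cdot> spair E ?Q (ptrg H) w u"
      by (simp add: act_def K(2))
    also have "\<dots> = split_s \<cdot> ra M (split_r \<cdot> w) u"
      unfolding ract_hcomp using a' by (simp add: smap_def)
    finally show ?thesis .
  qed
qed

end

section \<open>The two unit coherence cells as instances of the split situation\<close>

context profunctor_category
begin

context
  fixes H :: "('o, 'm) prof"
  assumes H: "internal_profunctor E H"
begin

lemmas unit_iso_simps = internal_profunctorD[OF H]
  internal_categoryD[OF internal_profunctorD(1)[OF H]] internal_categoryD[OF internal_profunctorD(2)[OF H]]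
  unt_simps[OF internal_profunctorD(1)[OF H]] unt_simps[OF internal_profunctorD(2)[OF H]]
  act_simps[OF internal_profunctorD(3)[OF H]] act_simps[OF internal_profunctorD(4)[OF H]]
  span_opD(5-9)[OF internal_profunctorD(3)[OF H]] span_opD(5-9)[OF internal_profunctorD(4)[OF H]]

text \<open>The section sends h to the pair (h, 1), with the identity at the target of h. The
  condition \<open>q\<sigma>\<close> is the computation that h b paired with 1 has the class of h
  paired with b 1, that is, of (h, b).\<close>

lemma split_tensor_runit: "split_tensor E H (unit_prof (ptrg H)) H (ract H)
    (spair E H (ptrg H) (Ide E (apex H)) (unt (ptrg H) \<cdot> leg1 H))"
proof unfold_locales
  note [simp] = unit_iso_simps
  let ?Y = "ptrg H" and ?\<sigma> = "spair E H (ptrg H) (Ide E (apex H)) (unt (ptrg H) \<cdot> leg1 H)"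
  let ?p = "sp1 E H ?Y" and ?p' = "sp2 E H ?Y"
  show "internal_profunctor E H"
    by (rule H)
  show U: "internal_profunctor E (unit_prof ?Y)"
    by (rule internal_profunctor_unit_prof) simp
  show match: "ptrg H = psrc (unit_prof ?Y)" "psrc H = psrc H" "ptrg H = ptrg (unit_prof ?Y)"
    by simp_all
  show "span_op H (unit_prof ?Y) H (ract H)"
    by simp
  show "act (ract H) H (unit_prof ?Y) (ra H j b) h = act (ract H) H (unit_prof ?Y) j (la (unit_prof ?Y) b h)"
    if "composable H (psrc (unit_prof ?Y)) j b" "composable (psrc (unit_prof ?Y)) (unit_prof ?Y) b h" for j b h
    using act_laws(3)[OF H, of j b h] that by simp
  show "act (ract H) H (unit_prof ?Y) (la H a j) h = la H a (act (ract H) H (unit_prof ?Y) j h)"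
    if "composable (psrc H) H a j" "composable H (unit_prof ?Y) j h" for a j h
    using act_laws(5)[OF H, of a j h] that by simp
  show "act (ract H) H (unit_prof ?Y) j (ra (unit_prof ?Y) h c) = ra H (act (ract H) H (unit_prof ?Y) j h) c"
    if "composable H (unit_prof ?Y) j h" "composable (unit_prof ?Y) (ptrg (unit_prof ?Y)) h c" for j h c
    using act_laws(3)[OF H, of j h c] that by simp
  show "?\<sigma> \<in> Mor E" "Dom E ?\<sigma> = apex H" "Cod E ?\<sigma> = apex (spcomp E H (unit_prof ?Y))"
    by simp_all
  show "ract H \<cdot> ?\<sigma> = Ide E (apex H)"
    using act_laws(4)[OF H, of "Ide E (apex H)"] by (simp add: act_def)
  have "?\<sigma> \<cdot> ract H = spair E H ?Y (ra H ?p ?p') (unt ?Y \<cdot> (leg1 ?Y \<cdot> ?p'))"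
    using op_eq_act[of H ?Y H "ract H"] by simp
  then have "hquot E H (unit_prof ?Y) \<cdot> (?\<sigma> \<cdot> ract H) =
      hquot E H (unit_prof ?Y) \<cdot> spair E H ?Y (ra H ?p ?p') (unt ?Y \<cdot> (leg1 ?Y \<cdot> ?p'))"
    by (simp only:)
  also have "\<dots> =
      hquot E H (unit_prof ?Y) \<cdot> spair E H ?Y ?p (mm ?Y ?p' (unt ?Y \<cdot> (leg1 ?Y \<cdot> ?p')))"
    by (rule hquot_balanced[OF H U match(1), of ?p ?p' "unt ?Y \<cdot> (leg1 ?Y \<cdot> ?p')",
        unfolded unit_prof_simps unit_prof_spans]) simp_all
  also have "\<dots> = hquot E H (unit_prof ?Y) \<cdot> spair E H ?Y ?p ?p'"
    by (subst mm_laws(3)[OF internal_profunctorD(2)[OF H]]) simp_all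
  also have "\<dots> = hquot E H (unit_prof ?Y)"
    by (simp add: hquot_simps[OF H U match(1)])
  finally show "hquot E H (unit_prof ?Y) \<cdot> (?\<sigma> \<cdot> ract H) = hquot E H (unit_prof ?Y)" .
qed

text \<open>Dually, the section sends h to (1, h), with the identity at the source of h, and 1
  paired with a h has the class of 1 a paired with h, that is, of (a, h).\<close>

lemma split_tensor_lunit: "split_tensor E (unit_prof (psrc H)) H H (lact H)
    (spair E (psrc H) H (unt (psrc H) \<cdot> leg0 H) (Ide E (apex H)))"
proof unfold_locales
  note [simp] = unit_iso_simps
  let ?Y = "psrc H" and ?\<sigma> = "spair E (psrc H) H (unt (psrc H) \<cdot> leg0 H) (Ide E (apex H))"
  let ?p = "sp1 E ?Y H" and ?p' = "sp2 E ?Y H"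
  show "internal_profunctor E H"
    by (rule H)
  show U: "internal_profunctor E (unit_prof ?Y)"
    by (rule internal_profunctor_unit_prof) simp
  show match: "ptrg (unit_prof ?Y) = psrc H" "psrc H = psrc (unit_prof ?Y)" "ptrg H = ptrg H"
    by simp_all
  show "span_op (unit_prof ?Y) H H (lact H)"
    by simp
  show "act (lact H) (unit_prof ?Y) H (ra (unit_prof ?Y) j b) h = act (lact H) (unit_prof ?Y) H j (la H b h)"
    if "composable (unit_prof ?Y) (psrc H) j b" "composable (psrc H) H b h" for j b h
    using act_laws(1)[OF H, of j b h] that by simp
  show "act (lact H) (unit_prof ?Y) H (la (unit_prof ?Y) a j) h = la H a (act (lact H) (unit_prof ?Y) H j h)"
    if "composable (psrc (unit_prof ?Y)) (unit_prof ?Y) a j" "composable (unit_prof ?Y) H j h" for a j h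
    using act_laws(1)[OF H, of a j h] that by simp
  show "act (lact H) (unit_prof ?Y) H j (ra H h c) = ra H (act (lact H) (unit_prof ?Y) H j h) c"
    if "composable (unit_prof ?Y) H j h" "composable H (ptrg H) h c" for j h c
    using act_laws(5)[OF H, of j h c] that by simp
  show "?\<sigma> \<in> Mor E" "Dom E ?\<sigma> = apex H" "Cod E ?\<sigma> = apex (spcomp E (unit_prof ?Y) H)"
    by simp_all
  show "lact H \<cdot> ?\<sigma> = Ide E (apex H)"
    using act_laws(2)[OF H, of "Ide E (apex H)"] by (simp add: act_def)
  have "?\<sigma> \<cdot> lact H = spair E ?Y H (unt ?Y \<cdot> (leg0 ?Y \<cdot> ?p)) (la H ?p ?p')"
    using op_eq_act[of ?Y H H "lact H"] by simp
  then have "hquot E (unit_prof ?Y) H \<cdot> (?\<sigma> \<cdot> lact H) =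
      hquot E (unit_prof ?Y) H \<cdot> spair E ?Y H (unt ?Y \<cdot> (leg0 ?Y \<cdot> ?p)) (la H ?p ?p')"
    by (simp only:)
  also have "\<dots> =
      hquot E (unit_prof ?Y) H \<cdot> spair E ?Y H (mm ?Y (unt ?Y \<cdot> (leg0 ?Y \<cdot> ?p)) ?p) ?p'"
    by (rule hquot_balanced[OF U H match(1), of "unt ?Y \<cdot> (leg0 ?Y \<cdot> ?p)" ?p ?p',
        unfolded unit_prof_simps unit_prof_spans, symmetric]) simp_all
  also have "\<dots> = hquot E (unit_prof ?Y) H \<cdot> spair E ?Y H ?p ?p'"
    by (subst mm_laws(2)[OF internal_profunctorD(1)[OF H]]) simp_all
  also have "\<dots> = hquot E (unit_prof ?Y) H"
    by (simp add: hquot_simps[OF U H match(1)])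
  finally show "hquot E (unit_prof ?Y) H \<cdot> (?\<sigma> \<cdot> lact H) = hquot E (unit_prof ?Y) H" .
qed

end

end

subsection \<open>The two-dimensional property\<close>

locale tabulated_profunctor_coequalisers = tabulated_profunctor E J + profunctor_category E
  for E :: "('o, 'm, 'x) cat_choice_scheme" (structure) and J
begin

text \<open>On an element h the three cells act in turn: h goes to the class of (h, 1), then to the
  class of (\<xi>(h), \<psi>(1)), then to the product \<xi>(h) \<psi>(1), where 1 is the identity at
  the target of h.\<close>

lemma cmap_left_composite:
  assumes H: "internal_profunctor E H"
    and \<xi>: "internal_cell E \<xi>" "ctop \<xi> = H" "cbot \<xi> = unit_prof A" "clft \<xi> = f" "crgt \<xi> = g"
    and \<psi>: "internal_cell E \<psi>" "ctop \<psi> = unit_prof (ptrg H)" "cbot \<psi> = J" "clft \<psi> = g" "crgt \<psi> = k"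
  shows "cmap (vcomp (Prof E) (lunit (Prof E) J) (vcomp (Prof E) (hcell (Prof E) \<xi> \<psi>) (vinv (Prof E) (runit (Prof E) H)))) =
    la J (cmap \<xi>) (cmap \<psi> \<cdot> (unt (ptrg H) \<cdot> leg1 H))"
proof -
  let ?Y = "ptrg H" and ?\<sigma> = "spair E H (ptrg H) (Ide E (apex H)) (unt (ptrg H) \<cdot> leg1 H)"
  have m: "ptrg H = psrc (unit_prof ?Y)" "ptrg (unit_prof A) = psrc J"
    by simp_all
  note [simp] = unit_iso_simps[OF H] internal_cellD(9-13)[OF \<xi>, simplified] internal_cellD(9-13)[OF \<psi>, simplified]
    cell_simps(1,2)[OF \<psi>, simplified] internal_functorD(3-8)[OF internal_cellD(6-8)[OF \<xi>], simplified]
  have "vinv (Prof E) (runit (Prof E) H) = id_pcell E H (hcomp_prof E H (unit_prof ?Y)) (hquot E H (unit_prof ?Y) \<cdot> ?\<sigma>)"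
    using split_tensor.vinv_split[OF split_tensor_runit[OF H]] by simp
  then have "cmap (vcomp (Prof E) (hcell (Prof E) \<xi> \<psi>) (vinv (Prof E) (runit (Prof E) H))) =
      cmap (hcell (Prof E) \<xi> \<psi>) \<cdot> (hquot E H (unit_prof ?Y) \<cdot> spair E H (unit_prof ?Y) (Ide E (apex H)) (unt ?Y \<cdot> leg1 H))"
    by (simp del: Prof_horizontal_simps)
  also have "\<dots> = hquot E (unit_prof A) J \<cdot> spair E (unit_prof A) J (cmap \<xi> \<cdot> Ide E (apex H)) (cmap \<psi> \<cdot> (unt ?Y \<cdot> leg1 H))"
    by (rule hcell_simps(4)[OF \<xi> \<psi> m]) simp
  finally have "cmap (vcomp (Prof E) (lunit (Prof E) J) (vcomp (Prof E) (hcell (Prof E) \<xi> \<psi>) (vinv (Prof E) (runit (Prof E) H)))) =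
    desc E (hquot E (unit_prof A) J) (lact J) \<cdot> (hquot E (unit_prof A) J \<cdot> spair E A J (cmap \<xi>) (cmap \<psi> \<cdot> (unt ?Y \<cdot> leg1 H)))"
    by (simp del: Prof_horizontal_simps(1,3,4))
  also have "\<dots> = la J (cmap \<xi>) (cmap \<psi> \<cdot> (unt ?Y \<cdot> leg1 H))"
    by (subst split_tensor.split_r_quot[OF split_tensor_lunit[OF J]]) simp_all
  finally show ?thesis .
qed

text \<open>Here h goes to the class of (1, h), then to the class of (\<phi>(1), \<xi>(h)), then to
  \<phi>(1) \<xi>(h), with the identity at the source of h.\<close>

lemma cmap_right_composite:
  assumes H: "internal_profunctor E H"
    and \<phi>: "internal_cell E \<phi>" "ctop \<phi> = unit_prof (psrc H)" "cbot \<phi> = J" "clft \<phi> = f" "crgt \<phi> = g"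
    and \<xi>: "internal_cell E \<xi>" "ctop \<xi> = H" "cbot \<xi> = unit_prof B" "clft \<xi> = g" "crgt \<xi> = k"
  shows "cmap (vcomp (Prof E) (runit (Prof E) J) (vcomp (Prof E) (hcell (Prof E) \<phi> \<xi>) (vinv (Prof E) (lunit (Prof E) H)))) =
    ra J (cmap \<phi> \<cdot> (unt (psrc H) \<cdot> leg0 H)) (cmap \<xi>)"
proof -
  let ?X = "psrc H" and ?\<sigma> = "spair E (psrc H) H (unt (psrc H) \<cdot> leg0 H) (Ide E (apex H))"
  have m: "ptrg (unit_prof ?X) = psrc H" "ptrg J = psrc (unit_prof B)"
    by simp_all
  note [simp] = unit_iso_simps[OF H] internal_cellD(9-13)[OF \<xi>, simplified] internal_cellD(9-13)[OF \<phi>, simplified]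
    cell_simps(1,2)[OF \<phi>, simplified] internal_functorD(3-8)[OF internal_cellD(3-5)[OF \<xi>], simplified]
  have "vinv (Prof E) (lunit (Prof E) H) = id_pcell E H (hcomp_prof E (unit_prof ?X) H) (hquot E (unit_prof ?X) H \<cdot> ?\<sigma>)"
    using split_tensor.vinv_split[OF split_tensor_lunit[OF H]] by simp
  then have "cmap (vcomp (Prof E) (hcell (Prof E) \<phi> \<xi>) (vinv (Prof E) (lunit (Prof E) H))) =
      cmap (hcell (Prof E) \<phi> \<xi>) \<cdot> (hquot E (unit_prof ?X) H \<cdot> spair E (unit_prof ?X) H (unt ?X \<cdot> leg0 H) (Ide E (apex H)))"
    by (simp del: Prof_horizontal_simps)
  also have "\<dots> = hquot E J (unit_prof B) \<cdot> spair E J (unit_prof B) (cmap \<phi> \<cdot> (unt ?X \<cdot> leg0 H)) (cmap \<xi> \<cdot> Ide E (apex H))"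
    by (rule hcell_simps(4)[OF \<phi> \<xi> m]) simp
  finally have "cmap (vcomp (Prof E) (runit (Prof E) J) (vcomp (Prof E) (hcell (Prof E) \<phi> \<xi>) (vinv (Prof E) (lunit (Prof E) H)))) =
    desc E (hquot E J (unit_prof B)) (ract J) \<cdot> (hquot E J (unit_prof B) \<cdot> spair E J B (cmap \<phi> \<cdot> (unt ?X \<cdot> leg0 H)) (cmap \<xi>))"
    by (simp del: Prof_horizontal_simps(1,2,4))
  also have "\<dots> = ra J (cmap \<phi> \<cdot> (unt ?X \<cdot> leg0 H)) (cmap \<xi>)"
    by (subst split_tensor.split_r_quot[OF split_tensor_runit[OF J]]) simp_all
  finally show ?thesis .
qed

text \<open>The image of an identity is an identity square, whose diagonal is the object itself.
  This turns the values on identities in the two composites above into object parts of the factoring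
  functors.\<close>

lemma tab_cell_functor_unt:
  assumes f: "internal_functor E f" "fsrc f = X" "ftrg f = tab" and w: "w \<in> Mor E" "Cod E w = base X"
  shows "(la J tu tx \<cdot> far f) \<cdot> (unt X \<cdot> w) = fob f \<cdot> w"
proof -
  note [simp] = internal_functorD(3-8)[OF f, simplified] internal_categoryD[OF internal_functorD(1)[OF f]] w
  have "(la J tu tx \<cdot> far f) \<cdot> (unt X \<cdot> w) = la J tu tx \<cdot> (far f \<cdot> (unt X \<cdot> w))"
    by (rule Comp_Comp) simp_all
  also have "\<dots> = la J tu tx \<cdot> (unt tab \<cdot> (fob f \<cdot> w))"
    by (simp only: functor_simps(3)[OF f w])
  also have "\<dots> = fob f \<cdot> w"
    by simp
  finally show ?thesis .
qed

lemma tabulation_2dim: "tabulation_2dim (Prof E) J tab tab_cell"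
  unfolding tabulation_2dim_def
proof (intro allI impI)
  fix X Y \<phi> \<psi> \<phi>\<^sub>A \<phi>\<^sub>B \<psi>\<^sub>A \<psi>\<^sub>B \<phi>' \<psi>' H \<xi>\<^sub>A \<xi>\<^sub>B
  assume "X \<in> Ob (Vert (Prof E))" "Y \<in> Ob (Vert (Prof E))"
    and "is_cell (Prof E) \<phi> (hunit (Prof E) X) J \<phi>\<^sub>A \<phi>\<^sub>B" "is_cell (Prof E) \<psi> (hunit (Prof E) Y) J \<psi>\<^sub>A \<psi>\<^sub>B"
    and "\<phi>' \<in> hom (Vert (Prof E)) X tab" and \<phi>_eq: "vcomp (Prof E) tab_cell (ucell (Prof E) \<phi>') = \<phi>"
    and "\<psi>' \<in> hom (Vert (Prof E)) Y tab" and \<psi>_eq: "vcomp (Prof E) tab_cell (ucell (Prof E) \<psi>') = \<psi>"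
    and "H \<in> Hor (Prof E)" "hsrc (Prof E) H = X" "htrg (Prof E) H = Y"
    and "is_cell (Prof E) \<xi>\<^sub>A H (hunit (Prof E) (hsrc (Prof E) J)) \<phi>\<^sub>A \<psi>\<^sub>A"
    and "is_cell (Prof E) \<xi>\<^sub>B H (hunit (Prof E) (htrg (Prof E) J)) \<phi>\<^sub>B \<psi>\<^sub>B"
    and compat: "vcomp (Prof E) (lunit (Prof E) J) (vcomp (Prof E) (hcell (Prof E) \<xi>\<^sub>A \<psi>) (vinv (Prof E) (runit (Prof E) H))) =
      vcomp (Prof E) (runit (Prof E) J) (vcomp (Prof E) (hcell (Prof E) \<phi> \<xi>\<^sub>B) (vinv (Prof E) (lunit (Prof E) H)))"
  then have H: "internal_profunctor E H" and XY: "X = psrc H" "Y = ptrg H"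
    and \<phi>: "internal_cell E \<phi>" "ctop \<phi> = unit_prof (psrc H)" "cbot \<phi> = J" "clft \<phi> = \<phi>\<^sub>A" "crgt \<phi> = \<phi>\<^sub>B"
    and \<psi>: "internal_cell E \<psi>" "ctop \<psi> = unit_prof (ptrg H)" "cbot \<psi> = J" "clft \<psi> = \<psi>\<^sub>A" "crgt \<psi> = \<psi>\<^sub>B"
    and \<phi>': "internal_functor E \<phi>'" "fsrc \<phi>' = psrc H" "ftrg \<phi>' = tab"
    and \<psi>': "internal_functor E \<psi>'" "fsrc \<psi>' = ptrg H" "ftrg \<psi>' = tab"
    and \<xi>A: "internal_cell E \<xi>\<^sub>A" "ctop \<xi>\<^sub>A = H" "cbot \<xi>\<^sub>A = unit_prof A" "clft \<xi>\<^sub>A = \<phi>\<^sub>A" "crgt \<xi>\<^sub>A = \<psi>\<^sub>A"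
    and \<xi>B: "internal_cell E \<xi>\<^sub>B" "ctop \<xi>\<^sub>B = H" "cbot \<xi>\<^sub>B = unit_prof B" "clft \<xi>\<^sub>B = \<phi>\<^sub>B" "crgt \<xi>\<^sub>B = \<psi>\<^sub>B"
    unfolding is_cell_def hom_Cat_int by (auto simp only: Prof_simps mem_Collect_eq)
  \<comment> \<open>The vertical boundaries are composites of the factoring functors with the two
    projections. Spelling this out expresses the legs and the equivariance of
    \<open>\<xi>\<^sub>A\<close> and \<open>\<xi>\<^sub>B\<close> through \<open>\<phi>'\<close> and
    \<open>\<psi>'\<close>, the form needed for a cell into the tabulation.\<close>
  have func: "\<phi>\<^sub>A = \<lparr>fsrc = psrc H, ftrg = A, fob = leg0 J \<cdot> fob \<phi>', far = tu \<cdot> far \<phi>'\<rparr>"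
    "\<phi>\<^sub>B = \<lparr>fsrc = psrc H, ftrg = B, fob = leg1 J \<cdot> fob \<phi>', far = tv \<cdot> far \<phi>'\<rparr>"
    "\<psi>\<^sub>A = \<lparr>fsrc = ptrg H, ftrg = A, fob = leg0 J \<cdot> fob \<psi>', far = tu \<cdot> far \<psi>'\<rparr>"
    "\<psi>\<^sub>B = \<lparr>fsrc = ptrg H, ftrg = B, fob = leg1 J \<cdot> fob \<psi>', far = tv \<cdot> far \<psi>'\<rparr>"
    using arg_cong[OF \<phi>_eq, of clft] arg_cong[OF \<phi>_eq, of crgt] \<phi>(4,5) \<phi>'(2)
      arg_cong[OF \<psi>_eq, of clft] arg_cong[OF \<psi>_eq, of crgt] \<psi>(4,5) \<psi>'(2)
    by (simp_all add: tab_cell_def proj_A_def proj_B_def)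
  define a b where "a = cmap \<xi>\<^sub>A" and "b = cmap \<xi>\<^sub>B"
  note [simp] = unit_iso_simps[OF H] internal_functorD(3-8)[OF \<phi>'] internal_functorD(3-8)[OF \<psi>']
    functor_simps(1,2)[OF \<phi>', simplified] functor_simps(1,2)[OF \<psi>', simplified]
    internal_functorD(9,10)[OF \<phi>', simplified] internal_functorD(9,10)[OF \<psi>', simplified]
    internal_cellD(9-13)[OF \<xi>A, unfolded func, simplified, folded a_def] internal_cellD(9-13)[OF \<xi>B, unfolded func, simplified, folded b_def]
    cell_simps[OF \<xi>A, unfolded func, simplified, folded a_def] cell_simps[OF \<xi>B, unfolded func, simplified, folded b_def]
  have c: "cmap \<phi> \<cdot> (unt (psrc H) \<cdot> leg0 H) = fob \<phi>' \<cdot> leg0 H" "cmap \<psi> \<cdot> (unt (ptrg H) \<cdot> leg1 H) = fob \<psi>' \<cdot> leg1 H"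
  proof -
    have "cmap \<phi> = la J tu tx \<cdot> far \<phi>'" "cmap \<psi> = la J tu tx \<cdot> far \<psi>'"
      using arg_cong[OF \<phi>_eq, of cmap] arg_cong[OF \<psi>_eq, of cmap] by (simp_all add: tab_cell_def)
    then show "cmap \<phi> \<cdot> (unt (psrc H) \<cdot> leg0 H) = fob \<phi>' \<cdot> leg0 H"
      "cmap \<psi> \<cdot> (unt (ptrg H) \<cdot> leg1 H) = fob \<psi>' \<cdot> leg1 H"
      using tab_cell_functor_unt[OF \<phi>', of "leg0 H"] tab_cell_functor_unt[OF \<psi>', of "leg1 H"] by simp_all
  qed
  have compat': "la J a (fob \<psi>' \<cdot> leg1 H) = ra J (fob \<phi>' \<cdot> leg0 H) b"
    using arg_cong[OF compat, of cmap]
    by (simp only: cmap_left_composite[OF H \<xi>A \<psi>] cmap_right_composite[OF H \<phi> \<xi>B] c a_def b_def)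
  have sq: "square a (fob \<psi>' \<cdot> leg1 H) (fob \<phi>' \<cdot> leg0 H) b"
    using compat' by (simp add: square_def)
  define z where "z = tpair a (fob \<psi>' \<cdot> leg1 H) (fob \<phi>' \<cdot> leg0 H) b"
  note z [simp] = tpair_simps[OF sq, folded z_def, simplified]
  have zw: "z \<cdot> w = tpair (a \<cdot> w) (fob \<psi>' \<cdot> (leg1 H \<cdot> w)) (fob \<phi>' \<cdot> (leg0 H \<cdot> w)) (b \<cdot> w)"
    "square (a \<cdot> w) (fob \<psi>' \<cdot> (leg1 H \<cdot> w)) (fob \<phi>' \<cdot> (leg0 H \<cdot> w)) (b \<cdot> w)"
    if "w \<in> Mor E" "Cod E w = apex H" for w
    using that tpair_Comp[OF sq, of w] square_Comp[OF sq, of w] by (simp_all add: z_def)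
  define \<xi> where "\<xi> = \<lparr>ctop = H, cbot = unit_prof tab, clft = \<phi>', crgt = \<psi>', cmap = z\<rparr>"
  have \<xi>: "internal_cell E \<xi>"
    unfolding \<xi>_def
  proof (rule internal_cellI)
    fix u w
    assume c: "composable (psrc H) H u w"
    have "far \<phi>' \<cdot> u \<in> Mor E" "Cod E (far \<phi>' \<cdot> u) = Q"
      using c by simp_all
    then show "la (unit_prof tab) (far \<phi>' \<cdot> u) (z \<cdot> w) = z \<cdot> la H u w"
      using c zw by simp
  next
    fix u w
    assume c: "composable H (ptrg H) w u"
    then show "ra (unit_prof tab) (z \<cdot> w) (far \<psi>' \<cdot> u) = z \<cdot> ra H w u"
      using zw zw(2)[of w] by simp
  qed (simp_all add: H \<phi>' \<psi>' internal_profunctor_unit_prof)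
  have ex: "is_cell (Prof E) \<xi> H (hunit (Prof E) tab) \<phi>' \<psi>' \<and>
      vcomp (Prof E) (ucell (Prof E) (sqlft (Prof E) tab_cell)) \<xi> = \<xi>\<^sub>A \<and>
      vcomp (Prof E) (ucell (Prof E) (sqrgt (Prof E) tab_cell)) \<xi> = \<xi>\<^sub>B"
    using \<xi> \<xi>A \<xi>B func \<phi>' \<psi>'
    by (simp add: is_cell_def \<xi>_def tab_cell_def proj_A_def proj_B_def a_def b_def)
  have unique: "\<zeta> = \<xi>"
    if \<zeta>_cell: "is_cell (Prof E) \<zeta> H (hunit (Prof E) tab) \<phi>' \<psi>'"
      and \<zeta>_A: "vcomp (Prof E) (ucell (Prof E) (sqlft (Prof E) tab_cell)) \<zeta> = \<xi>\<^sub>A"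
      and \<zeta>_B: "vcomp (Prof E) (ucell (Prof E) (sqrgt (Prof E) tab_cell)) \<zeta> = \<xi>\<^sub>B" for \<zeta>
  proof -
    have \<zeta>: "internal_cell E \<zeta>" "ctop \<zeta> = H" "cbot \<zeta> = unit_prof tab" "clft \<zeta> = \<phi>'" "crgt \<zeta> = \<psi>'"
      using \<zeta>_cell unfolding is_cell_def by (auto simp only: Prof_simps mem_Collect_eq)
    have 1: "tu \<cdot> cmap \<zeta> = a" "tv \<cdot> cmap \<zeta> = b"
      using arg_cong[OF \<zeta>_A, of cmap] arg_cong[OF \<zeta>_B, of cmap]
      by (simp_all add: tab_cell_def proj_A_def proj_B_def a_def b_def)
    \<comment> \<open>The sides \<open>tu\<close> and \<open>tv\<close> are prescribed by
      \<open>\<xi>\<^sub>A\<close> and \<open>\<xi>\<^sub>B\<close>. The edges \<open>tx\<close> and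
      \<open>ty\<close> are the legs of the unit of \<open>tab\<close>, hence fixed by the vertical
      boundary of \<zeta>.\<close>
    have "cmap \<zeta> = z"
      by (rule tpair_eqI) (use 1 internal_cellD(9-13)[OF \<zeta>] in simp_all)
    then show ?thesis
      using \<zeta> by (simp add: \<xi>_def)
  qed
  show "\<exists>!\<xi>'. is_cell (Prof E) \<xi>' H (hunit (Prof E) tab) \<phi>' \<psi>' \<and>
      vcomp (Prof E) (ucell (Prof E) (sqlft (Prof E) tab_cell)) \<xi>' = \<xi>\<^sub>A \<and>
      vcomp (Prof E) (ucell (Prof E) (sqrgt (Prof E) tab_cell)) \<xi>' = \<xi>\<^sub>B"
    by (rule ex1I[of _ \<xi>]; use ex unique in blast)
qed

end

theorem proposition5p15:
  fixes E :: "('o, 'm) cat_choice"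
  assumes "category E"
    and "has_pullbacks E"
    and "has_coequalisers E"
    and "pullbacks_preserve_coequalisers E"
  shows "admits_opcartesian_tabulations (Prof E)"
  unfolding admits_opcartesian_tabulations_def
proof
  fix J
  assume "J \<in> Hor (Prof E)"
  then interpret tabulated_profunctor_coequalisers E J
    using assms by (simp add: tabulated_profunctor_coequalisers_def tabulated_profunctor_def
      tabulated_profunctor_axioms_def profunctor_category_def profunctor_category_axioms_def
      pullback_category_def pullback_category_axioms_def)
  have "is_tabulation (Prof E) J tab tab_cell"
    using internal_category_tab internal_cell_tab_cell tabulation_1dim tabulation_2dim
    by (simp add: is_tabulation_def is_cell_def tab_cell_def)
  then show "\<exists>T \<pi>. is_tabulation (Prof E) J T \<pi> \<and> opcartesian (Prof E) \<pi>"
    using opcartesian_tab_cell by blast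
qed

end
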